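(* Let $\lambda\ge 0$, $\eta$ and $\alpha_1,\dots,\alpha_\lambda$ be integers with $0<\alpha_1<\cdots<\alpha_\lambda<\eta$ and $\alpha_i=\eta-\alpha_{\lambda+1-i}$ for $1\le i\le\lambda$, and let $k,r$ be integers with $k\ge r\ge\lambda\ge0$ and $k-1>\lambda$. Then for every $n\ge0$, \[ \overline{A}_0(\alpha_1,\ldots,\alpha_\lambda;\eta,k,r;n)=\overline{B}_0(\alpha_1,\ldots,\alpha_\lambda;\eta,k,r;n). \]
   Context: Overpartitions: an overpartition of $n$ is a partition of $n$ in which the first occurrence of a part size may be overlined. Parts are totally ordered by $1<\bar1<2<\bar2<3<\cdots$; an overpartition is written $\pi=(\pi_1,\dots,\pi_s)$ with $\pi_1\ge\cdots\ge\pi_s$ in this order, and all inequalities between parts (and expressions $x\pm\eta$) are taken in this order, where $x\pm\eta$ denotes the part of size $|x|\pm\eta$ which is overlined iff $x$ is. $[x/\eta]=\lfloor|x|/\eta\rfloor$. $\overline{V}_\pi(N)$ is the number of overlined parts of $\pi$ that are $\le N$. $\overline{B}_0(\alpha_1,\ldots,\alpha_\lambda;\eta,k,r;n)$ is the number of overpartitions $\pi=(\pi_1,\dots,\pi_s)$ of $n$ such that: (1) every part has size $\equiv 0,\alpha_1,\ldots,\alpha_\lambda\pmod\eta$; (2) only parts whose size is a multiple of $\eta$ may be non-overlined; (3) $\pi_i\ge\pi_{i+k-1}+\eta$ whenever $i+k-1\le s$, with strict inequality if $\pi_i$ is non-overlined; (4) at most $r-1$ of the parts satisfy $\pi_i\le\eta$;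 (5) whenever $i+k-2\le s$ and $\pi_i\le\pi_{i+k-2}+\eta$ with strict inequality if $\pi_i$ is overlined, then $[\pi_i/\eta]+\cdots+[\pi_{i+k-2}/\eta]\equiv r-1+\overline{V}_\pi(\pi_i)\pmod{2}$. $\overline{A}_0(\alpha_1,\ldots,\alpha_\lambda;\eta,k,r;n)$ is the number of overpartitions of $n$ all of whose parts have size $\equiv0,\alpha_1,\ldots,\alpha_\lambda\pmod\eta$ and such that: if $\lambda$ is even, only multiples of $\eta$ may be non-overlined and no non-overlined part is $\equiv 0,\pm\eta(r-\lambda/2)\pmod{\eta(2k-\lambda-1)}$; if $\lambda$ is odd (so $\eta$ is even), only multiples of $\eta/2$ may be non-overlined, no non-overlined part is $\equiv\eta\pmod{2\eta}$, no non-overlined part is $\equiv0,\pm\eta(2r-\lambda)/2\pmod{\eta(2k-\lambda-1)}$, and no overlined part is $\equiv\eta/2\pmod\eta$.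
   Formalization: The formal theorem also assumes r ≥ 1: for r = λ = 0 the claim fails at n = 0, since condition (4) allows at most −1 parts, so B̄₀ = 0, while Ā₀ counts the empty overpartition, so Ā₀ = 1. *)

theory Defs
  imports "HOL-Number_Theory.Cong"
begin

datatype part = Part (psize: nat) (overlined: bool)

text \<open>The order on parts is 1 < overlined 1 < 2 < overlined 2 < ....\<close>

instantiation part :: linorder
begin

definition less_eq_part :: "part \<Rightarrow> part \<Rightarrow> bool" where
  "p \<le> q \<longleftrightarrow> psize p < psize q \<or> (psize p = psize q \<and> (overlined p \<longrightarrow> overlined q))"

definition less_part :: "part \<Rightarrow> part \<Rightarrow> bool" where
  "p < q \<longleftrightarrow> psize p < psize q \<or> (psize p = psize q \<and> \<not> overlined p \<and> overlined q)"

instance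
  by standard (auto simp: less_eq_part_def less_part_def intro: part.expand)

end

definition shift :: "part \<Rightarrow> nat \<Rightarrow> part" where
  "shift p d = Part (psize p + d) (overlined p)"

text \<open>
  An overpartition is a weakly decreasing list of parts. At most one copy of each size is
  overlined, and the order on parts puts the overlined copy before the others of its size, so
  that it is the first occurrence.
\<close>

definition overpartitions :: "nat \<Rightarrow> part list set" where
  "overpartitions n = {\<pi>.
     sorted_wrt (\<ge>) \<pi> \<and>
     (\<forall>p\<in>set \<pi>. 0 < psize p) \<and>
     (\<forall>m. count_list \<pi> (Part m True) \<le> 1) \<and>
     sum_list (map psize \<pi>) = n}"

definition overlined_upto :: "part list \<Rightarrow> part \<Rightarrow> nat" where
  "overlined_upto \<pi> N = length (filter (\<lambda>p. overlined p \<and> p \<le> N) \<pi>)"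

definition allowed_size :: "nat \<Rightarrow> nat \<Rightarrow> (nat \<Rightarrow> nat) \<Rightarrow> nat \<Rightarrow> bool" where
  "allowed_size l \<eta> \<alpha> m \<longleftrightarrow> [m = 0] (mod \<eta>) \<or> (\<exists>i\<in>{1..l}. [m = \<alpha> i] (mod \<eta>))"

text \<open>
  The list index starts at 0, so \<open>\<pi> ! i\<close> is the part \<open>\<pi>\<close> with subscript \<open>i + 1\<close>, and the bounds
  on \<open>i\<close> are strict. The natural subtractions \<open>i + k - 1\<close> and \<open>i + k - 2\<close> do not truncate for
  \<open>k \<ge> 2\<close>, while \<open>r - 1\<close> is taken in the integers. In the fourth condition the bound is the non-overlined part of size \<open>\<eta>\<close>, so an overlined \<open>\<eta>\<close> is not counted.
\<close>

definition B0_set ::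
    "nat \<Rightarrow> (nat \<Rightarrow> nat) \<Rightarrow> nat \<Rightarrow> nat \<Rightarrow> nat \<Rightarrow> nat \<Rightarrow> part list set" where
  "B0_set l \<alpha> \<eta> k r n = {\<pi> \<in> overpartitions n.
     (\<forall>p\<in>set \<pi>. allowed_size l \<eta> \<alpha> (psize p)) \<and>
     (\<forall>p\<in>set \<pi>. \<not> overlined p \<longrightarrow> \<eta> dvd psize p) \<and>
     (\<forall>i. i + k - 1 < length \<pi> \<longrightarrow>
        \<pi> ! i \<ge> shift (\<pi> ! (i + k - 1)) \<eta> \<and>
        (\<not> overlined (\<pi> ! i) \<longrightarrow> \<pi> ! i > shift (\<pi> ! (i + k - 1)) \<eta>)) \<and>
     int (length (filter (\<lambda>p. p \<le> Part \<eta> False) \<pi>)) \<le> int r - 1 \<and>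
     (\<forall>i. i + k - 2 < length \<pi> \<and>
          \<pi> ! i \<le> shift (\<pi> ! (i + k - 2)) \<eta> \<and>
          (overlined (\<pi> ! i) \<longrightarrow> \<pi> ! i < shift (\<pi> ! (i + k - 2)) \<eta>) \<longrightarrow>
        [int (\<Sum>j = i..i + k - 2. psize (\<pi> ! j) div \<eta>)
           = int r - 1 + int (overlined_upto \<pi> (\<pi> ! i))] (mod 2))}"

definition B0 :: "nat \<Rightarrow> (nat \<Rightarrow> nat) \<Rightarrow> nat \<Rightarrow> nat \<Rightarrow> nat \<Rightarrow> nat \<Rightarrow> nat" where
  "B0 l \<alpha> \<eta> k r n = card (B0_set l \<alpha> \<eta> k r n)"

text \<open>
  The integer divisions by 2 below are exact in the cases of interest: the first by the parity
  of \<open>l\<close>, the others because \<open>\<eta>\<close> is even when \<open>l\<close> is odd and the residues \<open>\<alpha>\<close> are symmetric.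
\<close>

definition A0_part ::
    "nat \<Rightarrow> nat \<Rightarrow> nat \<Rightarrow> nat \<Rightarrow> part \<Rightarrow> bool" where
  "A0_part l \<eta> k r p \<longleftrightarrow>
     (let m = int (psize p); e = int \<eta>; M = e * (2 * int k - int l - 1) in
      if even l then
        (\<not> overlined p \<longrightarrow>
           e dvd m \<and>
           \<not> [m = 0] (mod M) \<and>
           \<not> [m = e * (int r - int l div 2)] (mod M) \<and>
           \<not> [m = - (e * (int r - int l div 2))] (mod M))
      else
        (\<not> overlined p \<longrightarrow>
           e div 2 dvd m \<and>
           \<not> [m = e] (mod (2 * e)) \<and>
           \<not> [m = 0] (mod M) \<and>
           \<not> [m = e * (2 * int r - int l) div 2] (mod M) \<and>
           \<not> [m = - (e * (2 * int r - int l) div 2)] (mod M)) \<and>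
        (overlined p \<longrightarrow> \<not> [m = e div 2] (mod e)))"

definition A0_set ::
    "nat \<Rightarrow> (nat \<Rightarrow> nat) \<Rightarrow> nat \<Rightarrow> nat \<Rightarrow> nat \<Rightarrow> nat \<Rightarrow> part list set" where
  "A0_set l \<alpha> \<eta> k r n = {\<pi> \<in> overpartitions n.
     \<forall>p\<in>set \<pi>. allowed_size l \<eta> \<alpha> (psize p) \<and> A0_part l \<eta> k r p}"

definition A0 :: "nat \<Rightarrow> (nat \<Rightarrow> nat) \<Rightarrow> nat \<Rightarrow> nat \<Rightarrow> nat \<Rightarrow> nat \<Rightarrow> nat" where
  "A0 l \<alpha> \<eta> k r n = card (A0_set l \<alpha> \<eta> k r n)"

end

theory Submission
  imports "HOL-Analysis.Analysis" Defs
begin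

text \<open>
  Fix a real \<open>0 < Q < 1\<close> and put \<open>q = Q ^ \<eta>\<close>. The conditions defining \<open>B0\<close> only concern windows of
  length \<open>\<eta>\<close>, so that the generating function is computed by a particle carrier which visits the
  possible parts in increasing order, \<open>l + 2\<close> of them per period: its content is the room left in
  the current window, and one bit keeps track of the parity condition. Summing out the overlined
  multiples of \<open>\<eta>\<close> removes the bit, replaces \<open>k\<close> by \<open>k - 1\<close> and gives a factor \<open>(-q; q)\<close>.
  In the remaining model adjacent sites may be exchanged by Yang-Baxter type relations. They show
  that the generating function \<open>Z\<close> with a pair of residues of weights \<open>y\<close> and \<open>q / y\<close> satisfies
  \<open>Z y = y * Z (q * y)\<close>; hence \<open>Z y / ((-y; q) (-q/y; q))\<close> is invariant under \<open>y \<mapsto> q * y\<close>, and its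
  limit at infinity is the model without this pair. By symmetry of the residues only the cases
  \<open>l = 0\<close> and \<open>l = 1\<close> are left, where the generating function is an explicit series that the Jacobi
  triple product turns into a product. Thus the generating functions of \<open>A0\<close> and \<open>B0\<close> agree for all
  \<open>Q\<close>, and so do their coefficients.
\<close>

section \<open>The carrier model\<close>

text \<open>The parity condition involves all overlined parts up to the window, which no finite
  window sees. Modulo 2, however, it can be updated slot by slot, and an odd value amounts to the
  loss of one unit of capacity; this is the bit. The relation \<open>Z y = y * Z (q * y)\<close>
  fixes \<open>Z\<close> only up to a factor invariant under \<open>y \<mapsto> q * y\<close>, and
  it is the asymptotics along \<open>y / q ^ n\<close> that determines this factor. Hence the
  weights are arbitrary positive reals, not only the powers of \<open>Q\<close> that occur. A site
  that is almost always occupied binds one particle, so the removal of a pair lowers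
  \<open>k\<close> and \<open>r\<close> by 1 and \<open>l\<close> by 2; the numbers
  \<open>2 * k - l\<close> and \<open>2 * r - l\<close>, on which the product depends, do not
  change. The hypothesis \<open>l \<le> r\<close> keeps the carrier from running empty on the
  remaining empty sites, which the functional equation requires. Removing the bit lowers
  \<open>k\<close> but not \<open>r\<close>, so that \<open>r = k\<close> is exceptional: there
  \<open>k - 1\<close> takes the place of \<open>r\<close>, and the symmetry of the theta product
  under complementary exponents gives the same answer.\<close>

text \<open>
  A site has a weight per particle and a current number of particles; an \<open>Fm\<close> site holds at most
  one particle (after the first visit), a \<open>Bo\<close> site any number. The carrier with content \<open>C\<close> may
  leave particles it has just picked up on an \<open>Fm\<close> site, but not on a \<open>Bo\<close> site.
  In each sweep all weights are multiplied by \<open>q\<close>.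
\<close>

datatype site = Fm real nat | Bo real nat

fun run :: "real \<Rightarrow> site list \<Rightarrow> nat \<Rightarrow> (site list \<Rightarrow> nat \<Rightarrow> real) \<Rightarrow> real" where
  "run q [] C K = K [] C"
| "run q (Fm w a # S) C K = run q S (C + a) (\<lambda>S'. K (Fm (q * w) 0 # S'))
     + (if C + a = 0 then 0 else w * run q S (C + a - 1) (\<lambda>S'. K (Fm (q * w) 1 # S')))"
| "run q (Bo z f # S) C K = (\<Sum>i\<le>C. z ^ i * run q S (C - i + f) (\<lambda>S'. K (Bo (q * z) i # S')))"

primrec sweeps :: "real \<Rightarrow> nat \<Rightarrow> site list \<Rightarrow> nat \<Rightarrow> real" where
  "sweeps q 0 S C = 1"
| "sweeps q (Suc T) S C = run q S C (sweeps q T)"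

fun skel :: "site \<Rightarrow> bool \<times> real" where
  "skel (Fm w a) = (True, w)"
| "skel (Bo z f) = (False, z)"

fun occ :: "site \<Rightarrow> nat" where
  "occ (Fm w a) = a"
| "occ (Bo z f) = f"

definition occs :: "site list \<Rightarrow> nat" where "occs S = (\<Sum>s\<leftarrow>S. occ s)"

definition skels :: "real \<Rightarrow> site list \<Rightarrow> (bool \<times> real) list" where
  "skels q S = map (\<lambda>s. (fst (skel s), q * snd (skel s))) S"

definition nonneg :: "site list \<Rightarrow> bool" where
  "nonneg S \<longleftrightarrow> (\<forall>s\<in>set S. 0 \<le> snd (skel s))"

lemma skels_simps [simp]:
  "skels q [] = []"
  "skels q (Fm w a # S) = (True, q * w) # skels q S"
  "skels q (Bo w a # S) = (False, q * w) # skels q S"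
  "skels q (A @ B) = skels q A @ skels q B"
  by (auto simp: skels_def)

lemma occs_simps [simp]:
  "occs [] = 0" "occs (Fm w a # S) = a + occs S" "occs (Bo w a # S) = a + occs S"
  "occs (A @ B) = occs A + occs B"
  by (auto simp: occs_def)

lemma nonneg_simps [simp]:
  "nonneg []" "nonneg (Fm w a # S) \<longleftrightarrow> 0 \<le> w \<and> nonneg S" "nonneg (Bo w a # S) \<longleftrightarrow> 0 \<le> w \<and> nonneg S"
  "nonneg (A @ B) \<longleftrightarrow> nonneg A \<and> nonneg B"
  by (auto simp: nonneg_def)

text \<open>Invariants of the outcomes reached by \<open>run\<close>, not an exact description of them.\<close>

definition succs :: "real \<Rightarrow> site list \<Rightarrow> nat \<Rightarrow> site list \<Rightarrow> nat \<Rightarrow> bool" where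
  "succs q S C S' C' \<longleftrightarrow> map skel S' = skels q S \<and> C' + occs S' = C + occs S
     \<and> (\<forall>s\<in>set S'. fst (skel s) \<longrightarrow> occ s \<le> 1)"

lemma succs_Nil [simp]: "succs q [] C S' C' \<longleftrightarrow> S' = [] \<and> C' = C"
  by (auto simp: succs_def)

lemma succs_Cons_Fm:
  "succs q S (C + a) S' C' \<Longrightarrow> succs q (Fm w a # S) C (Fm (q * w) 0 # S') C'"
  "C + a \<noteq> 0 \<Longrightarrow> succs q S (C + a - 1) S' C' \<Longrightarrow> succs q (Fm w a # S) C (Fm (q * w) 1 # S') C'"
  by (auto simp: succs_def)

lemma succs_Cons_Bo:
  "i \<le> C \<Longrightarrow> succs q S (C - i + f) S' C' \<Longrightarrow> succs q (Bo z f # S) C (Bo (q * z) i # S') C'"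
  by (auto simp: succs_def)

section \<open>One sweep as a positive linear functional of its continuation\<close>

lemma run_cong:
  assumes "\<And>S' C'. succs q S C S' C' \<Longrightarrow> K S' C' = L S' C'"
  shows "run q S C K = run q S C L"
  using assms
proof (induction S arbitrary: C K L)
  case (Cons s S)
  show ?case
  proof (cases s)
    case (Fm w a)
    have "run q S (C + a) (\<lambda>S'. K (Fm (q * w) 0 # S')) = run q S (C + a) (\<lambda>S'. L (Fm (q * w) 0 # S'))"
      by (intro Cons.IH Cons.prems) (auto simp: Fm intro: succs_Cons_Fm)
    moreover have "run q S (C + a - 1) (\<lambda>S'. K (Fm (q * w) 1 # S')) = run q S (C + a - 1) (\<lambda>S'. L (Fm (q * w) 1 # S'))"
      if "C + a \<noteq> 0"
      using that by (intro Cons.IH Cons.prems) (use Fm succs_Cons_Fm in blast)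
    ultimately show ?thesis by (simp add: Fm)
  next
    case (Bo z f)
    show ?thesis unfolding Bo run.simps
      by (intro sum.cong arg_cong2[where f="(*)"] refl Cons.IH Cons.prems)
         (auto simp: Bo intro: succs_Cons_Bo)
  qed
qed auto

lemma run_mono:
  assumes "nonneg S" and "\<And>S' C'. succs q S C S' C' \<Longrightarrow> K S' C' \<le> L S' C'"
  shows "run q S C K \<le> run q S C L"
  using assms
proof (induction S arbitrary: C K L)
  case (Cons s S)
  show ?case
  proof (cases s)
    case (Fm w a)
    have "run q S (C + a) (\<lambda>S'. K (Fm (q * w) 0 # S')) \<le> run q S (C + a) (\<lambda>S'. L (Fm (q * w) 0 # S'))"
      using Cons.prems(1) by (intro Cons.IH Cons.prems(2)) (auto simp: Fm intro: succs_Cons_Fm)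
    moreover have "run q S (C + a - 1) (\<lambda>S'. K (Fm (q * w) 1 # S')) \<le> run q S (C + a - 1) (\<lambda>S'. L (Fm (q * w) 1 # S'))"
      if "C + a \<noteq> 0"
      using that Cons.prems(1) by (intro Cons.IH Cons.prems(2)) (use Fm succs_Cons_Fm in auto)
    ultimately show ?thesis using Cons.prems(1) by (auto simp: Fm intro!: add_mono mult_left_mono)
  next
    case (Bo z f)
    show ?thesis unfolding Bo run.simps using Cons.prems(1)
      by (intro sum_mono mult_left_mono Cons.IH Cons.prems(2))
         (auto simp: Bo intro: succs_Cons_Bo)
  qed
qed auto

lemma run_append:
  "run q (A @ B) C K = run q A C (\<lambda>A' C'. run q B C' (\<lambda>B'. K (A' @ B')))"
  by (induction q A C K rule: run.induct) simp_all

lemma run_lin: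
  "run q S C (\<lambda>S' C'. c * K S' C' + d * L S' C') = c * run q S C K + d * run q S C L"
proof (induction S arbitrary: C K L)
  case (Cons s S)
  show ?case
    by (cases s) (simp_all add: Cons sum.distrib sum_distrib_left algebra_simps)
qed auto

lemma run_scale: "run q S C (\<lambda>S' C'. c * K S' C') = c * run q S C K"
  using run_lin[of q S C c K 0 K] by simp

lemma run_const: "run q S C (\<lambda>S' C'. c) = c * run q S C (\<lambda>_ _. 1)"
  using run_lin[of q S C c "\<lambda>_ _. 1" 0 "\<lambda>_ _. 1"] by simp

lemma run_nonneg:
  assumes "nonneg S" and "\<And>S' C'. succs q S C S' C' \<Longrightarrow> 0 \<le> K S' C'"
  shows "0 \<le> run q S C K"
  using run_mono[of S q C "\<lambda>_ _. 0" K] run_const[of q S C 0] assms by simp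

fun vacate :: "real \<Rightarrow> site \<Rightarrow> site" where
  "vacate q (Fm w a) = Fm (q * w) 0"
| "vacate q (Bo w a) = Bo (q * w) 0"

text \<open>Only the outcome in which the carrier collects every particle is kept; its weight is
  1.\<close>

lemma run_ge_vacate:
  assumes "nonneg S" and "\<And>S' C'. succs q S C S' C' \<Longrightarrow> 0 \<le> K S' C'"
  shows "K (map (vacate q) S) (C + occs S) \<le> run q S C K"
  using assms
proof (induction S arbitrary: C K)
  case (Cons s S)
  show ?case
  proof (cases s)
    case (Fm w a)
    have "K (map (vacate q) (s # S)) (C + occs (s # S)) \<le> run q S (C + a) (\<lambda>S'. K (Fm (q * w) 0 # S'))"
      using Cons.IH[of "C + a" "\<lambda>S'. K (Fm (q * w) 0 # S')"] Cons.prems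
      by (auto simp: Fm add.assoc succs_Cons_Fm)
    moreover have "0 \<le> run q S (C + a - 1) (\<lambda>S'. K (Fm (q * w) 1 # S'))" if "C + a \<noteq> 0"
      using Cons.prems that by (intro run_nonneg Cons.prems(2)) (use Fm succs_Cons_Fm in auto)
    ultimately show ?thesis using Cons.prems(1) by (auto simp: Fm intro!: add_increasing2)
  next
    case (Bo z f)
    have nn: "0 \<le> run q S (C - i + f) (\<lambda>S'. K (Bo (q * z) i # S'))" if "i \<le> C" for i
      using Cons.prems that by (intro run_nonneg Cons.prems(2)) (auto simp: Bo intro: succs_Cons_Bo)
    have "K (map (vacate q) (s # S)) (C + occs (s # S)) \<le> z ^ 0 * run q S (C - 0 + f) (\<lambda>S'. K (Bo (q * z) 0 # S'))"
      using Cons.IH[of "C + f" "\<lambda>S'. K (Bo (q * z) 0 # S')"] Cons.prems succs_Cons_Bo[of 0 C q S f]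
      by (auto simp: Bo add.assoc)
    also have "\<dots> \<le> run q (s # S) C K"
      unfolding Bo run.simps using nn Cons.prems(1) Bo
      by (intro member_le_sum[of 0 "{..C}" "\<lambda>i. z ^ i * run q S (C - i + f) (\<lambda>S'. K (Bo (q * z) i # S'))"]) auto
    finally show ?thesis .
  qed
qed auto

lemma run_one_ge: "nonneg S \<Longrightarrow> 1 \<le> run q S C (\<lambda>_ _. 1)"
  using run_ge_vacate[of S q C "\<lambda>_ _. 1"] by simp

lemma tendsto_run:
  assumes "\<And>S' C'. succs q S C S' C' \<Longrightarrow> (\<lambda>T::nat. K T S' C') \<longlonglongrightarrow> L S' C'"
  shows "(\<lambda>T. run q S C (K T)) \<longlonglongrightarrow> run q S C L"
  using assms
proof (induction S arbitrary: C K L)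
  case (Cons s S)
  show ?case
  proof (cases s)
    case (Fm w a)
    have "(\<lambda>T. run q S (C + a) (\<lambda>S'. K T (Fm (q * w) 0 # S'))) \<longlonglongrightarrow> run q S (C + a) (\<lambda>S'. L (Fm (q * w) 0 # S'))"
      by (intro Cons.IH Cons.prems) (auto simp: Fm intro: succs_Cons_Fm)
    moreover have "(\<lambda>T. run q S (C + a - 1) (\<lambda>S'. K T (Fm (q * w) 1 # S'))) \<longlonglongrightarrow> run q S (C + a - 1) (\<lambda>S'. L (Fm (q * w) 1 # S'))"
      if "C + a \<noteq> 0"
      using that by (intro Cons.IH Cons.prems) (use Fm succs_Cons_Fm in blast)
    ultimately show ?thesis by (cases "C + a = 0") (auto simp: Fm intro!: tendsto_intros)
  next
    case (Bo z f)
    show ?thesis unfolding Bo run.simps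
      by (intro tendsto_intros Cons.IH Cons.prems) (auto simp: Bo intro: succs_Cons_Bo)
  qed
qed auto

lemma succs_nonneg: "succs q S C S' C' \<Longrightarrow> 0 \<le> q \<Longrightarrow> nonneg S \<Longrightarrow> nonneg S'"
proof -
  assume a: "succs q S C S' C'" "0 \<le> q" "nonneg S"
  have "set (map skel S') = set (skels q S)" using a by (simp add: succs_def)
  then have "skel ` set S' = (\<lambda>s. (fst (skel s), q * snd (skel s))) ` set S"
    by (auto simp: skels_def)
  then show ?thesis using a unfolding nonneg_def
    by (smt (verit, best) image_iff mult_nonneg_nonneg snd_conv)
qed

lemma sweeps_nonneg: "0 \<le> q \<Longrightarrow> nonneg S \<Longrightarrow> 0 \<le> sweeps q T S C"
  by (induction T arbitrary: S C) (auto intro!: run_nonneg dest: succs_nonneg)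

text \<open>Every history can be prolonged by a sweep that leaves all sites empty, at no cost in
  weight.\<close>

lemma sweeps_Suc_ge: "0 \<le> q \<Longrightarrow> nonneg S \<Longrightarrow> sweeps q T S C \<le> sweeps q (Suc T) S C"
proof (induction T arbitrary: S C)
  case 0
  then show ?case using run_one_ge[of S q C] run_cong[of q S C "sweeps q 0" "\<lambda>_ _. 1"] by simp
next
  case (Suc T)
  then show ?case unfolding sweeps.simps(2)[of q "Suc T"] sweeps.simps(2)[of q T S]
    by (intro run_mono) (auto dest: succs_nonneg simp del: sweeps.simps)
qed

lemma incseq_sweeps: "0 \<le> q \<Longrightarrow> nonneg S \<Longrightarrow> incseq (\<lambda>T. sweeps q T S C)"
  by (rule incseq_SucI) (rule sweeps_Suc_ge)

section \<open>Exponential bounds and convergence of the truncated sums\<close>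

definition wsum :: "site list \<Rightarrow> real" where "wsum S = (\<Sum>s\<leftarrow>S. snd (skel s))"

text \<open>The constant \<open>c\<close> bounds the geometric series \<open>1 / (1 - z)\<close> of every \<open>Bo\<close> weight \<open>z\<close>.\<close>

definition small :: "real \<Rightarrow> site list \<Rightarrow> bool" where
  "small c S \<longleftrightarrow> nonneg S \<and> 1 \<le> c \<and> (\<forall>s\<in>set S. \<not> fst (skel s) \<longrightarrow> snd (skel s) \<le> 1 - 1 / c)"

lemma wsum_simps [simp]:
  "wsum [] = 0" "wsum (Fm w a # S) = w + wsum S" "wsum (Bo w a # S) = w + wsum S"
  "wsum (A @ B) = wsum A + wsum B"
  by (auto simp: wsum_def)

lemma small_simps [simp]:
  "small c [] \<longleftrightarrow> 1 \<le> c" "small c (Fm w a # S) \<longleftrightarrow> 0 \<le> w \<and> small c S"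
  "small c (Bo w a # S) \<longleftrightarrow> 0 \<le> w \<and> w \<le> 1 - 1 / c \<and> small c S"
  "small c (A @ B) \<longleftrightarrow> small c A \<and> small c B"
  by (auto simp: small_def)

lemma small_nonneg: "small c S \<Longrightarrow> nonneg S"
  by (simp add: small_def)

lemma succs_wsum: "succs q S C S' C' \<Longrightarrow> wsum S' = q * wsum S"
proof -
  assume "succs q S C S' C'"
  then have "map snd (map skel S') = map snd (skels q S)" by (simp add: succs_def)
  then have "map (\<lambda>s. snd (skel s)) S' = map (\<lambda>s. q * snd (skel s)) S"
    by (simp add: skels_def o_def)
  then show ?thesis by (simp add: wsum_def sum_list_const_mult)
qed

lemma succs_small:
  assumes "succs q S C S' C'" "0 \<le> q" "q \<le> 1" "small c S"
  shows "small c S'"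
proof -
  have "set (map skel S') = set (skels q S)" using assms(1) by (simp add: succs_def)
  then have *: "skel ` set S' = (\<lambda>s. (fst (skel s), q * snd (skel s))) ` set S"
    by (auto simp: skels_def)
  have "snd (skel s') \<le> 1 - 1 / c" if s': "s' \<in> set S'" "\<not> fst (skel s')" for s'
  proof -
    obtain s where s: "s \<in> set S" "skel s' = (fst (skel s), q * snd (skel s))"
      using * s'(1) by (metis (no_types, lifting) image_iff)
    have "q * snd (skel s) \<le> snd (skel s)"
      using assms s(1) by (auto simp: small_def nonneg_def intro: mult_left_le_one_le)
    also have "\<dots> \<le> 1 - 1 / c" using assms(4) s s'(2) by (auto simp: small_def)
    finally show ?thesis using s by simp
  qed
  then show ?thesis using assms succs_nonneg[OF assms(1,2)] by (auto simp: small_def)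
qed

text \<open>A site of weight \<open>w\<close> contributes a factor of at most \<open>1 + w\<close>
  or \<open>1 / (1 - w)\<close>, and both are at most \<open>exp (c * w)\<close>.\<close>

lemma run_one_le:
  assumes "small c S"
  shows "run q S C (\<lambda>_ _. 1) \<le> exp (c * wsum S)"
  using assms
proof (induction S arbitrary: C)
  case (Cons s S)
  show ?case
  proof (cases s)
    case (Fm w a)
    have w: "0 \<le> w" "small c S" and c: "1 \<le> c" using Cons.prems by (auto simp: Fm small_def)
    have "(if C + a = 0 then 0 else w * run q S (C + a - 1) (\<lambda>_ _. 1)) \<le> w * exp (c * wsum S)"
      using Cons.IH[OF w(2), of "C + a - 1"] w(1) by (auto intro: mult_left_mono)
    with Cons.IH[OF w(2), of "C + a"]
    have "run q (s # S) C (\<lambda>_ _. 1) \<le> exp (c * wsum S) + w * exp (c * wsum S)"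
      unfolding Fm run.simps by (rule add_mono)
    also have "\<dots> = (1 + w) * exp (c * wsum S)" by (simp add: algebra_simps)
    also have "1 + w \<le> exp (c * w)"
    proof -
      have "1 + w \<le> exp w" by (rule exp_ge_add_one_self)
      also have "\<dots> \<le> exp (c * w)" using w(1) c mult_right_mono[of 1 c w] by simp
      finally show ?thesis .
    qed
    finally show ?thesis by (simp add: Fm exp_add[symmetric] algebra_simps)
  next
    case (Bo z f)
    have z: "0 \<le> z" "z \<le> 1 - 1 / c" "small c S" and c: "1 \<le> c"
      using Cons.prems by (auto simp: Bo small_def)
    have z1: "z < 1" using z(2) c by (smt (verit) divide_pos_pos)
    have "run q (s # S) C (\<lambda>_ _. 1) \<le> (\<Sum>i\<le>C. z ^ i * exp (c * wsum S))"
      unfolding Bo run.simps using z by (intro sum_mono mult_left_mono Cons.IH) auto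
    also have "\<dots> = (\<Sum>i\<le>C. z ^ i) * exp (c * wsum S)" by (simp add: sum_distrib_right)
    also have "(\<Sum>i\<le>C. z ^ i) \<le> exp (c * z)"
    proof -
      have "(\<Sum>i\<le>C. z ^ i) \<le> (\<Sum>i. z ^ i)"
        by (intro sum_le_suminf summable_geometric) (use z z1 in auto)
      also have "\<dots> = 1 / (1 - z)" using z z1 by (intro suminf_geometric) auto
      also have "\<dots> = 1 + z * (1 / (1 - z))" using z1 by (simp add: field_simps)
      also have "\<dots> \<le> 1 + z * c"
        using z c z1 by (intro add_left_mono mult_left_mono) (auto simp: field_simps)
      also have "\<dots> \<le> exp (z * c)" by (rule exp_ge_add_one_self)
      finally show ?thesis by (simp add: mult.commute)
    qed
    finally show ?thesis by (simp add: Bo exp_add[symmetric] algebra_simps)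
  qed
qed (simp add: small_def)

text \<open>The product over all sweeps of the one-sweep bounds
  \<open>exp (c * (q ^ i * t))\<close>; the exponents form a geometric series.\<close>

definition ebound :: "real \<Rightarrow> real \<Rightarrow> real \<Rightarrow> real" where
  "ebound q c t = exp (c * t / (1 - q))"

lemma ebound_step:
  assumes "q < 1" shows "exp (c * t) * ebound q c (q * t) = ebound q c t"
proof -
  have "c * t + c * (q * t) / (1 - q) = c * t / (1 - q)" using assms by (simp add: field_simps)
  then show ?thesis unfolding ebound_def exp_add[symmetric] by simp
qed

lemma ebound_pos: "0 < ebound q c t" by (simp add: ebound_def)

lemma sweeps_le:
  assumes "0 \<le> q" "q < 1" "small c S"
  shows "sweeps q T S C \<le> ebound q c (wsum S)"
  using assms(3)
proof (induction T arbitrary: S C)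
  case 0
  have "0 \<le> wsum S" using 0 by (auto simp: wsum_def small_def nonneg_def intro!: sum_list_nonneg)
  then show ?case using 0 assms by (simp add: ebound_def small_def)
next
  case (Suc T)
  have "sweeps q (Suc T) S C = run q S C (sweeps q T)" by simp
  also have "\<dots> \<le> run q S C (\<lambda>_ _. ebound q c (q * wsum S))"
  proof (rule run_mono)
    fix S' C' assume s: "succs q S C S' C'"
    show "sweeps q T S' C' \<le> ebound q c (q * wsum S)"
      using Suc.IH[OF succs_small[OF s]] succs_wsum[OF s] Suc.prems assms by simp
  qed (use Suc.prems small_nonneg in auto)
  also have "\<dots> = ebound q c (q * wsum S) * run q S C (\<lambda>_ _. 1)" by (rule run_const)
  also have "\<dots> \<le> ebound q c (q * wsum S) * exp (c * wsum S)"
    using Suc ebound_pos[of q c] by (intro mult_left_mono run_one_le) (auto intro: less_imp_le)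
  also have "\<dots> = ebound q c (wsum S)" using ebound_step[of q c "wsum S"] assms by (simp add: mult.commute)
  finally show ?case .
qed

definition gf :: "real \<Rightarrow> site list \<Rightarrow> nat \<Rightarrow> real" where
  "gf q S C = lim (\<lambda>T. sweeps q T S C)"

lemma sweeps_tendsto:
  assumes "0 \<le> q" "q < 1" "small c S"
  shows "(\<lambda>T. sweeps q T S C) \<longlonglongrightarrow> gf q S C"
proof -
  have "Bseq (\<lambda>T. sweeps q T S C)"
    using sweeps_le[OF assms] sweeps_nonneg[OF assms(1) small_nonneg[OF assms(3)]]
    by (intro BseqI'[of _ "ebound q c (wsum S)"]) auto
  then have "convergent (\<lambda>T. sweeps q T S C)"
    using incseq_sweeps[OF assms(1) small_nonneg[OF assms(3)]]
    by (intro Bseq_monoseq_convergent) (auto simp: incseq_imp_monoseq)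
  then show ?thesis by (simp add: gf_def convergent_LIMSEQ_iff)
qed

lemma sweeps_le_gf:
  assumes "0 \<le> q" "q < 1" "small c S"
  shows "sweeps q T S C \<le> gf q S C"
  using incseq_le[OF incseq_sweeps sweeps_tendsto] assms small_nonneg by blast

text \<open>Starting the sweeps at another site changes the truncated sums only by part of one sweep.\<close>

lemma sweeps_rotate:
  assumes "0 \<le> q" "nonneg A" "nonneg B"
  shows "sweeps q T (B @ A) C \<le> run q B C (\<lambda>B' C'. sweeps q T (A @ B') C')"
    and "run q B C (\<lambda>B' C'. sweeps q T (A @ B') C') \<le> sweeps q (Suc T) (B @ A) C"
  using assms(2,3)
proof (induction T arbitrary: A B C)
  case 0
  case 1
  then show "sweeps q 0 (B @ A) C \<le> run q B C (\<lambda>B' C'. sweeps q 0 (A @ B') C')"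
    using run_one_ge[of B q C] by simp
  case 2
  then show "run q B C (\<lambda>B' C'. sweeps q 0 (A @ B') C') \<le> sweeps q (Suc 0) (B @ A) C"
    unfolding sweeps.simps run_append by (auto intro!: run_mono run_one_ge simp: sweeps.simps dest: succs_nonneg[OF _ assms(1)])
next
  case (Suc T)
  case 1
  then show "sweeps q (Suc T) (B @ A) C \<le> run q B C (\<lambda>B' C'. sweeps q (Suc T) (A @ B') C')"
    using Suc assms(1) unfolding sweeps.simps run_append
    by (intro run_mono Suc.IH) (auto dest: succs_nonneg)
  case 2
  then show "run q B C (\<lambda>B' C'. sweeps q (Suc T) (A @ B') C') \<le> sweeps q (Suc (Suc T)) (B @ A) C"
    using Suc assms(1) unfolding sweeps.simps(2)[of q "Suc T"] run_append sweeps.simps(2)[of q T "_ @ _"]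
      run_append[of q _ _ _ "sweeps q T"]
    by (intro run_mono order.trans[OF Suc.IH(2)]) (auto dest: succs_nonneg simp: run_append)
qed

text \<open>By \<open>sweeps_rotate\<close> the rotated sums lie between two consecutive
  truncations, which have the same limit.\<close>

lemma gf_rotate:
  assumes "0 \<le> q" "q < 1" "small c A" "small c B"
  shows "gf q (B @ A) C = run q B C (\<lambda>B' C'. gf q (A @ B') C')"
proof (rule LIMSEQ_unique)
  have lim: "(\<lambda>T. sweeps q T (B @ A) C) \<longlonglongrightarrow> gf q (B @ A) C"
    using assms by (intro sweeps_tendsto[where c = c]) auto
  show "(\<lambda>T. run q B C (\<lambda>B' C'. sweeps q T (A @ B') C')) \<longlonglongrightarrow> gf q (B @ A) C"
    by (rule tendsto_sandwich[OF _ _ lim LIMSEQ_Suc[OF lim]])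
       (use assms small_nonneg in \<open>auto simp del: sweeps.simps intro!: always_eventually sweeps_rotate\<close>)
  show "(\<lambda>T. run q B C (\<lambda>B' C'. sweeps q T (A @ B') C')) \<longlonglongrightarrow> run q B C (\<lambda>B' C'. gf q (A @ B') C')"
    using assms by (intro tendsto_run sweeps_tendsto[where c = c]) (auto dest: succs_small[where c = c])
qed

lemma gf_Fm:
  assumes "0 \<le> q" "q < 1" "small c (Fm w a # S)"
  shows "gf q (Fm w a # S) C = gf q (S @ [Fm (q * w) 0]) (C + a)
     + (if C + a = 0 then 0 else w * gf q (S @ [Fm (q * w) 1]) (C + a - 1))"
proof -
  have "gf q ([Fm w a] @ S) C = run q [Fm w a] C (\<lambda>B' C'. gf q (S @ B') C')"
    using assms by (intro gf_rotate[where c = c]) (auto simp: small_def)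
  then show ?thesis by simp
qed

lemma gf_unfold:
  assumes "0 \<le> q" "q < 1" "small c S"
  shows "gf q S C = run q S C (gf q)"
  using gf_rotate[of q c "[]" S C] assms by (auto simp: small_def)

section \<open>Exchange relations and removal of pairs\<close>

text \<open>A Yang-Baxter relation: the pair \<open>(0, 1)\<close> is distributed over two exchanged
  pairs with coefficients \<rho> and 1 - \<rho>, and every other pair simply commutes. The
  coefficients survive a sweep because the ratio of the two weights does; \<rho> > 1 is
  allowed.\<close>

lemma sweeps_exchange_Fm:
  assumes "w1 = \<rho> * w2" "i \<le> 1" "j \<le> 1"
  shows "sweeps q T (X @ [Fm w1 i, Fm w2 j] @ Y) C =
    (if i = 0 \<and> j = 1 then \<rho> * sweeps q T (X @ [Fm w2 0, Fm w1 1] @ Y) C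
        + (1 - \<rho>) * sweeps q T (X @ [Fm w2 1, Fm w1 0] @ Y) C
     else sweeps q T (X @ [Fm w2 i, Fm w1 j] @ Y) C)"
  using assms
proof (induction T arbitrary: w1 w2 i j X Y C)
  case (Suc T)
  \<comment> \<open>\<open>M12\<close> and \<open>M21\<close> absorb the rest of the sweep and the
    induction hypothesis, so that only the passage of the carrier over the two sites has to be
    checked, in \<open>F\<close>.\<close>
  define M12 where "M12 X' a b c = run q Y c (\<lambda>Y'. sweeps q T (X' @ [Fm (q * w1) a, Fm (q * w2) b] @ Y'))" for X' a b c
  define M21 where "M21 X' a b c = run q Y c (\<lambda>Y'. sweeps q T (X' @ [Fm (q * w2) a, Fm (q * w1) b] @ Y'))" for X' a b c
  have q: "q * w1 = \<rho> * (q * w2)" using Suc.prems by simp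
  have M: "M12 X' a b c = (if a = 0 \<and> b = 1 then \<rho> * M21 X' 0 1 c + (1 - \<rho>) * M21 X' 1 0 c else M21 X' a b c)"
    if "a \<le> 1" "b \<le> 1" for X' a b c
    unfolding M12_def M21_def run_lin[symmetric]
    using Suc.IH[OF q that, of X'] by (cases "a = 0 \<and> b = 1") (auto intro!: run_cong)
  have Ma: "M12 X' 0 0 c = M21 X' 0 0 c" "M12 X' (Suc 0) 0 c = M21 X' (Suc 0) 0 c"
    "M12 X' (Suc 0) (Suc 0) c = M21 X' (Suc 0) (Suc 0) c"
    "M12 X' 0 (Suc 0) c = \<rho> * M21 X' 0 (Suc 0) c + (1 - \<rho>) * M21 X' (Suc 0) 0 c" for X' c
    using M[of 0 0] M[of 1 0] M[of 1 1] M[of 0 1] by simp_all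
  define F12 where "F12 a b X' c = run q [Fm w1 a, Fm w2 b] c (\<lambda>P c'. run q Y c' (\<lambda>Y'. sweeps q T (X' @ P @ Y')))" for a b X' c
  define F21 where "F21 a b X' c = run q [Fm w2 a, Fm w1 b] c (\<lambda>P c'. run q Y c' (\<lambda>Y'. sweeps q T (X' @ P @ Y')))" for a b X' c
  have F: "F12 a b X' c = (if a = 0 \<and> b = 1 then \<rho> * F21 0 1 X' c + (1 - \<rho>) * F21 1 0 X' c else F21 a b X' c)"
    if "a \<le> 1" "b \<le> 1" for a b X' c
  proof -
    have e12: "F12 a b X' c = M12 X' 0 0 (c + a + b)
       + (if c + a + b = 0 then 0 else w2 * M12 X' 0 1 (c + a + b - 1))
       + (if c + a = 0 then 0 else w1 * (M12 X' 1 0 (c + a - 1 + b)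
            + (if c + a - 1 + b = 0 then 0 else w2 * M12 X' 1 1 (c + a - 1 + b - 1))))" for a b
      unfolding F12_def M12_def by simp
    have e21: "F21 a b X' c = M21 X' 0 0 (c + a + b)
       + (if c + a + b = 0 then 0 else w1 * M21 X' 0 1 (c + a + b - 1))
       + (if c + a = 0 then 0 else w2 * (M21 X' 1 0 (c + a - 1 + b)
            + (if c + a - 1 + b = 0 then 0 else w1 * M21 X' 1 1 (c + a - 1 + b - 1))))" for a b
      unfolding F21_def M21_def by simp
    have "a = 0 \<or> a = 1" "b = 0 \<or> b = 1" using that by auto
    moreover have "c = 0 \<or> (\<exists>d. c = Suc d)" by (cases c) auto
    ultimately show ?thesis unfolding e12 e21 using Suc.prems(1)
      by (elim disjE exE) (simp_all add: Ma algebra_simps)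
  qed
  have s12: "sweeps q (Suc T) (X @ [Fm w1 a, Fm w2 b] @ Y) C = run q X C (F12 a b)" for a b
    unfolding sweeps.simps run_append[of _ X] run_append[of _ "[Fm w1 a, Fm w2 b]"] F12_def ..
  have s21: "sweeps q (Suc T) (X @ [Fm w2 a, Fm w1 b] @ Y) C = run q X C (F21 a b)" for a b
    unfolding sweeps.simps run_append[of _ X] run_append[of _ "[Fm w2 a, Fm w1 b]"] F21_def ..
  show ?case
    unfolding s12 s21 run_lin[symmetric] using F[OF Suc.prems(2,3)]
    by (cases "i = 0 \<and> j = 1") (auto intro!: run_cong)
qed simp

text \<open>The right side depends on \<open>s\<close> and \<open>e\<close> only through their sum:
  one particle goes to the \<open>Fm\<close> site or not with odds \<rho> to 1, where \<rho> is the
  ratio of the weights. The factor \<open>1 + \<rho>\<close> clears the denominator. The empty pair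
  is separate because it has no particle to give away.\<close>

lemma sweeps_exchange_Bo:
  assumes "w = \<rho> * z" "0 \<le> \<rho>" "e \<le> 1"
  shows "(1 + \<rho>) * sweeps q T (X @ [Bo z s, Fm w e] @ Y) C =
    (if s + e = 0 then (1 + \<rho>) * sweeps q T (X @ [Fm w 0, Bo z 0] @ Y) C
     else sweeps q T (X @ [Fm w 0, Bo z (s + e)] @ Y) C
        + \<rho> * sweeps q T (X @ [Fm w 1, Bo z (s + e - 1)] @ Y) C)"
  using assms
proof (induction T arbitrary: w z e s X Y C)
  case (Suc T)
  define M1 where "M1 X' f a c = run q Y c (\<lambda>Y'. sweeps q T (X' @ [Bo (q * z) f, Fm (q * w) a] @ Y'))" for X' f a c
  define M2 where "M2 X' a f c = run q Y c (\<lambda>Y'. sweeps q T (X' @ [Fm (q * w) a, Bo (q * z) f] @ Y'))" for X' a f c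
  have q: "q * w = \<rho> * (q * z)" using Suc.prems by simp
  have M: "(1 + \<rho>) * M1 X' f a c = (if f + a = 0 then (1 + \<rho>) * M2 X' 0 0 c
     else M2 X' 0 (f + a) c + \<rho> * M2 X' 1 (f + a - 1) c)" if "a \<le> 1" for X' f a c
  proof (cases "f + a = 0")
    case True
    then show ?thesis unfolding M1_def M2_def run_scale[symmetric]
      using Suc.IH[OF q Suc.prems(2) that, of X' f] by (auto intro!: run_cong)
  next
    case False
    have "M2 X' 0 (f + a) c + \<rho> * M2 X' 1 (f + a - 1) c = 1 * M2 X' 0 (f + a) c + \<rho> * M2 X' 1 (f + a - 1) c"
      by simp
    with False show ?thesis unfolding M1_def M2_def run_scale[of _ _ _ "1 + \<rho>", symmetric] run_lin[symmetric]
      using Suc.IH[OF q Suc.prems(2) that, of X' f] by (auto intro!: run_cong)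
  qed
  define F1 where "F1 f a X' c = run q [Bo z f, Fm w a] c (\<lambda>P c'. run q Y c' (\<lambda>Y'. sweeps q T (X' @ P @ Y')))" for f a X' c
  define F2 where "F2 a f X' c = run q [Fm w a, Bo z f] c (\<lambda>P c'. run q Y c' (\<lambda>Y'. sweeps q T (X' @ P @ Y')))" for f a X' c
  have F: "(1 + \<rho>) * F1 s e X' c = (if s + e = 0 then (1 + \<rho>) * F2 0 0 X' c
     else F2 0 (s + e) X' c + \<rho> * F2 1 (s + e - 1) X' c)" for X' c
  proof -
    define t where "t = s + e"
    \<comment> \<open>The index counts the particles left on the pair: all of them on the
      \<open>Bo\<close> site in \<open>A\<close> and \<open>D\<close>, one of them on the
      \<open>Fm\<close> site in \<open>B\<close>.\<close>
    define A where "A i = z ^ i * M2 X' 0 i (c + t - i)" for i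
    define B where "B i = z ^ i * M2 X' 1 (i - 1) (c + t - i)" for i
    define D where "D i = z ^ i * (M1 X' i 0 (c + t - i))" for i
    have D: "(1 + \<rho>) * D i = (if i = 0 then (1 + \<rho>) * A 0 else A i + \<rho> * B i)" for i
      using arg_cong[OF M[of 0 X' i "c + t - i"], of "\<lambda>u. z ^ i * u"]
      unfolding A_def B_def D_def by (auto simp: algebra_simps)
    have D1: "(1 + \<rho>) * (w * z ^ i * M1 X' i 1 (c + t - Suc i)) = \<rho> * (A (Suc i) + \<rho> * B (Suc i))" for i
      using arg_cong[OF M[of 1 X' i "c + t - Suc i"], of "\<lambda>u. w * z ^ i * u"]
      unfolding A_def B_def by (simp add: algebra_simps Suc.prems(1))
    have f1: "F1 s e X' c = (\<Sum>i\<le>c. D i) + (\<Sum>i\<le>c. if c + t - i = 0 then 0 else w * z ^ i * M1 X' i 1 (c + t - Suc i))"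
      unfolding F1_def D_def M1_def t_def sum.distrib[symmetric]
      unfolding run.simps by (intro sum.cong refl) (auto simp: algebra_simps)
    have f2: "F2 0 t X' c = (\<Sum>i\<le>c. A i) + (if c = 0 then 0 else \<rho> * (\<Sum>i\<le>c - 1. B (Suc i)))"
      unfolding F2_def A_def B_def M2_def
      by (simp add: sum_distrib_left Suc.prems(1) algebra_simps)
    show ?thesis
    proof (cases "t = 0")
      case True
      have "(1 + \<rho>) * F1 s e X' c = (\<Sum>i\<le>c. (1 + \<rho>) * D i) + (\<Sum>i\<le>c. if c - i = 0 then 0 else (1 + \<rho>) * (w * z ^ i * M1 X' i 1 (c + t - Suc i)))"
        unfolding f1 distrib_left sum_distrib_left using True by (auto intro!: sum.cong)
      also have "\<dots> = (1 + \<rho>) * F2 0 0 X' c"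
      proof (cases c)
        case 0
        then show ?thesis using f2 True D[of 0] by simp
      next
        case (Suc d)
        have "(\<Sum>i\<le>c. if c - i = 0 then 0 else (1 + \<rho>) * (w * z ^ i * M1 X' i 1 (c + t - Suc i)))
          = (\<Sum>i\<le>d. \<rho> * (A (Suc i) + \<rho> * B (Suc i)))"
          unfolding D1[symmetric] by (simp add: Suc)
        then show ?thesis using f2 True unfolding D
          by (simp del: sum.atMost_Suc add: Suc sum.atMost_Suc_shift sum.distrib sum_distrib_left algebra_simps)
      qed
      finally show ?thesis using True by (simp add: t_def)
    next
      case False
      have f3: "F2 1 (t - 1) X' c = (\<Sum>i\<le>Suc c. A i) + \<rho> * (\<Sum>i\<le>c. B (Suc i))"
        unfolding F2_def A_def B_def M2_def using False
        by (simp add: sum_distrib_left Suc.prems(1) algebra_simps)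
      have "(1 + \<rho>) * F1 s e X' c = (\<Sum>i\<le>c. (1 + \<rho>) * D i) + (\<Sum>i\<le>c. (1 + \<rho>) * (w * z ^ i * M1 X' i 1 (c + t - Suc i)))"
        unfolding f1 distrib_left sum_distrib_left using False by (auto intro!: sum.cong)
      also have "\<dots> = (\<Sum>i\<le>c. if i = 0 then (1 + \<rho>) * A 0 else A i + \<rho> * B i) + (\<Sum>i\<le>c. \<rho> * (A (Suc i) + \<rho> * B (Suc i)))"
        unfolding D D1 ..
      also have "\<dots> = F2 0 t X' c + \<rho> * F2 1 (t - 1) X' c"
        unfolding f2 f3
        by (cases c) (simp_all del: sum.atMost_Suc add: sum.atMost_Suc_shift sum.distrib sum_distrib_left algebra_simps)
      finally show ?thesis using False unfolding t_def by (simp only: if_False)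
    qed
  qed
  have s1: "sweeps q (Suc T) (X @ [Bo z f, Fm w a] @ Y) C = run q X C (F1 f a)" for a f
    unfolding sweeps.simps run_append[of _ X] run_append[of _ "[Bo z f, Fm w a]"] F1_def ..
  have s2: "sweeps q (Suc T) (X @ [Fm w a, Bo z f] @ Y) C = run q X C (F2 a f)" for a f
    unfolding sweeps.simps run_append[of _ X] run_append[of _ "[Fm w a, Bo z f]"] F2_def ..
  show ?case
  proof (cases "s + e = 0")
    case True
    then show ?thesis unfolding s1 s2 run_scale[symmetric] F by simp
  next
    case False
    have "run q X C (F2 0 (s + e)) + \<rho> * run q X C (F2 1 (s + e - 1)) = run q X C (\<lambda>X' C'. 1 * F2 0 (s + e) X' C' + \<rho> * F2 1 (s + e - 1) X' C')"
      unfolding run_lin by simp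
    with False show ?thesis
      unfolding s1 s2 run_scale[of _ _ _ "1 + \<rho>", symmetric] F by (simp only: if_False mult_1)
  qed
qed simp

section \<open>Exchange relations in the limit and the functional equation of a pair\<close>

lemma gf_exchange_Fm:
  assumes q: "0 \<le> q" "q < 1" and s: "small c (X @ [Fm w1 i, Fm w2 j] @ Y)"
    and w: "w1 = \<rho> * w2" "i \<le> 1" "j \<le> 1"
  shows "gf q (X @ [Fm w1 i, Fm w2 j] @ Y) C =
    (if i = 0 \<and> j = 1 then \<rho> * gf q (X @ [Fm w2 0, Fm w1 1] @ Y) C
        + (1 - \<rho>) * gf q (X @ [Fm w2 1, Fm w1 0] @ Y) C
     else gf q (X @ [Fm w2 i, Fm w1 j] @ Y) C)"
proof (rule LIMSEQ_unique)
  show "(\<lambda>T. sweeps q T (X @ [Fm w1 i, Fm w2 j] @ Y) C) \<longlonglongrightarrow> gf q (X @ [Fm w1 i, Fm w2 j] @ Y) C"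
    using q s by (rule sweeps_tendsto)
  show "(\<lambda>T. sweeps q T (X @ [Fm w1 i, Fm w2 j] @ Y) C) \<longlonglongrightarrow> (if i = 0 \<and> j = 1 then \<rho> * gf q (X @ [Fm w2 0, Fm w1 1] @ Y) C
        + (1 - \<rho>) * gf q (X @ [Fm w2 1, Fm w1 0] @ Y) C
     else gf q (X @ [Fm w2 i, Fm w1 j] @ Y) C)"
    unfolding sweeps_exchange_Fm[OF w] using q s
    by (cases "i = 0 \<and> j = 1")
       (simp_all only: if_True if_False simp_thms, (intro tendsto_intros sweeps_tendsto[where c = c]; simp)+)
qed

lemma gf_exchange_Bo:
  assumes q: "0 \<le> q" "q < 1" and sm: "small c (X @ [Bo z s, Fm w e] @ Y)"
    and w: "w = \<rho> * z" "0 \<le> \<rho>" "e \<le> 1"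
  shows "(1 + \<rho>) * gf q (X @ [Bo z s, Fm w e] @ Y) C =
    (if s + e = 0 then (1 + \<rho>) * gf q (X @ [Fm w 0, Bo z 0] @ Y) C
     else gf q (X @ [Fm w 0, Bo z (s + e)] @ Y) C
        + \<rho> * gf q (X @ [Fm w 1, Bo z (s + e - 1)] @ Y) C)"
proof (rule LIMSEQ_unique)
  show "(\<lambda>T. (1 + \<rho>) * sweeps q T (X @ [Bo z s, Fm w e] @ Y) C) \<longlonglongrightarrow> (1 + \<rho>) * gf q (X @ [Bo z s, Fm w e] @ Y) C"
    using q sm by (intro tendsto_intros sweeps_tendsto)
  show "(\<lambda>T. (1 + \<rho>) * sweeps q T (X @ [Bo z s, Fm w e] @ Y) C) \<longlonglongrightarrow>
    (if s + e = 0 then (1 + \<rho>) * gf q (X @ [Fm w 0, Bo z 0] @ Y) C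
     else gf q (X @ [Fm w 0, Bo z (s + e)] @ Y) C
        + \<rho> * gf q (X @ [Fm w 1, Bo z (s + e - 1)] @ Y) C)"
    unfolding sweeps_exchange_Bo[OF w] using q sm
    by (cases "s + e = 0")
       (simp_all only: if_True if_False simp_thms, (intro tendsto_intros sweeps_tendsto[where c = c]; simp)+)
qed

definition fms :: "real list \<Rightarrow> site list" where "fms ws = map (\<lambda>w. Fm w 0) ws"

lemma fms_simps [simp]: "fms [] = []" "fms (w # ws) = Fm w 0 # fms ws" "fms (us @ ws) = fms us @ fms ws"
  by (simp_all add: fms_def)

lemma small_fms [simp]: "small c (fms ws) \<longleftrightarrow> 1 \<le> c \<and> (\<forall>w\<in>set ws. 0 \<le> w)"
  by (induction ws) auto

text \<open>With at least as many particles as sites the carrier never runs empty, so that an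
  additional particle is only carried along.\<close>

lemma run_fms_Suc:
  "length ws \<le> C \<Longrightarrow> run q (fms ws) (Suc C) K = run q (fms ws) C (\<lambda>S c. K S (Suc c))"
proof (induction ws arbitrary: C K)
  case (Cons w ws)
  then obtain D where "C = Suc D" by (cases C) auto
  with Cons show ?case by simp
qed simp

text \<open>The particle on the site of weight \<open>x\<close> may be put into the carrier in
  advance, since the carrier does not run empty on \<open>ws\<close> before it would pick up that
  particle.\<close>

lemma gf_occupied:
  assumes "0 \<le> q" "q < 1" "small c (fms ws @ Fm x 1 # X)" "length ws \<le> C"
  shows "gf q (fms ws @ Fm x 1 # X) C = gf q (fms ws @ Fm x 0 # X) (Suc C)"
proof -
  have "gf q (fms ws @ Fm x 0 # X) (Suc C) = run q (fms ws @ Fm x 0 # X) (Suc C) (gf q)"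
    using assms by (intro gf_unfold[where c = c]) auto
  also have "\<dots> = run q (fms ws @ Fm x 1 # X) C (gf q)"
    unfolding run_append run_fms_Suc[OF assms(4)] by simp
  also have "\<dots> = gf q (fms ws @ Fm x 1 # X) C"
    using assms by (intro gf_unfold[where c = c, symmetric]) auto
  finally show ?thesis by simp
qed

lemma gf_move:
  assumes "0 \<le> q" "q < 1" "small c (Y @ Fm w 0 # fms ws @ R)" "\<forall>v\<in>set ws. 0 < v"
  shows "gf q (Y @ Fm w 0 # fms ws @ R) C = gf q (Y @ fms ws @ Fm w 0 # R) C"
  using assms(3,4)
proof (induction ws arbitrary: Y)
  case (Cons v ws)
  have "gf q (Y @ [Fm w 0, Fm v 0] @ (fms ws @ R)) C = gf q (Y @ [Fm v 0, Fm w 0] @ (fms ws @ R)) C"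
    using Cons.prems assms(1,2) by (subst gf_exchange_Fm[where c = c and \<rho> = "w / v"]) auto
  also have "\<dots> = gf q ((Y @ [Fm v 0]) @ Fm w 0 # fms ws @ R) C" by simp
  also have "\<dots> = gf q ((Y @ [Fm v 0]) @ fms ws @ Fm w 0 # R) C"
    using Cons.prems by (intro Cons.IH) auto
  finally show ?case by simp
qed simp

text \<open>Starting the sweep with the site \<open>y\<close> sends it to the end with weight
  \<open>a = q * y\<close>; on the right side, starting with \<open>1 / y\<close> sends that site to
  the end with weight \<open>b = q / y\<close>. Now both sides contain the weights \<open>a\<close>
  and \<open>b\<close>, and exchanging the last site with \<open>Bo\<close> (ratios \<open>y\<close>
  and \<open>1 / y\<close>) expresses everything by \<Gamma>, \<open>LA\<close> and
  \<open>LB\<close>.\<close>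

lemma gf_pair_shift:
  assumes q: "0 < q" "q < 1" and y: "0 < y" and ws: "\<forall>w\<in>set ws. 0 < w" and C: "length ws < C"
  shows "gf q (Fm y 0 # Fm (q / y) 0 # fms ws @ [Bo q s]) C
    = y * gf q (Fm (q * y) 0 # Fm (1 / y) 0 # fms ws @ [Bo q s]) C"
proof -
  define c where "c = 1 / (1 - q)"
  have c: "1 \<le> c" "q \<le> 1 - 1 / c" using q by (auto simp: c_def field_simps)
  have ws': "\<forall>w\<in>set ws. 0 \<le> w" using ws by auto
  note sm = c q y ws ws'
  define a where "a = q * y"
  define b where "b = q / y"
  have ab: "0 < a" "0 < b" "b = (1 / y\<^sup>2) * a" using q y by (auto simp: a_def b_def power2_eq_square)
  define \<Gamma> where "\<Gamma> s C = gf q ([Fm b 0] @ fms ws @ [Fm a 0, Bo q s]) C" for s C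
  define LA where "LA s C = gf q ([Fm b 0] @ fms ws @ [Fm a 1, Bo q s]) C" for s C
  define LB where "LB s C = gf q ([Fm a 0] @ fms ws @ [Fm b 1, Bo q s]) C" for s C
  have \<Gamma>: "\<Gamma> s C = gf q (fms ws @ [Fm b 0, Fm a 0, Bo q s]) C" for s C
    unfolding \<Gamma>_def using gf_move[of q c "[]" b ws "[Fm a 0, Bo q s]" C] sm ab by simp
  have \<Gamma>ab: "\<Gamma> s C = gf q (fms ws @ [Fm a 0, Fm b 0, Bo q s]) C" for s C
    unfolding \<Gamma> using gf_exchange_Fm[of q c "fms ws" b 0 a 0 "[Bo q s]" "1 / y\<^sup>2" C] sm ab by simp
  have \<Gamma>': "\<Gamma> s C = gf q ([Fm a 0] @ fms ws @ [Fm b 0, Bo q s]) C" for s C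
    unfolding \<Gamma>ab using gf_move[of q c "[]" a ws "[Fm b 0, Bo q s]" C] sm ab by simp
  have LA: "LA s D = \<Gamma> s (Suc D)" if "length ws < D" for s D
    unfolding LA_def \<Gamma>_def using gf_occupied[of q c "b # ws" a "[Bo q s]" D] sm ab that by simp
  have LB: "LB s D = \<Gamma> s (Suc D)" if "length ws < D" for s D
    unfolding LB_def \<Gamma>' using gf_occupied[of q c "a # ws" b "[Bo q s]" D] sm ab that by simp
  have LAB: "y\<^sup>2 * LA s D = LB s D + (y\<^sup>2 - 1) * \<Gamma> s (Suc D)" if "length ws \<le> D" for s D
  proof -
    have "LA s D = gf q (fms ws @ [Fm b 0, Fm a 1] @ [Bo q s]) D"
      unfolding LA_def using gf_move[of q c "[]" b ws "[Fm a 1, Bo q s]" D] sm ab by simp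
    also have "\<dots> = 1 / y\<^sup>2 * gf q (fms ws @ [Fm a 0, Fm b 1] @ [Bo q s]) D
        + (1 - 1 / y\<^sup>2) * gf q (fms ws @ [Fm a 1, Fm b 0] @ [Bo q s]) D"
      using gf_exchange_Fm[of q c "fms ws" b 0 a 1 "[Bo q s]" "1 / y\<^sup>2" D] sm ab by simp
    also have "gf q (fms ws @ [Fm a 0, Fm b 1] @ [Bo q s]) D = LB s D"
      unfolding LB_def using gf_move[of q c "[]" a ws "[Fm b 1, Bo q s]" D] sm ab by simp
    also have "gf q (fms ws @ [Fm a 1, Fm b 0] @ [Bo q s]) D = \<Gamma> s (Suc D)"
      unfolding \<Gamma>ab using gf_occupied[of q c ws a "[Fm b 0, Bo q s]" D] sm ab that by simp
    finally show ?thesis using y by (simp add: field_simps)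
  qed
  have C0: "C \<noteq> 0" using C by simp
  have A: "gf q (Fm y 0 # Fm (q / y) 0 # fms ws @ [Bo q s]) C
     = gf q (([Fm b 0] @ fms ws) @ [Bo q s, Fm a 0] @ []) C + y * gf q (([Fm b 0] @ fms ws) @ [Bo q s, Fm a 1] @ []) (C - 1)"
    using gf_Fm[of q c y 0 "Fm (q / y) 0 # fms ws @ [Bo q s]" C] sm ab C0 by (simp add: a_def b_def)
  have B: "gf q (Fm (q * y) 0 # Fm (1 / y) 0 # fms ws @ [Bo q s]) C
     = gf q (([Fm a 0] @ fms ws) @ [Bo q s, Fm b 0] @ []) C + (1 / y) * gf q (([Fm a 0] @ fms ws) @ [Bo q s, Fm b 1] @ []) (C - 1)"
  proof -
    \<comment> \<open>The site \<open>1 / y\<close> must come first before the sweep can be started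
      with it.\<close>
    have "gf q ([] @ [Fm (q * y) 0, Fm (1 / y) 0] @ fms ws @ [Bo q s]) C = gf q ([] @ [Fm (1 / y) 0, Fm (q * y) 0] @ fms ws @ [Bo q s]) C"
      using sm ab by (subst gf_exchange_Fm[where c = c and \<rho> = "q * y * y"]) auto
    then show ?thesis
      using gf_Fm[of q c "1 / y" 0 "Fm (q * y) 0 # fms ws @ [Bo q s]" C] sm ab C0 by (simp add: a_def b_def)
  qed
  have A0: "(1 + y) * gf q (([Fm b 0] @ fms ws) @ [Bo q s, Fm a 0] @ []) C
      = (if s = 0 then (1 + y) * \<Gamma> 0 C else \<Gamma> s C + y * LA (s - 1) C)"
    using gf_exchange_Bo[of q c "[Fm b 0] @ fms ws" q s a 0 "[]" y C] sm ab by (simp add: \<Gamma>_def LA_def a_def)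
  have A1: "(1 + y) * gf q (([Fm b 0] @ fms ws) @ [Bo q s, Fm a 1] @ []) (C - 1) = \<Gamma> (s + 1) (C - 1) + y * LA s (C - 1)"
    using gf_exchange_Bo[of q c "[Fm b 0] @ fms ws" q s a 1 "[]" y "C - 1"] sm ab by (simp add: \<Gamma>_def LA_def a_def)
  have B0: "(1 + 1 / y) * gf q (([Fm a 0] @ fms ws) @ [Bo q s, Fm b 0] @ []) C
      = (if s = 0 then (1 + 1 / y) * \<Gamma> 0 C else \<Gamma> s C + (1 / y) * LB (s - 1) C)"
    using gf_exchange_Bo[of q c "[Fm a 0] @ fms ws" q s b 0 "[]" "1 / y" C] sm ab by (simp add: \<Gamma>' LB_def b_def)
  have B1: "(1 + 1 / y) * gf q (([Fm a 0] @ fms ws) @ [Bo q s, Fm b 1] @ []) (C - 1) = \<Gamma> (s + 1) (C - 1) + (1 / y) * LB s (C - 1)"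
    using gf_exchange_Bo[of q c "[Fm a 0] @ fms ws" q s b 1 "[]" "1 / y" "C - 1"] sm ab by (simp add: \<Gamma>' LB_def b_def)
  define A0' where "A0' = gf q (([Fm b 0] @ fms ws) @ [Bo q s, Fm a 0] @ []) C"
  define A1' where "A1' = gf q (([Fm b 0] @ fms ws) @ [Bo q s, Fm a 1] @ []) (C - 1)"
  define B0' where "B0' = gf q (([Fm a 0] @ fms ws) @ [Bo q s, Fm b 0] @ []) C"
  define B1' where "B1' = gf q (([Fm a 0] @ fms ws) @ [Bo q s, Fm b 1] @ []) (C - 1)"
  note A0 = A0[folded A0'_def] and A1 = A1[folded A1'_def] and B0 = B0[folded B0'_def] and B1 = B1[folded B1'_def]
  have eq1: "LB (s - 1) C = LA (s - 1) C" using LA[of C] LB[of C] C by simp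
  have eq2: "LB s (C - 1) = y\<^sup>2 * LA s (C - 1) - (y\<^sup>2 - 1) * \<Gamma> s C" using LAB[of "C - 1" s] C by simp
  have "(1 + y) * (A0' + y * A1') = (1 + y) * A0' + y * ((1 + y) * A1')" by (simp add: algebra_simps)
  also have "\<dots> = y\<^sup>2 * ((1 + 1 / y) * B0') + y * ((1 + 1 / y) * B1')"
    unfolding A0 A1 B0 B1 eq1 eq2 using y by (cases "s = 0") (simp_all add: field_simps power2_eq_square)
  also have "\<dots> = (1 + y) * (y * (B0' + 1 / y * B1'))"
    using y by (simp add: field_simps power2_eq_square)
  finally have "(1 + y) * (A0' + y * A1') = (1 + y) * (y * (B0' + 1 / y * B1'))" .
  then have "A0' + y * A1' = y * (B0' + 1 / y * B1')" using y by simp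
  then show ?thesis unfolding A B A0'_def A1'_def B0'_def B1'_def .
qed

section \<open>The infinite q-Pochhammer symbol \<open>(-a; q)\<close>, written
  \<open>qp a q\<close>\<close>

definition qp :: "real \<Rightarrow> real \<Rightarrow> real" where
  "qp a q = (\<Prod>i. 1 + a * q ^ i)"

lemma qp_convergent: "0 \<le> q \<Longrightarrow> q < 1 \<Longrightarrow> convergent_prod (\<lambda>i. 1 + a * q ^ i)" for a q :: real
proof -
  assume "0 \<le> q" "q < 1"
  then have "summable (\<lambda>i. norm (1 + a * q ^ i - 1))"
    by (simp add: abs_mult power_abs summable_mult summable_geometric)
  then show ?thesis
    by (rule abs_convergent_prod_imp_convergent_prod[OF summable_imp_abs_convergent_prod])
qed

lemma qp_tendsto:
  assumes "0 \<le> q" "q < 1"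
  shows "(\<lambda>n. \<Prod>i<n. 1 + a * q ^ i) \<longlonglongrightarrow> qp a q"
proof -
  have "(\<lambda>n. \<Prod>i<Suc n. 1 + a * q ^ i) \<longlonglongrightarrow> qp a q"
    using convergent_prod_LIMSEQ[OF qp_convergent[OF assms]] by (simp add: qp_def lessThan_Suc_atMost)
  then show ?thesis by (rule LIMSEQ_imp_Suc)
qed

lemma prod_qp_Suc: "(\<Prod>i<Suc n. 1 + a * q ^ i) = (1 + a) * (\<Prod>i<n. 1 + (q * a) * q ^ i)" for a :: real
  by (simp add: prod.lessThan_Suc_shift algebra_simps del: prod.lessThan_Suc)

lemma qp_rec:
  assumes "0 \<le> q" "q < 1"
  shows "qp a q = (1 + a) * qp (q * a) q"
proof (rule LIMSEQ_unique)
  show "(\<lambda>n. \<Prod>i<Suc n. 1 + a * q ^ i) \<longlonglongrightarrow> qp a q"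
    using qp_tendsto[OF assms] by (rule LIMSEQ_Suc)
  show "(\<lambda>n. \<Prod>i<Suc n. 1 + a * q ^ i) \<longlonglongrightarrow> (1 + a) * qp (q * a) q"
    unfolding prod_qp_Suc by (intro tendsto_intros qp_tendsto assms)
qed

lemma qp_split:
  assumes "0 \<le> q" "q < 1"
  shows "qp a q = (\<Prod>i<n. 1 + a * q ^ i) * qp (a * q ^ n) q"
proof (induction n arbitrary: a)
  case (Suc n)
  have "qp a q = (1 + a) * qp (q * a) q" by (rule qp_rec[OF assms])
  also have "qp (q * a) q = (\<Prod>i<n. 1 + (q * a) * q ^ i) * qp (q * a * q ^ n) q" by (rule Suc.IH)
  finally show ?case unfolding prod_qp_Suc by (simp add: mult_ac)
qed simp

lemma prod_le_qp:
  assumes "0 \<le> q" "q < 1" "0 \<le> a"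
  shows "(\<Prod>i<n. 1 + a * q ^ i) \<le> qp a q"
proof (rule incseq_le[OF incseq_SucI qp_tendsto[OF assms(1,2)]])
  fix n
  have "(\<Prod>i<n. 1 + a * q ^ i) * 1 \<le> (\<Prod>i<n. 1 + a * q ^ i) * (1 + a * q ^ n)"
    using assms by (intro mult_left_mono prod_nonneg) auto
  then show "(\<Prod>i<n. 1 + a * q ^ i) \<le> (\<Prod>i<Suc n. 1 + a * q ^ i)" by simp
qed

lemma qp_ge_1: "0 \<le> q \<Longrightarrow> q < 1 \<Longrightarrow> 0 \<le> a \<Longrightarrow> 1 \<le> qp a q"
  using prod_le_qp[of q a 0] by simp

lemma qp_shift_tendsto_1:
  assumes "0 \<le> q" "q < 1" "0 \<le> a"
  shows "(\<lambda>n. qp (a * q ^ n) q) \<longlonglongrightarrow> 1"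
proof -
  have "(\<lambda>n. qp a q / (\<Prod>i<n. 1 + a * q ^ i)) \<longlonglongrightarrow> qp a q / qp a q"
    using qp_ge_1[OF assms] by (intro tendsto_intros qp_tendsto assms) auto
  moreover have "qp a q / (\<Prod>i<n. 1 + a * q ^ i) = qp (a * q ^ n) q" for n
  proof -
    have "0 < (\<Prod>i<n. 1 + a * q ^ i)" using assms by (intro prod_pos) (auto intro: add_pos_nonneg)
    moreover from this have "(\<Prod>i<n. 1 + a * q ^ i) \<noteq> 0" by linarith
    ultimately show ?thesis using qp_split[OF assms(1,2), of a n] by (metis nonzero_mult_div_cancel_left)
  qed
  moreover have "qp a q / qp a q = 1" using qp_ge_1[OF assms] by simp
  ultimately show ?thesis by simp
qed

section \<open>Asymptotics of a pair whose first weight is large\<close>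

lemma run_le_const:
  assumes "0 \<le> B" "small c S" "\<And>S' C'. succs q S C S' C' \<Longrightarrow> K S' C' \<le> B"
  shows "run q S C K \<le> B * exp (c * wsum S)"
proof -
  have "run q S C K \<le> run q S C (\<lambda>_ _. B)"
    using assms by (intro run_mono) (auto simp: small_nonneg)
  also have "\<dots> = B * run q S C (\<lambda>_ _. 1)" by (rule run_const)
  also have "\<dots> \<le> B * exp (c * wsum S)"
    using assms run_one_le by (intro mult_left_mono) auto
  finally show ?thesis .
qed

lemma prod_1_plus_nonneg: "0 \<le> a \<Longrightarrow> 0 \<le> q \<Longrightarrow> 0 \<le> (\<Prod>i<n. 1 + a * q ^ i)" for a q :: real
  by (intro prod_nonneg) auto

text \<open>Without the constraint at the first site each sweep yields a factor
  \<open>1 + w * q ^ i\<close>; the other sites are estimated by \<open>ebound\<close>.\<close>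

lemma sweeps_Fm_le:
  assumes q: "0 \<le> q" "q < 1" and "small c S" "0 \<le> w"
  shows "sweeps q T (Fm w a # S) C \<le> (\<Prod>i<T. 1 + w * q ^ i) * ebound q c (wsum S)"
  using assms(3,4)
proof (induction T arbitrary: w a S C)
  case 0
  have "0 \<le> wsum S" using 0 by (auto simp: wsum_def small_def nonneg_def intro!: sum_list_nonneg)
  then show ?case using 0 q by (simp add: ebound_def small_def)
next
  case (Suc T)
  define P where "P = (\<Prod>i<T. 1 + (q * w) * q ^ i)"
  have P: "0 \<le> P" unfolding P_def using q Suc.prems by (intro prod_1_plus_nonneg) auto
  have *: "run q S D (\<lambda>S'. sweeps q T (Fm (q * w) b # S')) \<le> P * ebound q c (wsum S)" for D b
  proof -
    have "run q S D (\<lambda>S'. sweeps q T (Fm (q * w) b # S')) \<le> P * ebound q c (q * wsum S) * exp (c * wsum S)"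
    proof (rule run_le_const)
      fix S' C' assume s: "succs q S D S' C'"
      show "sweeps q T (Fm (q * w) b # S') C' \<le> P * ebound q c (q * wsum S)"
        using Suc.IH[OF succs_small[OF s], of "q * w" b C'] succs_wsum[OF s] Suc.prems q by (simp add: P_def)
    qed (use P Suc.prems less_imp_le[OF ebound_pos] in auto)
    also have "\<dots> = P * ebound q c (wsum S)"
      using ebound_step[OF q(2), of c "wsum S"] by (simp add: mult_ac)
    finally show ?thesis .
  qed
  have "(if C + a = 0 then 0 else w * run q S (C + a - 1) (\<lambda>S'. sweeps q T (Fm (q * w) 1 # S'))) \<le> w * (P * ebound q c (wsum S))"
    using *[of "C + a - 1" 1] Suc.prems P less_imp_le[OF ebound_pos] by (auto intro!: mult_left_mono mult_nonneg_nonneg)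
  with *[of "C + a" 0] have "sweeps q (Suc T) (Fm w a # S) C \<le> P * ebound q c (wsum S) + w * (P * ebound q c (wsum S))"
    unfolding sweeps.simps run.simps by (rule add_mono)
  then show ?case unfolding prod_qp_Suc P_def by (simp add: algebra_simps)
qed

lemma nonneg_vacate: "nonneg S \<Longrightarrow> 0 \<le> q \<Longrightarrow> nonneg (map (vacate q) S)"
proof (induction S)
  case (Cons s S)
  then show ?case by (cases s) auto
qed simp

text \<open>All other sites are left empty. Then every particle is back in the carrier or on the
  first site at the next visit, and as soon as there is one particle both choices are open there in
  every sweep.\<close>

lemma sweeps_Fm_ge:
  assumes "0 \<le> q" "nonneg S" "0 \<le> w" "C + a \<noteq> 0"
  shows "(\<Prod>i<T. 1 + w * q ^ i) \<le> sweeps q T (Fm w a # S) C"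
  using assms(2-4)
proof (induction T arbitrary: w a S C)
  case (Suc T)
  define P where "P = (\<Prod>i<T. 1 + (q * w) * q ^ i)"
  have *: "P \<le> run q S D (\<lambda>S'. sweeps q T (Fm (q * w) b # S'))" if "D + occs S + b \<noteq> 0" for D b
  proof -
    have v: "nonneg (map (vacate q) S)"
      using Suc.prems(1) assms(1) by (rule nonneg_vacate)
    have "P \<le> sweeps q T (Fm (q * w) b # map (vacate q) S) (D + occs S)"
      unfolding P_def using that v Suc.prems assms by (intro Suc.IH) auto
    also have "\<dots> \<le> run q S D (\<lambda>S'. sweeps q T (Fm (q * w) b # S'))"
      using Suc.prems assms by (intro run_ge_vacate sweeps_nonneg) (auto dest: succs_nonneg)
    finally show ?thesis .
  qed
  have "sweeps q (Suc T) (Fm w a # S) C \<ge> P + w * P"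
    using *[of "C + a" 0] *[of "C + a - 1" 1] Suc.prems by (auto intro!: add_mono mult_left_mono)
  then show ?case unfolding prod_qp_Suc P_def by (simp add: algebra_simps)
qed simp

lemma gf_Fm_ge:
  assumes q: "0 \<le> q" "q < 1" and "small c S" "0 \<le> w" "C + a \<noteq> 0"
  shows "qp w q \<le> gf q (Fm w a # S) C"
  by (rule LIMSEQ_le[OF qp_tendsto[OF q] sweeps_tendsto[OF q]])
     (use assms in \<open>auto intro!: exI[of _ 0] sweeps_Fm_ge simp: small_nonneg\<close>)

text \<open>
  For large \<open>y\<close> and small \<open>w\<close> the first site is occupied in each of the first \<open>n\<close> sweeps up to a
  negligible error, and then the sites \<open>S\<close> do not notice the pair.
\<close>

lemma sweeps_pair_le:
  assumes q: "0 \<le> q" "q < 1" and "small c S" "0 \<le> y" "0 \<le> w"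
  shows "sweeps q (n + T) (Fm y 1 # Fm w 0 # S) C \<le> (\<Prod>i<n + T. 1 + y * q ^ i) *
     (ebound q c (q ^ n * (w + wsum S)) * sweeps q n S C
      + (\<Sum>i<n. 1 / (1 + y * q ^ i) + w * q ^ i) * ebound q c (w + wsum S))"
  using assms(3-5)
proof (induction n arbitrary: y w S C)
  case 0
  then show ?case using sweeps_Fm_le[OF q, of c "Fm w 0 # S" y T 1 C] by simp
next
  case (Suc n)
  define P where "P = (\<Prod>i<n + T. 1 + (q * y) * q ^ i)"
  define B where "B = ebound q c (w + wsum S)"
  define B' where "B' = ebound q c (q * (w + wsum S))"
  define U where "U = ebound q c (q ^ Suc n * (w + wsum S))"
  define e where "e = (\<Sum>i<n. 1 / (1 + (q * y) * q ^ i) + (q * w) * q ^ i)"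
  have c: "1 \<le> c" using Suc.prems by (simp add: small_def)
  have pos: "0 \<le> P" "0 \<le> B" "0 \<le> B'" "0 \<le> U" "0 \<le> e"
    unfolding P_def B_def B'_def U_def e_def using q Suc.prems less_imp_le[OF ebound_pos]
    by (auto intro!: prod_1_plus_nonneg sum_nonneg add_nonneg_nonneg)
  have ws: "0 \<le> wsum S" using Suc.prems by (auto simp: wsum_def small_def nonneg_def intro!: sum_list_nonneg)
  have "exp (c * wsum S) * B' \<le> exp (c * (w + wsum S)) * B'"
    using pos Suc.prems c by (intro mult_right_mono) auto
  also have "\<dots> = B" unfolding B_def B'_def by (rule ebound_step[OF q(2)])
  finally have BB: "exp (c * wsum S) * B' \<le> B" .
  \<comment> \<open>The first site is left empty: relative weight
    \<open>1 / (1 + y)\<close>.\<close>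
  have t1: "run q (Fm w 0 # S) (C + 1) (\<lambda>S'. sweeps q (n + T) (Fm (q * y) 0 # S')) \<le> P * B"
  proof -
    have "run q (Fm w 0 # S) (C + 1) (\<lambda>S'. sweeps q (n + T) (Fm (q * y) 0 # S')) \<le> P * B' * exp (c * wsum (Fm w 0 # S))"
    proof (rule run_le_const)
      fix S' C' assume s: "succs q (Fm w 0 # S) (C + 1) S' C'"
      show "sweeps q (n + T) (Fm (q * y) 0 # S') C' \<le> P * B'"
        using sweeps_Fm_le[OF q succs_small[OF s], of c "q * y" "n + T" 0 C'] succs_wsum[OF s] Suc.prems q
        by (simp add: P_def B'_def)
    qed (use pos Suc.prems in auto)
    also have "\<dots> = P * B" unfolding B_def B'_def using ebound_step[OF q(2), of c "w + wsum S"] by (simp add: mult_ac)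
    finally show ?thesis .
  qed
  \<comment> \<open>Both sites are occupied: the second one costs a factor \<open>w\<close>.\<close>
  have t2: "run q S (C - 1) (\<lambda>S'. sweeps q (n + T) (Fm (q * y) 1 # Fm (q * w) 1 # S')) \<le> P * B"
  proof -
    have "run q S (C - 1) (\<lambda>S'. sweeps q (n + T) (Fm (q * y) 1 # Fm (q * w) 1 # S')) \<le> P * B' * exp (c * wsum S)"
    proof (rule run_le_const)
      fix S' C' assume s: "succs q S (C - 1) S' C'"
      show "sweeps q (n + T) (Fm (q * y) 1 # Fm (q * w) 1 # S') C' \<le> P * B'"
        using sweeps_Fm_le[OF q, of c "Fm (q * w) 1 # S'" "q * y" "n + T" 1 C'] succs_small[OF s] succs_wsum[OF s] Suc.prems q
        by (simp add: P_def B'_def algebra_simps)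
    qed (use pos Suc.prems in auto)
    also have "\<dots> \<le> P * B" using mult_left_mono[OF BB pos(1)] by (simp add: mult_ac)
    finally show ?thesis .
  qed
  \<comment> \<open>The pair keeps its state and the carrier enters \<open>S\<close> with content
    \<open>C\<close> as if the pair were absent; here the induction hypothesis applies.\<close>
  have t3: "run q S C (\<lambda>S'. sweeps q (n + T) (Fm (q * y) 1 # Fm (q * w) 0 # S')) \<le> P * (U * sweeps q (Suc n) S C + e * B)"
  proof -
    have "run q S C (\<lambda>S'. sweeps q (n + T) (Fm (q * y) 1 # Fm (q * w) 0 # S'))
      \<le> run q S C (\<lambda>S' C'. P * U * sweeps q n S' C' + P * e * B' * 1)"
    proof (rule run_mono)
      fix S' C' assume s: "succs q S C S' C'"
      have "q ^ n * (q * w + wsum S') = q ^ Suc n * (w + wsum S)" "q * w + wsum S' = q * (w + wsum S)"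
        using succs_wsum[OF s] by (simp_all add: algebra_simps)
      then show "sweeps q (n + T) (Fm (q * y) 1 # Fm (q * w) 0 # S') C' \<le> P * U * sweeps q n S' C' + P * e * B' * 1"
        using Suc.IH[OF succs_small[OF s], of "q * y" "q * w" C'] Suc.prems q
        by (simp add: P_def U_def e_def B'_def algebra_simps)
    qed (use Suc.prems small_nonneg in auto)
    also have "\<dots> = P * U * sweeps q (Suc n) S C + P * e * B' * run q S C (\<lambda>_ _. 1)"
      unfolding run_lin by simp
    also have "\<dots> \<le> P * U * sweeps q (Suc n) S C + P * e * B' * exp (c * wsum S)"
      using pos run_one_le Suc.prems by (intro add_left_mono mult_left_mono) auto
    also have "\<dots> \<le> P * U * sweeps q (Suc n) S C + P * e * B"
      using mult_left_mono[OF BB, of "P * e"] pos by (simp add: mult_ac)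
    finally show ?thesis by (simp add: algebra_simps)
  qed
  have s0: "0 \<le> sweeps q (Suc n) S C" using Suc.prems q small_nonneg by (intro sweeps_nonneg) auto
  have "(if C = 0 then 0 else w * run q S (C - 1) (\<lambda>S'. sweeps q (n + T) (Fm (q * y) 1 # Fm (q * w) 1 # S'))) \<le> w * (P * B)"
    using t2 Suc.prems pos by (auto intro!: mult_left_mono mult_nonneg_nonneg)
  then have "run q (Fm w 0 # S) C (\<lambda>S'. sweeps q (n + T) (Fm (q * y) 1 # S'))
    \<le> P * (U * sweeps q (Suc n) S C + e * B) + w * (P * B)"
    unfolding run.simps add_0_right by (rule add_mono[OF t3])
  moreover have "sweeps q (Suc n + T) (Fm y 1 # Fm w 0 # S) C = run q (Fm w 0 # S) (C + 1) (\<lambda>S'. sweeps q (n + T) (Fm (q * y) 0 # S'))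
     + y * run q (Fm w 0 # S) C (\<lambda>S'. sweeps q (n + T) (Fm (q * y) 1 # S'))"
    by (simp del: run.simps(2) add: run.simps(2)[of q y])
  ultimately have "sweeps q (Suc n + T) (Fm y 1 # Fm w 0 # S) C
    \<le> P * B + y * (P * (U * sweeps q (Suc n) S C + e * B) + w * (P * B))"
    using t1 Suc.prems by (auto intro!: add_mono mult_left_mono simp del: run.simps sweeps.simps)
  also have "\<dots> \<le> (1 + y) * P * (U * sweeps q (Suc n) S C + (1 / (1 + y) + w + e) * B)"
  proof -
    have "(1 + y) * P * (U * sweeps q (Suc n) S C + (1 / (1 + y) + w + e) * B) =
      P * B + y * (P * (U * sweeps q (Suc n) S C + e * B) + w * (P * B))
       + P * (U * sweeps q (Suc n) S C) + P * (w * B) + P * (e * B)"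
      using Suc.prems by (simp add: field_simps)
    moreover have "0 \<le> P * (U * sweeps q (Suc n) S C)" "0 \<le> P * (w * B)" "0 \<le> P * (e * B)"
      using pos s0 Suc.prems by (auto simp del: sweeps.simps)
    ultimately show ?thesis by linarith
  qed
  also have "(1 + y) * P = (\<Prod>i<Suc n + T. 1 + y * q ^ i)"
    unfolding P_def add_Suc prod_qp_Suc ..
  also have "1 / (1 + y) + w + e = (\<Sum>i<Suc n. 1 / (1 + y * q ^ i) + w * q ^ i)"
    unfolding e_def by (simp add: sum.lessThan_Suc_shift mult_ac del: sum.lessThan_Suc)
  finally show ?case unfolding U_def B_def .
qed

text \<open>Only those histories are kept in which the first site stays occupied and the second one
  empty during \<open>n\<close> sweeps; \<open>gf_Fm_ge\<close> bounds what follows.\<close>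

lemma gf_pair_ge:
  assumes q: "0 \<le> q" "q < 1" and "small c S" "0 \<le> y" "0 \<le> w"
  shows "(\<Prod>i<n. y * q ^ i) * sweeps q n S C * qp (y * q ^ n) q \<le> gf q (Fm y 1 # Fm w 0 # S) C"
  using assms(3-5)
proof (induction n arbitrary: y w S C)
  case 0
  then show ?case using gf_Fm_ge[OF q, of c "Fm w 0 # S" y C 1] by simp
next
  case (Suc n)
  have nn: "0 \<le> gf q S' C'" if "small c S'" for S' C'
    using sweeps_nonneg[of q S' 0 C'] sweeps_le_gf[OF q that, of 0 C'] q by simp
  have "(\<Prod>i<Suc n. y * q ^ i) * sweeps q (Suc n) S C * qp (y * q ^ Suc n) q
    = y * (((\<Prod>i<n. (q * y) * q ^ i) * qp (q * y * q ^ n) q) * run q S C (sweeps q n))"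
    by (simp add: prod.lessThan_Suc_shift mult_ac del: prod.lessThan_Suc)
  also have "\<dots> = y * run q S C (\<lambda>S' C'. (\<Prod>i<n. (q * y) * q ^ i) * qp (q * y * q ^ n) q * sweeps q n S' C')"
    unfolding run_scale ..
  also have "\<dots> \<le> y * run q S C (\<lambda>S'. gf q (Fm (q * y) 1 # Fm (q * w) 0 # S'))"
  proof (intro mult_left_mono run_mono)
    fix S' C' assume s: "succs q S C S' C'"
    show "(\<Prod>i<n. (q * y) * q ^ i) * qp (q * y * q ^ n) q * sweeps q n S' C' \<le> gf q (Fm (q * y) 1 # Fm (q * w) 0 # S') C'"
      using Suc.IH[OF succs_small[OF s], of "q * y" "q * w" C'] Suc.prems q by (simp add: mult_ac)
  qed (use Suc.prems small_nonneg in auto)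
  also have "\<dots> \<le> y * run q (Fm w 0 # S) C (\<lambda>S'. gf q (Fm (q * y) 1 # S'))"
  proof (rule mult_left_mono)
    have "0 \<le> run q S (C - 1) (\<lambda>S'. gf q (Fm (q * y) 1 # Fm (q * w) 1 # S'))"
      using Suc.prems q small_nonneg by (intro run_nonneg nn) (auto dest: succs_small[where c = c])
    then show "run q S C (\<lambda>S'. gf q (Fm (q * y) 1 # Fm (q * w) 0 # S')) \<le> run q (Fm w 0 # S) C (\<lambda>S'. gf q (Fm (q * y) 1 # S'))"
      using Suc.prems by simp
  qed (use Suc.prems in simp)
  also have "\<dots> \<le> run q (Fm y 1 # Fm w 0 # S) C (gf q)"
  proof -
    have "0 \<le> run q (Fm w 0 # S) (C + 1) (\<lambda>S'. gf q (Fm (q * y) 0 # S'))"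
      using Suc.prems q small_nonneg by (intro run_nonneg nn) (auto dest: succs_small[where c = c])
    then show ?thesis by simp
  qed
  also have "\<dots> = gf q (Fm y 1 # Fm w 0 # S) C"
    using Suc.prems q by (intro gf_unfold[where c = c, symmetric]) auto
  finally show ?case .
qed

text \<open>The quotient \<open>R\<close> is constant along the orbit
  \<open>Y m = y / q ^ m\<close>. For a fixed number \<open>n\<close> of controlled sweeps first
  \<open>m\<close> and then \<open>n\<close> tends to infinity, which bounds \<open>R y\<close> from
  both sides. The content becomes \<open>C - 1\<close> because the first site, occupied from the
  start by \<open>gf_occupied\<close>, binds one particle.\<close>

lemma gf_pair:
  assumes q: "0 < q" "q < 1" and y: "0 < y" and ws: "\<forall>w\<in>set ws. 0 < w" and C: "length ws < C"
  shows "gf q (Fm y 0 # Fm (q / y) 0 # fms ws @ [Bo q s]) C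
    = qp y q * qp (q / y) q * gf q (fms ws @ [Bo q s]) (C - 1)"
proof -
  define c where "c = 1 / (1 - q)"
  have c: "1 \<le> c" "q \<le> 1 - 1 / c" using q by (auto simp: c_def field_simps)
  have q0: "0 \<le> q" using q by simp
  define S where "S = fms ws @ [Bo q s]"
  have S: "small c S" using c q ws by (auto simp: S_def)
  define Z where "Z y = gf q (Fm y 0 # Fm (q / y) 0 # S) C" for y
  define R where "R y = Z y / (qp y q * qp (q / y) q)" for y
  have qp_pos: "0 < qp a q" if "0 \<le> a" for a using qp_ge_1[OF q0 q(2) that] by simp
  have R_shift: "R (q * y) = R y" if y: "0 < y" for y
  proof -
    have Zy: "Z y = y * Z (q * y)" using gf_pair_shift[OF q y ws C, of s] q by (simp add: Z_def S_def)
    have p: "qp y q = (1 + y) * qp (q * y) q" "qp (1 / y) q = (1 + 1 / y) * qp (q / y) q"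
      using qp_rec[OF q0 q(2), of y] qp_rec[OF q0 q(2), of "1 / y"] by simp_all
    have "q / (q * y) = 1 / y" using q by simp
    then have "R (q * y) = Z (q * y) / (qp (q * y) q * ((1 + 1 / y) * qp (q / y) q))" by (simp add: R_def p)
    also have "\<dots> = y * Z (q * y) / ((1 + y) * qp (q * y) q * qp (q / y) q)"
      using y qp_pos[of "q * y"] qp_pos[of "q / y"] q by (simp add: field_simps)
    finally show ?thesis by (simp add: R_def p Zy)
  qed
  define Y where "Y n = y / q ^ n" for n
  have Y: "0 < Y n" for n using y q by (simp add: Y_def)
  have R_Y: "R (Y n) = R y" for n
  proof (induction n)
    case (Suc n)
    have "q * Y (Suc n) = Y n" using q by (simp add: Y_def)
    with R_shift[OF Y[of "Suc n"]] Suc show ?case by simp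
  qed (simp add: Y_def)
  have qY: "q / Y n = (q / y) * q ^ n" for n by (simp add: Y_def)
  have qpow: "(\<lambda>n. q ^ n) \<longlonglongrightarrow> 0" using q by (intro LIMSEQ_power_zero) auto
  have qY0: "(\<lambda>n. q / Y n) \<longlonglongrightarrow> 0" unfolding qY by (rule tendsto_mult_right_zero[OF qpow])
  have qp1: "(\<lambda>n. qp (q / Y n) q) \<longlonglongrightarrow> 1"
    unfolding qY using q y by (intro qp_shift_tendsto_1) auto
  have occ: "Z y' = gf q (Fm y' 1 # Fm (q / y') 0 # S) (C - 1)" if "0 < y'" for y'
    using gf_occupied[of q c "[]" y' "Fm (q / y') 0 # S" "C - 1"] S q that C c by (simp add: Z_def)
  have inv: "(\<lambda>n. 1 / (1 + Y n * q ^ i)) \<longlonglongrightarrow> 0" for i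
  proof -
    have "(\<lambda>n. q ^ n / (q ^ n + y * q ^ i)) \<longlonglongrightarrow> 0 / (0 + y * q ^ i)"
      using y q by (intro tendsto_intros qpow) auto
    moreover have "q ^ n / (q ^ n + y * q ^ i) = 1 / (1 + Y n * q ^ i)" for n
      using q y by (simp add: Y_def field_simps)
    ultimately show ?thesis by simp
  qed
  have upper_n: "R y \<le> ebound q c (q ^ n * wsum S) * gf q S (C - 1)" for n
  proof -
    define X where "X m = ebound q c (q ^ n * (q / Y m + wsum S)) * sweeps q n S (C - 1)
      + (\<Sum>i<n. 1 / (1 + Y m * q ^ i) + (q / Y m) * q ^ i) * ebound q c (q / Y m + wsum S)" for m
    have "R y \<le> X m" for m
    proof -
      have X0: "0 \<le> X m" unfolding X_def using q Y[of m] S small_nonneg less_imp_le[OF ebound_pos]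
        by (intro add_nonneg_nonneg mult_nonneg_nonneg sum_nonneg sweeps_nonneg) (auto intro: less_imp_le)
      have "Z (Y m) \<le> qp (Y m) q * X m"
        unfolding occ[OF Y]
      proof (rule LIMSEQ_le_const2)
        show "(\<lambda>T. sweeps q T (Fm (Y m) 1 # Fm (q / Y m) 0 # S) (C - 1)) \<longlonglongrightarrow> gf q (Fm (Y m) 1 # Fm (q / Y m) 0 # S) (C - 1)"
          using q S Y[of m] less_imp_le[OF Y] by (intro sweeps_tendsto[where c = c]) auto
        have "sweeps q (n + T) (Fm (Y m) 1 # Fm (q / Y m) 0 # S) (C - 1) \<le> qp (Y m) q * X m" for T
        proof -
          have "sweeps q (n + T) (Fm (Y m) 1 # Fm (q / Y m) 0 # S) (C - 1) \<le> (\<Prod>i<n + T. 1 + Y m * q ^ i) * X m"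
            unfolding X_def using q S Y[of m] by (intro sweeps_pair_le) auto
          also have "\<dots> \<le> qp (Y m) q * X m"
            using X0 Y[of m] q by (intro mult_right_mono prod_le_qp) auto
          finally show ?thesis .
        qed
        then show "\<exists>N. \<forall>T\<ge>N. sweeps q T (Fm (Y m) 1 # Fm (q / Y m) 0 # S) (C - 1) \<le> qp (Y m) q * X m"
          by (metis le_Suc_ex)
      qed
      also have "\<dots> \<le> qp (Y m) q * X m * qp (q / Y m) q"
        using mult_left_mono[of 1 "qp (q / Y m) q" "qp (Y m) q * X m"] X0 qp_pos[of "Y m"] Y[of m]
          qp_ge_1[OF q0 q(2), of "q / Y m"] q by simp
      finally have "R (Y m) \<le> X m"
        unfolding R_def using qp_pos[of "Y m"] qp_pos[of "q / Y m"] Y[of m] q by (simp add: field_simps)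
      then show ?thesis by (simp add: R_Y)
    qed
    moreover have "X \<longlonglongrightarrow> ebound q c (q ^ n * (0 + wsum S)) * sweeps q n S (C - 1)
        + (\<Sum>i<n. 0 + 0 * q ^ i) * ebound q c (0 + wsum S)"
      unfolding X_def ebound_def using q by (intro tendsto_intros inv qY0) auto
    ultimately have "R y \<le> ebound q c (q ^ n * wsum S) * sweeps q n S (C - 1)"
      by (intro LIMSEQ_le_const[of X]) auto
    also have "\<dots> \<le> ebound q c (q ^ n * wsum S) * gf q S (C - 1)"
      using less_imp_le[OF ebound_pos] sweeps_le_gf[OF q0 q(2) S] by (intro mult_left_mono) auto
    finally show ?thesis .
  qed
  have "(\<lambda>n. ebound q c (q ^ n * wsum S) * gf q S (C - 1)) \<longlonglongrightarrow> ebound q c (0 * wsum S) * gf q S (C - 1)"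
    unfolding ebound_def using q by (intro tendsto_intros qpow) auto
  then have upper: "R y \<le> gf q S (C - 1)"
    using upper_n by (intro LIMSEQ_le_const) (auto simp: ebound_def)
  have lower_n: "sweeps q n S (C - 1) \<le> R y" for n
  proof -
    define X where "X m = (\<Prod>i<n. 1 - 1 / (1 + Y m * q ^ i)) * sweeps q n S (C - 1) / qp (q / Y m) q" for m
    have "X m \<le> R y" for m
    proof -
      have pos: "0 < 1 + Y m * q ^ i" for i using Y[of m] q by (simp add: add_pos_pos)
      have "(\<Prod>i<n. 1 - 1 / (1 + Y m * q ^ i)) = (\<Prod>i<n. Y m * q ^ i / (1 + Y m * q ^ i))"
        using pos by (intro prod.cong refl) (metis add_diff_cancel_left' diff_divide_distrib divide_self order_less_irrefl)
      also have "\<dots> = (\<Prod>i<n. Y m * q ^ i) / (\<Prod>i<n. 1 + Y m * q ^ i)" by (rule prod_dividef)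
      finally have e: "(\<Prod>i<n. 1 - 1 / (1 + Y m * q ^ i)) * qp (Y m) q = (\<Prod>i<n. Y m * q ^ i) * qp (Y m * q ^ n) q"
        using qp_split[OF q0 q(2), of "Y m" n] less_imp_neq[OF pos] by (auto simp: eq_commute[of 0])
      have "X m * (qp (Y m) q * qp (q / Y m) q) = (\<Prod>i<n. Y m * q ^ i) * sweeps q n S (C - 1) * qp (Y m * q ^ n) q"
        unfolding X_def using qp_pos[of "q / Y m"] Y[of m] q e by (simp add: field_simps)
      also have "\<dots> \<le> Z (Y m)" unfolding occ[OF Y] using q S Y[of m] by (intro gf_pair_ge) auto
      finally have "X m \<le> R (Y m)"
        unfolding R_def using qp_pos[of "Y m"] qp_pos[of "q / Y m"] Y[of m] q by (simp add: field_simps)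
      then show ?thesis by (simp add: R_Y)
    qed
    moreover have "X \<longlonglongrightarrow> (\<Prod>i<n. 1 - 0) * sweeps q n S (C - 1) / 1"
      unfolding X_def by (intro tendsto_intros inv qp1) auto
    ultimately show ?thesis by (intro LIMSEQ_le_const2[of X]) auto
  qed
  have "gf q S (C - 1) \<le> R y"
    using lower_n by (intro LIMSEQ_le_const2[OF sweeps_tendsto[OF q0 q(2) S]]) auto
  with upper have "R y = gf q S (C - 1)" by simp
  then show ?thesis
    using qp_pos[of y] qp_pos[of "q / y"] y q unfolding R_def Z_def S_def by (simp add: field_simps)
qed

section \<open>Elimination of the parity bit\<close>

text \<open>
  The bit \<open>b\<close> reserves one particle of the carrier. At a \<open>Bo\<close> site the parity of what
  the carrier retains is added to it, so that a window can only be filled up when the parity condition holds.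
\<close>

fun runb :: "real \<Rightarrow> site list \<Rightarrow> nat \<Rightarrow> nat \<Rightarrow> (site list \<Rightarrow> nat \<Rightarrow> nat \<Rightarrow> real) \<Rightarrow> real" where
  "runb q [] C b K = K [] C b"
| "runb q (Fm w a # S) C b K =
     (\<Sum>x | x \<le> 1 \<and> x + b \<le> C + a. w ^ x * runb q S (C + a - x) b (\<lambda>S'. K (Fm (q * w) x # S')))"
| "runb q (Bo z f # S) C b K =
     (\<Sum>x | x + b \<le> C. z ^ x * runb q S (C - x + f) ((b + (C - x)) mod 2) (\<lambda>S'. K (Bo (q * z) x # S')))"

primrec sweepsb :: "real \<Rightarrow> nat \<Rightarrow> site list \<Rightarrow> nat \<Rightarrow> nat \<Rightarrow> real" where
  "sweepsb q 0 S C b = 1"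
| "sweepsb q (Suc T) S C b = runb q S C b (sweepsb q T)"

lemma runb_append:
  "runb q (A @ B) C b K = runb q A C b (\<lambda>A' C' b'. runb q B C' b' (\<lambda>B'. K (A' @ B')))"
  by (induction q A C b K rule: runb.induct) simp_all

lemma Fm_sum:
  "(\<Sum>x | x \<le> 1 \<and> x + b \<le> c. g x) = (if b \<le> c then g 0 else 0) + (if Suc b \<le> c then g (1 :: nat) else (0 :: real))"
proof -
  have "{x :: nat. x \<le> 1 \<and> x + b \<le> c} = (if Suc b \<le> c then {0, 1} else if b \<le> c then {0} else {})"
    by (auto simp: le_Suc_eq)
  then show ?thesis by simp
qed

lemma runb_Fm:
  "runb q (Fm w a # S) C b K = (if b \<le> C + a then runb q S (C + a) b (\<lambda>S'. K (Fm (q * w) 0 # S')) else 0)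
     + (if Suc b \<le> C + a then w * runb q S (C + a - 1) b (\<lambda>S'. K (Fm (q * w) 1 # S')) else 0)"
  unfolding runb.simps Fm_sum by simp

definition all_Fm :: "site list \<Rightarrow> bool" where
  "all_Fm V \<longleftrightarrow> (\<forall>s\<in>set V. fst (skel s) \<and> occ s \<le> 1)"

lemma all_Fm_simps [simp]:
  "all_Fm []" "all_Fm (Fm w a # V) \<longleftrightarrow> a \<le> 1 \<and> all_Fm V" "\<not> all_Fm (Bo w a # V)"
  by (auto simp: all_Fm_def)

lemma occs_le_length: "all_Fm V \<Longrightarrow> occs V \<le> length V"
proof (induction V)
  case (Cons s V)
  then show ?case by (cases s) auto
qed simp

lemma succs_all_Fm: "succs q V C V' C' \<Longrightarrow> all_Fm V \<Longrightarrow> all_Fm V' \<and> length V' = length V"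
proof -
  assume s: "succs q V C V' C'" and V: "all_Fm V"
  have m: "map skel V' = map (\<lambda>s. (fst (skel s), q * snd (skel s))) V"
    using s by (simp add: succs_def skels_def)
  then have l: "length V' = length V" by (metis length_map)
  have "fst (skel (V' ! i)) = fst (skel (V ! i))" if "i < length V" for i
    using m that l by (metis (no_types, lifting) fst_conv nth_map)
  then have "\<forall>s\<in>set V'. fst (skel s)" using V l by (metis all_Fm_def in_set_conv_nth)
  then show ?thesis using s l by (simp add: succs_def all_Fm_def)
qed

text \<open>On \<open>Fm\<close> sites the reserved particle merely travels along, so content
  \<open>D + b\<close> with \<open>b\<close> reserved behaves like content \<open>D\<close>.\<close>

lemma runb_all_Fm:
  "all_Fm V \<Longrightarrow> runb q V (D + b) b K = run q V D (\<lambda>V' C'. K V' (C' + b) b)"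
proof (induction V arbitrary: D K)
  case (Cons s V)
  then obtain w a where s: "s = Fm w a" by (cases s) auto
  have ih: "runb q V (D' + b) b K = run q V D' (\<lambda>V' C'. K V' (C' + b) b)" for D' K
    using Cons s by simp
  show ?case
  proof (cases "D + a")
    case 0
    then show ?thesis using ih[of 0] by (simp add: s runb_Fm del: runb.simps(2))
  next
    case (Suc d)
    then have e: "D + b + a = Suc (d + b)" by simp
    with Suc show ?thesis using ih[of "Suc d"] ih[of d] by (simp add: s runb_Fm e Suc del: runb.simps(2))
  qed
qed simp

text \<open>The same holds for an unreserved additional particle if the carrier cannot run empty,
  which the bound on \<open>length V\<close> ensures.\<close>

lemma runb_all_Fm_Suc:
  "all_Fm V \<Longrightarrow> length V \<le> D + occs V \<Longrightarrow> runb q V (Suc D) 0 K = run q V D (\<lambda>V' C'. K V' (Suc C') 0)"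
proof (induction V arbitrary: D K)
  case (Cons s V)
  then obtain w a where s: "s = Fm w a" by (cases s) auto
  have pos: "D + a \<noteq> 0" using Cons.prems occs_le_length[of V] s by auto
  then obtain d where d: "D + a = Suc d" by (cases "D + a") auto
  have "runb q V (Suc (D + a)) 0 (\<lambda>S'. K (Fm (q * w) 0 # S')) = run q V (D + a) (\<lambda>V' C'. K (Fm (q * w) 0 # V') (Suc C') 0)"
    using Cons.prems s by (intro Cons.IH) auto
  moreover have "runb q V (Suc d) 0 (\<lambda>S'. K (Fm (q * w) 1 # S')) = run q V d (\<lambda>V' C'. K (Fm (q * w) 1 # V') (Suc C') 0)"
    using Cons.prems s d by (intro Cons.IH) auto
  ultimately show ?case by (simp add: s runb_Fm d del: runb.simps(2))
qed simp

text \<open>On the left each of the terms \<open>z ^ j * h j\<close> and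
  \<open>z ^ (j + 1) * h j\<close> occurs exactly once: one of them comes from \<open>i = j\<close>,
  the other from \<open>i = j - 1\<close> or \<open>i = j + 1\<close> according to the parity of
  \<open>D - j\<close>. For \<open>j = 0\<close> and even \<open>D\<close> the neighbour would be
  -1; its term is supplied by the truncated subtraction at \<open>i = 0\<close>.\<close>

lemma parity_sum:
  fixes h :: "nat \<Rightarrow> real"
  shows "(\<Sum>i\<le>D. z ^ i * (h (i + (D - i) mod 2 - 1) + z * h (i + (D - i) mod 2))) = (1 + z) * (\<Sum>i\<le>D. z ^ i * h i)"
proof (induction D rule: induct_nat_012)
  case (ge2 n)
  have "(\<Sum>i\<le>n. z ^ i * (h (i + (Suc (Suc n) - i) mod 2 - 1) + z * h (i + (Suc (Suc n) - i) mod 2)))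
    = (\<Sum>i\<le>n. z ^ i * (h (i + (n - i) mod 2 - 1) + z * h (i + (n - i) mod 2)))"
    by (intro sum.cong refl) (simp add: Suc_diff_le)
  then show ?case unfolding sum.atMost_Suc distrib_left[of "1 + z"] ge2(1)[symmetric]
    by (simp add: algebra_simps)
qed (simp_all add: algebra_simps)

lemma le_set_eq: "{x :: nat. x + b \<le> D + b} = {..D}" by auto

text \<open>
  The last \<open>Bo\<close> and \<open>Fm\<close> sites have equal weight and enter only through the sum of their
  occupations and the bit, so that the induction step reduces to \<open>parity_sum\<close>. The truncated
  difference that occurs there for \<open>i = 0\<close> is the second case.
\<close>

lemma sweepsb_eq:
  assumes "all_Fm V" "length V \<le> D + occs V + t"
  shows "f + e + b = t + 1 \<Longrightarrow> e \<le> 1 \<Longrightarrow> b \<le> 1 \<Longrightarrow>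
      sweepsb q T (V @ [Bo z f, Fm z e]) (D + b) b = (\<Prod>i<T. 1 + z * q ^ i) * sweeps q T (V @ [Bo z t]) D"
    and "t = 0 \<Longrightarrow> sweepsb q T (V @ [Bo z 0, Fm z 0]) (Suc D) 0 = (\<Prod>i<T. 1 + z * q ^ i) * sweeps q T (V @ [Bo z t]) D"
  using assms
proof (induction T arbitrary: V D t f e b z)
  case 0
  { case 1 then show ?case by simp next case 2 then show ?case by simp }
next
  case (Suc T)
  define P where "P z = (\<Prod>i<T. 1 + (q * z) * q ^ i)" for z
  define h where "h z V' D' t t' = sweeps q T (V' @ [Bo (q * z) t']) (D' + t - t')" for z V' D' t t'
  define k where "k z V' i x c \<beta> = sweepsb q T (V' @ [Bo (q * z) i, Fm (q * z) x]) c \<beta>" for z V' i x c \<beta>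
  have small: "run q [Bo z t] D' (\<lambda>S'. sweeps q T (V' @ S')) = (\<Sum>i\<le>D'. z ^ i * h z V' D' t i)" for z V' D' t
    by (simp add: h_def algebra_simps)
  have big: "runb q [Bo z f, Fm z e] C b (\<lambda>S'. sweepsb q T (V' @ S')) = (\<Sum>i | i + b \<le> C. z ^ i *
      ((if (b + (C - i)) mod 2 \<le> C - i + f + e then k z V' i 0 (C - i + f + e) ((b + (C - i)) mod 2) else 0)
      + (if Suc ((b + (C - i)) mod 2) \<le> C - i + f + e then z * k z V' i 1 (C - i + f + e - 1) ((b + (C - i)) mod 2) else 0)))"
    for z C b f e V' by (simp only: k_def runb.simps(1,3) runb_Fm)
  have k0: "k z V' i 0 (D' + t + 1 - i) ((D' - i) mod 2) = P z * h z V' D' t (i + (D' - i) mod 2 - 1)"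
    if V': "all_Fm V'" "length V' \<le> D' + occs V' + t" and i: "i \<le> D'" for z V' i D' t
  proof -
    define \<beta> where "\<beta> = (D' - i) mod 2"
    have \<beta>: "\<beta> \<le> 1" "\<beta> \<le> D' - i" by (auto simp: \<beta>_def)
    show ?thesis
    proof (cases "i + \<beta> = 0")
      case True
      have "k z V' 0 0 (Suc (D' + t)) 0 = P z * h z V' D' t 0"
        unfolding k_def P_def h_def using V' Suc.IH(2)[of 0 V' "D' + t" "q * z"] by simp
      then show ?thesis using True unfolding \<beta>_def[symmetric] by simp
    next
      case False
      have "k z V' i 0 (D' + t - (i + \<beta> - 1) + \<beta>) \<beta> = P z * h z V' D' t (i + \<beta> - 1)"
        unfolding k_def P_def h_def using V' \<beta> i False
        by (intro Suc.IH(1)) auto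
      moreover have "D' + t - (i + \<beta> - 1) + \<beta> = D' + t + 1 - i" using i \<beta> False by auto
      ultimately show ?thesis unfolding \<beta>_def[symmetric] by (simp only:)
    qed
  qed
  have k1: "k z V' i 1 (D' + t - i) ((D' - i) mod 2) = P z * h z V' D' t (i + (D' - i) mod 2)"
    if V': "all_Fm V'" "length V' \<le> D' + occs V' + t" and i: "i + (D' - i) mod 2 \<le> D' + t" for z V' i D' t
  proof -
    define \<beta> where "\<beta> = (D' - i) mod 2"
    have "k z V' i 1 (D' + t - (i + \<beta>) + \<beta>) \<beta> = P z * h z V' D' t (i + \<beta>)"
      unfolding k_def P_def h_def using V' i
      by (intro Suc.IH(1)) (auto simp: \<beta>_def)
    moreover have "D' + t - (i + \<beta>) + \<beta> = D' + t - i" using i by (auto simp: \<beta>_def)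
    ultimately show ?thesis unfolding \<beta>_def[symmetric] by (simp only:)
  qed
  have stepA: "runb q [Bo z f, Fm z e] (D' + b) b (\<lambda>S'. sweepsb q T (V' @ S')) = (1 + z) * P z * (\<Sum>i\<le>D'. z ^ i * h z V' D' t i)"
    if V': "all_Fm V'" "length V' \<le> D' + occs V' + t" and fe: "f + e + b = t + 1" for z V' D' t f e b
  proof -
    have "runb q [Bo z f, Fm z e] (D' + b) b (\<lambda>S'. sweepsb q T (V' @ S'))
      = (\<Sum>i\<le>D'. z ^ i * (P z * h z V' D' t (i + (D' - i) mod 2 - 1) + z * (P z * h z V' D' t (i + (D' - i) mod 2))))"
      unfolding big le_set_eq
    proof (intro sum.cong refl arg_cong2[where f = "(*)"])
      fix i assume i: "i \<in> {..D'}"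
      have m: "(D' - i) mod 2 \<le> D' - i" by simp
      \<comment> \<open>The old bit enters twice, as itself and through the content
        \<open>D' + b\<close>, so the new bit does not depend on it.\<close>
      have "b + (D' + b - i) = (D' - i) + 2 * b" using i by auto
      then have b: "(b + (D' + b - i)) mod 2 = (D' - i) mod 2" by (simp only: mod_mult_self2)
      have c: "D' + b - i + f + e = D' + t + 1 - i" using i fe by auto
      have le: "Suc ((D' - i) mod 2) \<le> D' + t + 1 - i" using m i by auto
      have d: "D' + t + 1 - i - 1 = D' + t - i" by simp
      have "i + (D' - i) mod 2 \<le> D' + t" using m i by auto
      then show "(if (b + (D' + b - i)) mod 2 \<le> D' + b - i + f + e then k z V' i 0 (D' + b - i + f + e) ((b + (D' + b - i)) mod 2) else 0)
        + (if Suc ((b + (D' + b - i)) mod 2) \<le> D' + b - i + f + e then z * k z V' i 1 (D' + b - i + f + e - 1) ((b + (D' + b - i)) mod 2) else 0)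
        = P z * h z V' D' t (i + (D' - i) mod 2 - 1) + z * (P z * h z V' D' t (i + (D' - i) mod 2))"
        unfolding b c d using le k0[OF V', of i] k1[OF V', of i] i by simp
    qed
    also have "\<dots> = P z * (\<Sum>i\<le>D'. z ^ i * (h z V' D' t (i + (D' - i) mod 2 - 1) + z * h z V' D' t (i + (D' - i) mod 2)))"
      by (simp add: sum_distrib_left algebra_simps)
    finally show ?thesis unfolding parity_sum by simp
  qed
  have stepB: "runb q [Bo z 0, Fm z 0] (Suc D') 0 (\<lambda>S'. sweepsb q T (V' @ S')) = (1 + z) * P z * (\<Sum>i\<le>D'. z ^ i * h z V' D' 0 i)"
    if V': "all_Fm V'" "length V' \<le> D' + occs V'" for z V' D'
  proof -
    define g where "g i = h z V' D' 0 i" for i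
    define A where "A i = z ^ i *
      ((if (Suc D' - i) mod 2 \<le> Suc D' - i then k z V' i 0 (Suc D' - i) ((Suc D' - i) mod 2) else 0)
      + (if Suc ((Suc D' - i) mod 2) \<le> Suc D' - i then z * k z V' i 1 (Suc D' - i - 1) ((Suc D' - i) mod 2) else 0))" for i
    have k0': "k z V' i 0 (Suc D' - i) ((Suc D' - i) mod 2) = P z * g (i + (Suc D' - i) mod 2 - 1)" if "i \<le> Suc D'" for i
    proof -
      define \<beta> where "\<beta> = (Suc D' - i) mod 2"
      have \<beta>: "\<beta> \<le> 1" "\<beta> \<le> Suc D' - i" by (auto simp: \<beta>_def)
      show ?thesis
      proof (cases "i + \<beta> = 0")
        case True
        have "k z V' 0 0 (Suc D') 0 = P z * g 0"
          unfolding k_def P_def h_def g_def using V' Suc.IH(2)[of 0 V' D' "q * z"] by simp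
        then show ?thesis using True unfolding \<beta>_def[symmetric] by simp
      next
        case False
        have "k z V' i 0 (D' + 0 - (i + \<beta> - 1) + \<beta>) \<beta> = P z * g (i + \<beta> - 1)"
          unfolding k_def P_def h_def g_def using V' \<beta> that False
          by (intro Suc.IH(1)) auto
        moreover have "D' + 0 - (i + \<beta> - 1) + \<beta> = Suc D' - i" using that \<beta> False by auto
        ultimately show ?thesis unfolding \<beta>_def[symmetric] by (simp only:)
      qed
    qed
    have k1': "k z V' i 1 (D' - i) ((Suc D' - i) mod 2) = P z * g (i + (Suc D' - i) mod 2)" if "i + (Suc D' - i) mod 2 \<le> D'" for i
    proof -
      define \<beta> where "\<beta> = (Suc D' - i) mod 2"
      have "k z V' i 1 (D' + 0 - (i + \<beta>) + \<beta>) \<beta> = P z * g (i + \<beta>)"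
        unfolding k_def P_def h_def g_def using V' that
        by (intro Suc.IH(1)) (auto simp: \<beta>_def)
      moreover have "D' + 0 - (i + \<beta>) + \<beta> = D' - i" using that by (auto simp: \<beta>_def)
      ultimately show ?thesis unfolding \<beta>_def[symmetric] by (simp only:)
    qed
    have "runb q [Bo z 0, Fm z 0] (Suc D') 0 (\<lambda>S'. sweepsb q T (V' @ S')) = (\<Sum>i\<le>Suc D'. A i)"
      unfolding big A_def using le_set_eq[of 0 "Suc D'"] by (simp only: add_0_right add_0_left)
    \<comment> \<open>For the two largest indices only the choice of an empty \<open>Fm\<close> site
      is possible, and together they give \<open>(1 + z) * z ^ D' * g D'\<close>; the remaining
      indices form an instance of \<open>parity_sum\<close> with \<open>D' - 1\<close>.\<close>
    also have "\<dots> = A (Suc D') + A D' + (\<Sum>i<D'. A i)" by (simp add: lessThan_Suc_atMost[symmetric])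
    also have "A (Suc D') = P z * (z ^ Suc D' * g D')" unfolding A_def using k0'[of "Suc D'"] by simp
    also have "A D' = P z * (z ^ D' * g D')" unfolding A_def using k0'[of D'] by (simp add: Suc_diff_le)
    also have "(\<Sum>i<D'. A i) = P z * ((1 + z) * (\<Sum>i<D'. z ^ i * g i))"
    proof (cases D')
      case (Suc d)
      have "(\<Sum>i<D'. A i) = (\<Sum>i\<le>d. P z * (z ^ i * (g (i + (d - i) mod 2 - 1) + z * g (i + (d - i) mod 2))))"
        unfolding Suc lessThan_Suc_atMost
      proof (intro sum.cong refl)
        fix i assume i: "i \<in> {..d}"
        have m: "(Suc D' - i) mod 2 = (d - i) mod 2" using i Suc by (simp add: Suc_diff_le)
        have m2: "(d - i) mod 2 \<le> d - i" by simp
        have "Suc ((d - i) mod 2) \<le> Suc D' - i" "(d - i) mod 2 \<le> Suc D' - i" using m2 i Suc by auto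
        moreover have "i + (Suc D' - i) mod 2 \<le> D'" unfolding m using m2 i Suc by auto
        ultimately show "A i = P z * (z ^ i * (g (i + (d - i) mod 2 - 1) + z * g (i + (d - i) mod 2)))"
          unfolding A_def using k0'[of i] k1'[of i] i Suc unfolding m by (simp add: algebra_simps)
      qed
      then show ?thesis using parity_sum[where h = g and D = d and z = z]
        by (simp add: Suc lessThan_Suc_atMost sum_distrib_left[symmetric] del: sum.lessThan_Suc)
    qed simp
    finally show ?thesis unfolding g_def by (simp add: lessThan_Suc_atMost[symmetric] algebra_simps)
  qed
  have E: "(1 + z) * P z * run q V D (\<lambda>V' D'. (\<Sum>i\<le>D'. z ^ i * h z V' D' t i)) = (\<Prod>i<Suc T. 1 + z * q ^ i) * sweeps q (Suc T) (V @ [Bo z t]) D" for z V D t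
    unfolding prod_qp_Suc P_def sweeps.simps run_append small by simp
  { case 1
    then have "sweepsb q (Suc T) (V @ [Bo z f, Fm z e]) (D + b) b
      = run q V D (\<lambda>V' D'. runb q [Bo z f, Fm z e] (D' + b) b (\<lambda>S'. sweepsb q T (V' @ S')))"
      unfolding sweepsb.simps runb_append by (intro runb_all_Fm)
    also have "\<dots> = run q V D (\<lambda>V' D'. (1 + z) * P z * (\<Sum>i\<le>D'. z ^ i * h z V' D' t i))"
    proof (rule run_cong)
      fix V' D' assume s: "succs q V D V' D'"
      show "runb q [Bo z f, Fm z e] (D' + b) b (\<lambda>S'. sweepsb q T (V' @ S')) = (1 + z) * P z * (\<Sum>i\<le>D'. z ^ i * h z V' D' t i)"
        using succs_all_Fm[OF s] 1 s by (intro stepA) (auto simp: succs_def)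
    qed
    finally show ?case unfolding run_scale E .
  next
    case 2
    then have "sweepsb q (Suc T) (V @ [Bo z 0, Fm z 0]) (Suc D) 0
      = run q V D (\<lambda>V' D'. runb q [Bo z 0, Fm z 0] (Suc D') 0 (\<lambda>S'. sweepsb q T (V' @ S')))"
      unfolding sweepsb.simps runb_append by (intro runb_all_Fm_Suc) auto
    also have "\<dots> = run q V D (\<lambda>V' D'. (1 + z) * P z * (\<Sum>i\<le>D'. z ^ i * h z V' D' 0 i))"
    proof (rule run_cong)
      fix V' D' assume s: "succs q V D V' D'"
      show "runb q [Bo z 0, Fm z 0] (Suc D') 0 (\<lambda>S'. sweepsb q T (V' @ S')) = (1 + z) * P z * (\<Sum>i\<le>D'. z ^ i * h z V' D' 0 i)"
        using succs_all_Fm[OF s] 2 s by (intro stepB) (auto simp: succs_def)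
    qed
    finally show ?case unfolding run_scale E using 2 by simp }
qed

section \<open>The Jacobi triple product\<close>

definition qpoch :: "real \<Rightarrow> nat \<Rightarrow> real" where
  "qpoch p n = (\<Prod>i<n. 1 - p ^ Suc i)"

lemma qpoch_0 [simp]: "qpoch p 0 = 1" by (simp add: qpoch_def)

lemma qpoch_Suc: "qpoch p (Suc n) = qpoch p n * (1 - p ^ Suc n)" by (simp add: qpoch_def)

lemma qpoch_pos: "0 \<le> p \<Longrightarrow> p < 1 \<Longrightarrow> 0 < qpoch p n"
  unfolding qpoch_def
proof (intro prod_pos)
  fix i assume p: "0 \<le> p" "p < 1"
  have "p ^ Suc i \<le> p * 1" unfolding power_Suc using p by (intro mult_left_mono) (auto simp: power_le_one)
  then show "0 < 1 - p ^ Suc i" using p by simp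
qed

lemma qpoch_tendsto: "0 \<le> p \<Longrightarrow> p < 1 \<Longrightarrow> (\<lambda>n. qpoch p n) \<longlonglongrightarrow> qp (- p) p"
  using qp_tendsto[of p "- p"] by (simp add: qpoch_def)

lemma qp_minus_bounds:
  assumes "0 \<le> p" "p < 1" "0 \<le> a" "a \<le> b" "b < 1"
  shows "qp (- b) p \<le> qp (- a) p" "qp (- a) p \<le> 1" "0 < qp (- b) p"
proof -
  have le1: "c * p ^ i \<le> 1" if "0 \<le> c" "c < 1" for c i
    using mult_mono[of c 1 "p ^ i" 1] that assms by (auto simp: power_le_one)
  show "qp (- b) p \<le> qp (- a) p"
  proof (rule LIMSEQ_le[OF qp_tendsto[OF assms(1,2)] qp_tendsto[OF assms(1,2)]], intro exI allI impI prod_mono conjI)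
    fix i :: nat
    show "0 \<le> 1 + - b * p ^ i" using le1[of b i] assms by simp
    show "1 + - b * p ^ i \<le> 1 + - a * p ^ i" using assms by (simp add: mult_right_mono)
  qed
  show "qp (- a) p \<le> 1"
  proof (rule LIMSEQ_le_const2[OF qp_tendsto[OF assms(1,2)]], intro exI allI impI prod_le_1 conjI)
    fix i :: nat
    show "0 \<le> 1 + - a * p ^ i" using le1[of a i] assms by simp
    show "1 + - a * p ^ i \<le> 1" using assms by simp
  qed
  have pos: "0 < 1 + - b * p ^ i" for i
  proof -
    have "b * p ^ i \<le> b * 1" using assms by (intro mult_left_mono) (auto simp: power_le_one)
    then show ?thesis using assms by simp
  qed
  have "(\<lambda>i. 1 + - b * p ^ i) has_prod qp (- b) p"
    unfolding qp_def using qp_convergent[OF assms(1,2)] by (rule convergent_prod_has_prod)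
  then show "0 < qp (- b) p"
    using pos qp_convergent[OF assms(1,2), of "- b"] less_0_prodinf[of "\<lambda>i. 1 + - b * p ^ i"] unfolding qp_def by blast
qed

lemma qpoch_ge: "0 \<le> p \<Longrightarrow> p < 1 \<Longrightarrow> qp (- p) p \<le> qpoch p n"
proof -
  assume p: "0 \<le> p" "p < 1"
  have "qp (- p) p = qpoch p n * qp (- p * p ^ n) p"
    using qp_split[OF p, of "- p" n] by (simp add: qpoch_def)
  also have "\<dots> \<le> qpoch p n * 1"
    using qp_minus_bounds(2)[OF p, of "p * p ^ n" "p * p ^ n"] p qpoch_pos[OF p, of n] power_Suc_less_one[of p n]
    by (intro mult_left_mono) (cases "p = 0"; auto)+
  finally show ?thesis by simp
qed

lemma qpoch_le_1: "0 \<le> p \<Longrightarrow> p < 1 \<Longrightarrow> qpoch p n \<le> 1"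
  unfolding qpoch_def by (intro prod_le_1) (auto simp: power_le_one mult_le_one)

text \<open>The \<open>p\<close>-binomial coefficient of \<open>2 * n\<close> over \<open>n - j\<close>.\<close>

definition cbin :: "real \<Rightarrow> nat \<Rightarrow> nat \<Rightarrow> real" where
  "cbin p n j = (if j \<le> n then qpoch p (2 * n) / (qpoch p (n - j) * qpoch p (n + j)) else 0)"

text \<open>This is the comparison of coefficients when \<open>finite_triple_product\<close> passes
  from \<open>n\<close> to \<open>n + 1\<close>. In terms of \<alpha> and \<beta> all four values
  are rational multiples of \<open>P / (A * B)\<close>, and a rational identity remains.\<close>

lemma cbin_rec:
  assumes p: "0 < p" "p < 1" and j: "j \<le> n"
  shows "cbin p (Suc n) (Suc j) = (1 + p ^ (2 * n + 1)) * cbin p n (Suc j)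
    + p ^ (n - j) * cbin p n j + p ^ (n + j + 2) * cbin p n (Suc (Suc j))"
proof -
  define \<alpha> where "\<alpha> = p ^ (n - j)"
  define \<beta> where "\<beta> = p ^ (n + j)"
  define P where "P = qpoch p (2 * n)"
  define A where "A = qpoch p (n - j)"
  define B where "B = qpoch p (n + j)"
  have pos: "0 < qpoch p m" for m using p by (intro qpoch_pos) auto
  have pw: "p ^ m < 1" if "m \<noteq> 0" for m using p that by (simp add: power_less_one_iff)
  have \<alpha>\<beta>: "p ^ (2 * n) = \<alpha> * \<beta>" unfolding \<alpha>_def \<beta>_def power_add[symmetric] using j by (simp add: mult_2)
  have s1: "cbin p (Suc n) (Suc j) = P * (1 - p * (\<alpha> * \<beta>)) * (1 - p\<^sup>2 * (\<alpha> * \<beta>)) / (A * (B * (1 - p * \<beta>) * (1 - p\<^sup>2 * \<beta>)))"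
  proof -
    have "qpoch p (2 * Suc n) = P * (1 - p * p ^ (2 * n)) * (1 - p\<^sup>2 * p ^ (2 * n))"
      by (simp add: qpoch_Suc P_def power2_eq_square)
    moreover have "qpoch p (Suc n + Suc j) = B * (1 - p * \<beta>) * (1 - p\<^sup>2 * \<beta>)"
      by (simp add: qpoch_Suc B_def \<beta>_def power2_eq_square)
    ultimately show ?thesis using j unfolding \<alpha>\<beta> cbin_def A_def by simp
  qed
  have s2: "cbin p n j = P / (A * B)" using j by (simp add: cbin_def P_def A_def B_def)
  have nz: "1 - p * \<beta> \<noteq> 0" "1 - p\<^sup>2 * \<beta> \<noteq> 0"
    using pw[of "Suc (n + j)"] pw[of "Suc (Suc (n + j))"] by (auto simp: \<beta>_def power2_eq_square)
  \<comment> \<open>For \<open>j = n\<close> both sides vanish through the factor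
    \<open>1 - \<alpha>\<close>; in \<open>s4\<close> the factor \<open>p - \<alpha>\<close> does
    the same for \<open>n = j + 1\<close>. The factor \<open>p\<close> in \<open>s4\<close> avoids
    \<open>p ^ (n - j - 1) = \<alpha> / p\<close>.\<close>
  have s3: "cbin p n (Suc j) = P * (1 - \<alpha>) / (A * (B * (1 - p * \<beta>)))"
  proof (cases "j = n")
    case False
    then obtain d where d: "n - j = Suc d" "n - Suc j = d" using j by (cases "n - j") auto
    have "A = qpoch p d * (1 - \<alpha>)" unfolding A_def \<alpha>_def d qpoch_Suc ..
    moreover have "1 - \<alpha> \<noteq> 0" unfolding \<alpha>_def d using pw[of "Suc d"] by simp
    ultimately show ?thesis using False j d
      by (simp add: cbin_def P_def B_def \<beta>_def qpoch_Suc)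
  qed (simp add: cbin_def \<alpha>_def)
  have s4: "p * cbin p n (Suc (Suc j)) = P * (1 - \<alpha>) * (p - \<alpha>) / (A * (B * (1 - p * \<beta>) * (1 - p\<^sup>2 * \<beta>)))"
  proof (cases "n \<le> Suc j")
    case True
    then have "\<alpha> = 1 \<or> \<alpha> = p" using j by (cases "n = j") (auto simp: \<alpha>_def Suc_diff_le le_Suc_eq)
    then show ?thesis using True by (auto simp: cbin_def)
  next
    case False
    then obtain d where d: "n - j = Suc (Suc d)" "n - Suc (Suc j) = d"
      by (metis Suc_diff_Suc less_imp_Suc_add not_le Suc_diff_le diff_Suc_Suc Suc_lessD)
    have "A = qpoch p d * (1 - p ^ Suc d) * (1 - \<alpha>)" unfolding A_def \<alpha>_def d qpoch_Suc ..
    moreover have "1 - \<alpha> \<noteq> 0" "1 - p ^ Suc d \<noteq> 0" unfolding \<alpha>_def d using pw[of "Suc (Suc d)"] pw[of "Suc d"] by auto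
    moreover have "p - \<alpha> = p * (1 - p ^ Suc d)" unfolding \<alpha>_def d by (simp add: algebra_simps)
    ultimately show ?thesis using False d
      by (simp add: cbin_def P_def B_def \<beta>_def qpoch_Suc power2_eq_square mult_ac)
  qed
  have "p * cbin p (Suc n) (Suc j) = p * (1 + p * (\<alpha> * \<beta>)) * cbin p n (Suc j)
    + p * \<alpha> * cbin p n j + p\<^sup>2 * \<beta> * (p * cbin p n (Suc (Suc j)))"
    unfolding s1 s2 s3 s4 using nz pos[of "n - j"] pos[of "n + j"] unfolding A_def[symmetric] B_def[symmetric]
    by (simp add: divide_simps) (simp add: algebra_simps power2_eq_square)
  then have "p * cbin p (Suc n) (Suc j) = p * ((1 + p * (\<alpha> * \<beta>)) * cbin p n (Suc j)
    + \<alpha> * cbin p n j + p\<^sup>2 * \<beta> * cbin p n (Suc (Suc j)))"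
    by (simp add: algebra_simps)
  then have "cbin p (Suc n) (Suc j) = (1 + p * (\<alpha> * \<beta>)) * cbin p n (Suc j)
    + \<alpha> * cbin p n j + p\<^sup>2 * \<beta> * cbin p n (Suc (Suc j))"
    using p by simp
  moreover have "p ^ (2 * n + 1) = p * (\<alpha> * \<beta>)" unfolding \<alpha>\<beta>[symmetric] by simp
  moreover have "p ^ (n + j + 2) = p\<^sup>2 * \<beta>" unfolding \<beta>_def by (simp add: power2_eq_square)
  ultimately show ?thesis unfolding \<alpha>_def[symmetric] by (simp only:)
qed

lemma cbin_rec_0:
  assumes p: "0 < p" "p < 1"
  shows "cbin p (Suc n) 0 = (1 + p ^ (2 * n + 1)) * cbin p n 0 + 2 * p ^ (n + 1) * cbin p n 1"
proof -
  define \<alpha> where "\<alpha> = p ^ n"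
  define P where "P = qpoch p (2 * n)"
  define A where "A = qpoch p n"
  have pos: "0 < qpoch p m" for m using p by (intro qpoch_pos) auto
  have pw: "p ^ m < 1" if "m \<noteq> 0" for m using p that by (simp add: power_less_one_iff)
  have \<alpha>2: "p ^ (2 * n) = \<alpha>\<^sup>2" unfolding \<alpha>_def by (simp add: power_mult[symmetric] mult.commute)
  have nz: "1 - p * \<alpha> \<noteq> 0" using pw[of "Suc n"] by (auto simp: \<alpha>_def)
  have s1: "cbin p (Suc n) 0 = P * (1 - p * \<alpha>\<^sup>2) * (1 - p\<^sup>2 * \<alpha>\<^sup>2) / (A\<^sup>2 * (1 - p * \<alpha>)\<^sup>2)"
  proof -
    have "qpoch p (2 * Suc n) = P * (1 - p ^ Suc (2 * n)) * (1 - p ^ Suc (Suc (2 * n)))"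
      by (simp add: qpoch_Suc P_def)
    moreover have "p ^ Suc (2 * n) = p * \<alpha>\<^sup>2" "p ^ Suc (Suc (2 * n)) = p\<^sup>2 * \<alpha>\<^sup>2"
      unfolding \<alpha>2[symmetric] by (simp_all add: power2_eq_square)
    ultimately have "qpoch p (2 * Suc n) = P * (1 - p * \<alpha>\<^sup>2) * (1 - p\<^sup>2 * \<alpha>\<^sup>2)" by (simp only:)
    then show ?thesis by (simp add: cbin_def qpoch_Suc A_def \<alpha>_def power2_eq_square mult_ac)
  qed
  have s2: "cbin p n 0 = P / A\<^sup>2" by (simp add: cbin_def P_def A_def power2_eq_square)
  have s3: "cbin p n 1 = P * (1 - \<alpha>) / (A\<^sup>2 * (1 - p * \<alpha>))"
  proof (cases n)
    case (Suc d)
    have "A = qpoch p d * (1 - \<alpha>)" unfolding A_def \<alpha>_def Suc qpoch_Suc ..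
    moreover have "1 - \<alpha> \<noteq> 0" unfolding \<alpha>_def Suc using pw[of "Suc d"] by simp
    moreover have "cbin p n 1 = P / (qpoch p d * (A * (1 - p * \<alpha>)))"
      by (simp add: cbin_def Suc P_def A_def \<alpha>_def qpoch_Suc)
    ultimately show ?thesis by (simp add: power2_eq_square)
  qed (simp add: cbin_def \<alpha>_def)
  have "cbin p (Suc n) 0 = (1 + p * \<alpha>\<^sup>2) * cbin p n 0 + 2 * (p * \<alpha>) * cbin p n 1"
    unfolding s1 s2 s3 using nz pos[of n] unfolding A_def[symmetric]
    by (simp add: divide_simps) (simp add: algebra_simps power2_eq_square)
  moreover have "p ^ (2 * n + 1) = p * \<alpha>\<^sup>2" unfolding \<alpha>2[symmetric] by simp
  moreover have "p ^ (n + 1) = p * \<alpha>" unfolding \<alpha>_def by simp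
  ultimately show ?thesis by (simp only: mult.assoc)
qed

text \<open>The bilateral sum is folded at 0: since \<open>u * v = p\<close>, the indices
  \<open>j\<close> and \<open>- j\<close> have the same coefficient, once with \<open>u ^ j\<close>
  and once with \<open>v ^ j\<close>. The induction multiplies by \<open>(1 - u * p ^ n) * (1 - v *
  p ^ n) = 1 + p ^ (2 * n + 1) - p ^ n * (u + v)\<close>.\<close>

lemma finite_triple_product:
  assumes p: "0 < p" "p < 1" and uv: "u * v = p"
  shows "(\<Prod>i<n. 1 + (- u) * p ^ i) * (\<Prod>i<n. 1 + (- v) * p ^ i) =
    cbin p n 0 + (\<Sum>j<n. (- 1) ^ Suc j * p ^ (Suc j choose 2) * cbin p n (Suc j) * (u ^ Suc j + v ^ Suc j))"
proof (induction n)
  case 0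
  show ?case by (simp add: cbin_def)
next
  case (Suc n)
  define c where "c j = (- 1) ^ j * p ^ (j choose 2) * cbin p n j" for j
  define w where "w j = u ^ j + v ^ j" for j
  have c_0: "c 0 = cbin p n 0" by (simp add: c_def binomial_eq_0)
  have c0: "c j = 0" if "n < j" for j using that by (simp add: c_def cbin_def)
  have w2: "(u + v) * w (Suc j) = w (Suc (Suc j)) + p * w j" for j
    unfolding w_def uv[symmetric] by (simp add: algebra_simps)
  \<comment> \<open>By \<open>w2\<close>, multiplication by \<open>u + v\<close> shifts the index in
    both directions; the term \<open>2 * p * c 1\<close> stems from \<open>w 0 = 2\<close>.\<close>
  have "(u + v) * (c 0 + (\<Sum>j<m. c (Suc j) * w (Suc j)))
      = (if m = 0 then 0 else 2 * p * c 1) + (\<Sum>j<Suc m. c j * w (Suc j)) + p * (\<Sum>j<m - 1. c (Suc (Suc j)) * w (Suc j))" for m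
  proof (induction m)
    case (Suc m)
    have "(u + v) * (c (Suc m) * w (Suc m)) = c (Suc m) * (w (Suc (Suc m)) + p * w m)"
      unfolding w2[symmetric] by (simp add: algebra_simps)
    with Suc show ?case
      by (cases m) (simp_all add: algebra_simps, simp_all add: w_def)
  qed (simp add: w_def)
  from this[of n] have main: "(u + v) * (c 0 + (\<Sum>j<n. c (Suc j) * w (Suc j)))
      = 2 * p * c 1 + (\<Sum>j<Suc n. (c j + p * c (Suc (Suc j))) * w (Suc j))"
    using c0[of 1] c0[of "Suc n"] c0[of "Suc (Suc n)"]
    by (cases n) (simp_all add: sum.distrib sum_distrib_left algebra_simps)
  have cj: "(1 + p ^ (2 * n + 1)) * c (Suc j) - p ^ n * (c j + p * c (Suc (Suc j)))
      = (- 1) ^ Suc j * p ^ (Suc j choose 2) * cbin p (Suc n) (Suc j)" if j: "j \<le> n" for j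
  proof -
    have ch: "Suc j choose 2 = j + (j choose 2)" "Suc (Suc j) choose 2 = Suc j + j + (j choose 2)"
      by (simp_all add: numeral_2_eq_2)
    have "p ^ n = p ^ (n - j) * p ^ j" using j by (simp add: power_add[symmetric])
    then show ?thesis unfolding cbin_rec[OF p j] c_def ch
      by (simp add: power_add algebra_simps power2_eq_square)
  qed
  have "(\<Prod>i<Suc n. 1 + (- u) * p ^ i) * (\<Prod>i<Suc n. 1 + (- v) * p ^ i)
     = ((1 - u * p ^ n) * (1 - v * p ^ n)) * (c 0 + (\<Sum>j<n. c (Suc j) * w (Suc j)))"
    using Suc by (simp add: c_0 c_def[of "Suc _"] w_def mult_ac)
  also have "(1 - u * p ^ n) * (1 - v * p ^ n) = (1 + p ^ (2 * n + 1)) - p ^ n * (u + v)"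
  proof -
    have "(1 - u * p ^ n) * (1 - v * p ^ n) = 1 + (u * v) * (p ^ n)\<^sup>2 - p ^ n * (u + v)"
      by (simp add: algebra_simps power2_eq_square)
    then show ?thesis unfolding uv by (simp add: power_mult[symmetric] mult.commute)
  qed
  also have "((1 + p ^ (2 * n + 1)) - p ^ n * (u + v)) * (c 0 + (\<Sum>j<n. c (Suc j) * w (Suc j)))
     = (1 + p ^ (2 * n + 1)) * (c 0 + (\<Sum>j<Suc n. c (Suc j) * w (Suc j)))
       - p ^ n * ((u + v) * (c 0 + (\<Sum>j<n. c (Suc j) * w (Suc j))))"
    using c0[of "Suc n"] by (simp add: algebra_simps)
  also have "\<dots> = ((1 + p ^ (2 * n + 1)) * c 0 - p ^ n * (2 * p * c 1))
      + (\<Sum>j<Suc n. ((1 + p ^ (2 * n + 1)) * c (Suc j) - p ^ n * (c j + p * c (Suc (Suc j)))) * w (Suc j))"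
    unfolding main by (simp add: sum_distrib_left sum_subtractf sum.distrib algebra_simps del: sum.lessThan_Suc)
  also have "(1 + p ^ (2 * n + 1)) * c 0 - p ^ n * (2 * p * c 1) = cbin p (Suc n) 0"
    unfolding cbin_rec_0[OF p] c_0 by (simp add: c_def binomial_eq_0)
  also have "(\<Sum>j<Suc n. ((1 + p ^ (2 * n + 1)) * c (Suc j) - p ^ n * (c j + p * c (Suc (Suc j)))) * w (Suc j))
     = (\<Sum>j<Suc n. (- 1) ^ Suc j * p ^ (Suc j choose 2) * cbin p (Suc n) (Suc j) * w (Suc j))"
    by (intro sum.cong refl) (simp only: lessThan_iff less_Suc_eq_le cj)
  finally show ?case unfolding w_def .
qed

lemma summable_quadratic:
  fixes p c :: real
  assumes "0 \<le> p" "p < 1" "0 \<le> c"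
  shows "summable (\<lambda>n. c ^ n * p ^ (n choose 2))"
proof -
  have "(\<lambda>n. c * p ^ n) \<longlonglongrightarrow> 0"
    using assms by (intro tendsto_mult_right_zero LIMSEQ_power_zero) auto
  then have "\<forall>\<^sub>F n in sequentially. c * p ^ n < 1 / 2"
    by (rule order_tendstoD) simp
  then obtain N where N: "\<And>n. n \<ge> N \<Longrightarrow> c * p ^ n \<le> 1 / 2"
    unfolding eventually_sequentially by (meson less_imp_le)
  show ?thesis
  proof (rule summable_ratio_test[of "1 / 2" N])
    fix n assume "n \<ge> N"
    have "norm (c ^ Suc n * p ^ (Suc n choose 2)) = (c * p ^ n) * norm (c ^ n * p ^ (n choose 2))"
      using assms by (simp add: numeral_2_eq_2 power_add mult_ac)
    also have "\<dots> \<le> 1 / 2 * norm (c ^ n * p ^ (n choose 2))"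
      using N[OF \<open>n \<ge> N\<close>] by (intro mult_right_mono) auto
    finally show "norm (c ^ Suc n * p ^ (Suc n choose 2)) \<le> 1 / 2 * norm (c ^ n * p ^ (n choose 2))" .
  qed simp
qed

text \<open>Here the bilateral theta series is folded by joining the indices \<open>n\<close> and
  \<open>- n - 1\<close>, because \<open>v ^ n * u ^ (2 * n + 1) = p ^ n * u ^ Suc n\<close>. It is
  the limit of the finite form; Tannery's theorem applies since \<open>cbin\<close> is bounded
  uniformly by \<open>1 / L ^ 2\<close>.\<close>

lemma triple_product:
  assumes p: "0 < p" "p < 1" and uv: "u * v = p" "0 < u" "0 < v"
  shows "(\<lambda>n. (- 1) ^ n * p ^ (n choose 2) * v ^ n * (1 - u ^ (2 * n + 1))) sums (qp (- p) p * qp (- u) p * qp (- v) p)"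
proof -
  have p0: "0 \<le> p" using p by simp
  define L where "L = qp (- p) p"
  have L: "0 < L" unfolding L_def using qp_minus_bounds(3)[OF p0 p(2), of p p] p by simp
  have cl: "(\<lambda>n. cbin p n j) \<longlonglongrightarrow> 1 / L" for j
  proof (rule Lim_transform_eventually)
    have "(\<lambda>n. qpoch p (2 * (n + j)) / (qpoch p n * qpoch p (n + 2 * j))) \<longlonglongrightarrow> L / (L * L)"
      unfolding L_def using L[unfolded L_def]
      by (intro tendsto_intros filterlim_compose[OF qpoch_tendsto[OF p0 p(2)]] qpoch_tendsto[OF p0 p(2)])
         (auto intro!: filterlim_subseq strict_monoI)
    moreover have "qpoch p (2 * (n + j)) / (qpoch p n * qpoch p (n + 2 * j)) = cbin p (n + j) j" for n
      by (simp add: cbin_def mult_2 add.assoc)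
    ultimately have "(\<lambda>n. cbin p (n + j) j) \<longlonglongrightarrow> 1 / L" using L by simp
    then show "(\<lambda>n. cbin p n j) \<longlonglongrightarrow> 1 / L" by (rule LIMSEQ_offset)
  qed simp
  have cb: "\<bar>cbin p n j\<bar> \<le> 1 / L\<^sup>2" for n j
  proof (cases "j \<le> n")
    case True
    have "qpoch p (2 * n) / (qpoch p (n - j) * qpoch p (n + j)) \<le> 1 / (L * L)"
      unfolding L_def using L[unfolded L_def] qpoch_ge[OF p0 p(2)] qpoch_le_1[OF p0 p(2)] qpoch_pos[OF p0 p(2)]
      by (intro frac_le mult_mono) (auto intro: less_imp_le)
    moreover have "0 \<le> qpoch p (2 * n) / (qpoch p (n - j) * qpoch p (n + j))"
      using qpoch_pos[OF p0 p(2)] by (simp add: less_imp_le)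
    ultimately show ?thesis using True by (simp add: cbin_def power2_eq_square)
  qed (simp add: cbin_def)
  define g where "g j = (- 1) ^ Suc j * p ^ (Suc j choose 2) * (u ^ Suc j + v ^ Suc j)" for j
  define M where "M j = p ^ (Suc j choose 2) * (u ^ Suc j + v ^ Suc j)" for j
  have su: "summable (\<lambda>j. u ^ Suc j * p ^ (Suc j choose 2))" "summable (\<lambda>j. v ^ Suc j * p ^ (Suc j choose 2))"
    using summable_Suc_iff[of "\<lambda>j. u ^ j * p ^ (j choose 2)"] summable_Suc_iff[of "\<lambda>j. v ^ j * p ^ (j choose 2)"]
      summable_quadratic[OF p0 p(2)] uv by (simp_all only: less_imp_le)
  have M: "summable M" unfolding M_def using summable_add[OF su] by (simp add: algebra_simps)
  have gM: "\<bar>g j\<bar> = M j" for j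
    unfolding g_def M_def using p uv by (simp add: abs_mult power_abs)
  have "(\<lambda>n. \<Sum>j. g j * cbin p n (Suc j)) \<longlonglongrightarrow> (\<Sum>j. g j * (1 / L))"
  proof (intro conjunct2[OF conjunct2[OF tannerys_theorem]])
    show "(\<lambda>n. g j * cbin p n (Suc j)) \<longlonglongrightarrow> g j * (1 / L)" for j
      by (intro tendsto_intros cl)
    show "\<forall>\<^sub>F (k, n) in at_top \<times>\<^sub>F sequentially. norm (g k * cbin p n (Suc k)) \<le> M k * (1 / L\<^sup>2)"
    proof (intro always_eventually allI, clarify)
      fix k n
      have "\<bar>g k\<bar> * \<bar>cbin p n (Suc k)\<bar> \<le> \<bar>g k\<bar> * (1 / L\<^sup>2)"
        by (intro mult_left_mono cb) auto
      then show "norm (g k * cbin p n (Suc k)) \<le> M k * (1 / L\<^sup>2)" by (simp add: abs_mult gM)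
    qed
    show "summable (\<lambda>j. M j * (1 / L\<^sup>2))" using M by (rule summable_mult2)
  qed simp
  then have "(\<lambda>n. cbin p n 0 + (\<Sum>j. g j * cbin p n (Suc j))) \<longlonglongrightarrow> 1 / L + (\<Sum>j. g j * (1 / L))"
    by (intro tendsto_intros cl)
  moreover have "cbin p n 0 + (\<Sum>j. g j * cbin p n (Suc j)) = (\<Prod>i<n. 1 + (- u) * p ^ i) * (\<Prod>i<n. 1 + (- v) * p ^ i)" for n
  proof -
    have "(\<Sum>j. g j * cbin p n (Suc j)) = (\<Sum>j<n. g j * cbin p n (Suc j))"
      by (intro suminf_finite) (auto simp: cbin_def)
    then show ?thesis unfolding finite_triple_product[OF p uv(1)] g_def by (simp add: mult_ac)
  qed
  ultimately have "(\<lambda>n. (\<Prod>i<n. 1 + (- u) * p ^ i) * (\<Prod>i<n. 1 + (- v) * p ^ i)) \<longlonglongrightarrow> 1 / L + (\<Sum>j. g j * (1 / L))"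
    by simp
  moreover have "(\<lambda>n. (\<Prod>i<n. 1 + (- u) * p ^ i) * (\<Prod>i<n. 1 + (- v) * p ^ i)) \<longlonglongrightarrow> qp (- u) p * qp (- v) p"
    by (intro tendsto_intros qp_tendsto p0 p)
  ultimately have e1: "qp (- u) p * qp (- v) p = 1 / L + (\<Sum>j. g j * (1 / L))" by (rule LIMSEQ_unique[symmetric])
  have "summable (\<lambda>j. \<bar>g j\<bar>)" unfolding gM using M .
  then have sg: "summable g" by (rule summable_rabs_cancel)
  have e2: "(\<Sum>j. g j * (1 / L)) = (\<Sum>j. g j) * (1 / L)" by (rule suminf_mult2[OF sg, symmetric])
  have eq: "L * (qp (- u) p * qp (- v) p) = 1 + (\<Sum>j. g j)"
    unfolding e1 e2 using L by (simp add: distrib_left)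
  define a where "a j = (- 1) ^ j * (v ^ j * p ^ (j choose 2))" for j
  define b where "b j = (- 1) ^ Suc j * (u ^ Suc j * p ^ (Suc j choose 2))" for j
  have sb: "summable b" unfolding b_def
    by (rule summable_rabs_cancel, rule summable_cong[THEN iffD1, OF _ su(1)])
       (use uv p in \<open>simp add: abs_mult power_abs\<close>)
  have sa': "summable (\<lambda>j. a (Suc j))" unfolding a_def
    by (rule summable_rabs_cancel, rule summable_cong[THEN iffD1, OF _ su(2)])
       (use uv p in \<open>simp add: abs_mult power_abs\<close>)
  then have sa: "summable a" by (simp only: summable_Suc_iff)
  have "(\<lambda>j. a j + b j) sums (suminf a + suminf b)" by (intro sums_add summable_sums sa sb)
  moreover have "suminf a = 1 + (\<Sum>j. a (Suc j))" using suminf_split_head[OF sa] by (simp add: a_def binomial_eq_0)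
  moreover have "(\<Sum>j. a (Suc j)) + suminf b = (\<Sum>j. g j)"
  proof -
    have "(\<Sum>j. a (Suc j)) + suminf b = (\<Sum>j. a (Suc j) + b j)" by (rule suminf_add[OF sa' sb])
    also have "(\<lambda>j. a (Suc j) + b j) = g" unfolding a_def b_def g_def by (simp add: algebra_simps)
    finally show ?thesis .
  qed
  ultimately have "(\<lambda>j. a j + b j) sums (1 + (\<Sum>j. g j))" by (simp add: add_ac)
  moreover have "a n + b n = (- 1) ^ n * p ^ (n choose 2) * v ^ n * (1 - u ^ (2 * n + 1))" for n
  proof -
    have "Suc n choose 2 = n + (n choose 2)" by (simp add: numeral_2_eq_2)
    moreover have "v ^ n * u ^ (2 * n + 1) = p ^ n * u ^ Suc n"
    proof -
      have "2 * n + 1 = n + Suc n" by simp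
      then show ?thesis unfolding uv(1)[symmetric] by (simp only: power_add power_mult_distrib mult_ac)
    qed
    ultimately show ?thesis using uv(2) by (simp add: a_def b_def power_add algebra_simps)
  qed
  ultimately show ?thesis unfolding eq[symmetric] L_def by (simp add: mult_ac)
qed

lemma qp_mono:
  assumes "0 \<le> q" "q < 1" "0 \<le> a" "a \<le> b"
  shows "qp a q \<le> qp b q"
  by (rule LIMSEQ_le[OF qp_tendsto[OF assms(1,2)] qp_tendsto[OF assms(1,2)]])
     (use assms in \<open>auto intro!: exI[of _ 0] prod_mono mult_right_mono\<close>)

lemma qp_tendsto_1:
  assumes q: "0 \<le> q" "q < 1" and a: "\<bar>a\<bar> < 1"
  shows "(\<lambda>n. qp (a * q ^ n) q) \<longlonglongrightarrow> 1"
proof (cases "0 \<le> a")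
  case True
  then show ?thesis using qp_shift_tendsto_1[OF q] by simp
next
  case False
  define b where "b = - a"
  have b: "0 \<le> b" "b < 1" using False a by (auto simp: b_def)
  have pos: "0 < qp (- b) q" using qp_minus_bounds(3)[OF q b(1) order_refl b(2)] .
  have "(\<lambda>n. qp (- b) q / (\<Prod>i<n. 1 + - b * q ^ i)) \<longlonglongrightarrow> qp (- b) q / qp (- b) q"
    using pos by (intro tendsto_intros qp_tendsto q) auto
  moreover have "qp (- b) q / (\<Prod>i<n. 1 + - b * q ^ i) = qp (- b * q ^ n) q" for n
  proof -
    have "(\<Prod>i<n. 1 + - b * q ^ i) \<noteq> 0" using qp_split[OF q, of "- b" n] pos by (metis mult_eq_0_iff less_irrefl)
    then show ?thesis using qp_split[OF q, of "- b" n] by (metis nonzero_mult_div_cancel_left)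
  qed
  ultimately show ?thesis using pos by (simp add: b_def)
qed

section \<open>The models with at most one residue\<close>

text \<open>
  The series \<open>base_series q y k x i\<close> is an Andrews type series: \<open>base_series_step\<close> is its
  functional equation, which matches the first sweep over the sites \<open>Bo\<close> and \<open>Fm\<close>.
\<close>

definition base_factor :: "real \<Rightarrow> real \<Rightarrow> real \<Rightarrow> nat \<Rightarrow> real" where
  "base_factor q y x n = qp (x * y * q ^ Suc n) q * qp (- (q ^ Suc n)) q / (qp (- q) q * qp (- (x * q ^ Suc n)) q)"

text \<open>The product is \<open>(y / q) ^ n\<close> times a finite q-Pochhammer symbol in
  \<open>q / y\<close>, in a form that also makes sense for \<open>y = 0\<close>, the model without
  residues.\<close>

definition base_coeff :: "real \<Rightarrow> real \<Rightarrow> nat \<Rightarrow> real \<Rightarrow> nat \<Rightarrow> real" where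
  "base_coeff q y k x n = (- 1) ^ n * x ^ (k * n) * q ^ (k * n * n) * (\<Prod>j<n. q ^ j + y / q) * base_factor q y x n"

definition base_term :: "real \<Rightarrow> real \<Rightarrow> nat \<Rightarrow> real \<Rightarrow> nat \<Rightarrow> nat \<Rightarrow> real" where
  "base_term q y k x i n = base_coeff q y k x n * (q ^ ((k + 1 - i) * n) * (1 - (x * q ^ (2 * n + 1)) ^ i))"

definition base_series :: "real \<Rightarrow> real \<Rightarrow> nat \<Rightarrow> real \<Rightarrow> nat \<Rightarrow> real" where
  "base_series q y k x i = (\<Sum>n. base_term q y k x i n)"

lemma base_series_0 [simp]: "base_series q y k x 0 = 0"
  by (simp add: base_series_def base_term_def)

context
  fixes q y :: real and k :: nat
  assumes q: "0 < q" "q < 1" and y: "0 \<le> y" and k: "1 \<le> k"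
begin

lemma q0: "0 \<le> q" using q by simp

lemma q_pow: "0 < q ^ n" "q ^ n \<le> 1" "q ^ Suc n \<le> q" "q ^ Suc n < 1"
proof -
  show 1: "0 < q ^ n" "q ^ n \<le> 1" using q by (auto simp: power_le_one)
  have "q * q ^ n \<le> q * 1" using 1 q by (intro mult_left_mono) auto
  then show 2: "q ^ Suc n \<le> q" by simp
  from le_less_trans[OF 2 q(2)] show "q ^ Suc n < 1" .
qed

lemma xq: "0 \<le> x \<Longrightarrow> x \<le> 1 \<Longrightarrow> x * q ^ Suc n \<le> q"
  using mult_mono[of x 1 "q ^ Suc n" q] q_pow[of n] q by (auto simp del: power_Suc)

lemma base_factor_nonneg:
  assumes "0 \<le> x" "x \<le> 1"
  shows "0 \<le> base_factor q y x n" "base_factor q y x n \<le> qp y q / (qp (- q) q * qp (- q) q)"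
proof -
  have p: "0 < qp (- q) q" using qp_minus_bounds(3)[OF q0 q(2) q0 order_refl q(2)] .
  have 1: "0 \<le> x * y * q ^ Suc n" "x * y * q ^ Suc n \<le> y"
    using assms y q_pow[of n] q xq[OF assms, of n] mult_right_mono[of "x * q ^ Suc n" 1 y] by (auto simp: mult_ac simp del: power_Suc)
  have 2: "qp (- q) q \<le> qp (- (q ^ Suc n)) q" "qp (- (q ^ Suc n)) q \<le> 1"
    using qp_minus_bounds[OF q0 q(2), of "q ^ Suc n" q] q_pow[of n] q_pow[of "Suc n"] q by (auto simp del: power_Suc)
  have 3: "qp (- q) q \<le> qp (- (x * q ^ Suc n)) q"
    using qp_minus_bounds(1)[OF q0 q(2), of "x * q ^ Suc n" q] xq[OF assms, of n] q assms by (auto simp del: power_Suc)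
  have 4: "0 < qp (x * y * q ^ Suc n) q" using qp_ge_1[OF q0 q(2) 1(1)] by simp
  show "0 \<le> base_factor q y x n" unfolding base_factor_def using p 2 3 4 by (simp del: power_Suc)
  have "base_factor q y x n \<le> qp y q * 1 / (qp (- q) q * qp (- q) q)"
    unfolding base_factor_def using p 2 3 4 qp_mono[OF q0 q(2) 1]
    by (intro frac_le mult_mono) (auto simp del: power_Suc)
  then show "base_factor q y x n \<le> qp y q / (qp (- q) q * qp (- q) q)" by simp
qed

text \<open>The quotient of \<open>qp (- (q ^ Suc n)) q\<close> by \<open>qp (- q) q\<close> stands
  for the reciprocal of the finite product \<open>qpoch q n\<close>. Both identities split off the
  first factor of an infinite product.\<close>

lemma base_factor_shift:
  assumes "0 \<le> x" "x \<le> 1"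
  shows "base_factor q y x n * (1 - x * q ^ Suc n) = base_factor q y (q * x) n * (1 + x * y * q ^ Suc n)"
    and "base_factor q y x (Suc n) * (1 - q ^ Suc n) = base_factor q y (q * x) n"
proof -
  have e: "q * (x * y * q ^ Suc n) = q * x * y * q ^ Suc n" "q * - (x * q ^ Suc n) = - (q * x * q ^ Suc n)"
    "q * - (q ^ Suc n) = - (q ^ Suc (Suc n))" by simp_all
  have r: "qp (x * y * q ^ Suc n) q = (1 + x * y * q ^ Suc n) * qp (q * x * y * q ^ Suc n) q"
    "qp (- (x * q ^ Suc n)) q = (1 - x * q ^ Suc n) * qp (- (q * x * q ^ Suc n)) q"
    "qp (- (q ^ Suc n)) q = (1 - q ^ Suc n) * qp (- (q ^ Suc (Suc n))) q"
    using qp_rec[OF q0 q(2), of "x * y * q ^ Suc n"] qp_rec[OF q0 q(2), of "- (x * q ^ Suc n)"] qp_rec[OF q0 q(2), of "- (q ^ Suc n)"]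
    unfolding e by simp_all
  have nz: "1 - x * q ^ Suc n \<noteq> 0" "1 - q ^ Suc n \<noteq> 0" using xq[OF assms, of n] q q_pow[of n] by (auto simp del: power_Suc)
  show "base_factor q y x n * (1 - x * q ^ Suc n) = base_factor q y (q * x) n * (1 + x * y * q ^ Suc n)"
    unfolding base_factor_def r(1,2) using nz by (simp add: divide_simps del: power_Suc)
  have "x * y * q ^ Suc (Suc n) = q * x * y * q ^ Suc n" "x * q ^ Suc (Suc n) = q * x * q ^ Suc n" by simp_all
  note f = this
  show "base_factor q y x (Suc n) * (1 - q ^ Suc n) = base_factor q y (q * x) n"
    unfolding base_factor_def r(3) f using nz by (simp add: divide_simps del: power_Suc)
qed

definition coeff_bound :: real where "coeff_bound = qp y q / (qp (- q) q * qp (- q) q)"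

text \<open>Up to \<open>coeff_bound\<close>, a summable majorant of the series for all
  \<open>x\<close> between 0 and 1 at once, as Tannery's theorem requires.\<close>

definition majorant :: "nat \<Rightarrow> real" where "majorant n = (1 + y / q) ^ n * q ^ (n choose 2)"

lemma summable_majorant: "summable majorant"
  unfolding majorant_def using y q by (intro summable_quadratic) auto

lemma base_coeff_le:
  assumes "0 \<le> x" "x \<le> 1"
  shows "\<bar>base_coeff q y k x n\<bar> \<le> x ^ (k * n) * (coeff_bound * majorant n)"
proof -
  have "(\<Prod>j<n. q ^ j + y / q) \<le> (1 + y / q) ^ n"
    using q_pow y q prod_mono[of "{..<n}" "\<lambda>j. q ^ j + y / q" "\<lambda>_. 1 + y / q"] by (auto intro: less_imp_le)
  moreover have "q ^ (k * n * n) \<le> q ^ (n choose 2)"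
  proof (rule power_decreasing)
    have "n choose 2 \<le> n * (n - 1)" unfolding choose_two by (rule div_le_dividend)
    also have "\<dots> \<le> n * n" by simp
    also have "\<dots> \<le> k * n * n" using k by simp
    finally show "n choose 2 \<le> k * n * n" .
  qed (use q in auto)
  moreover have pn: "0 \<le> (\<Prod>j<n. q ^ j + y / q)" using q y by (intro prod_nonneg) auto
  ultimately have "q ^ (k * n * n) * (\<Prod>j<n. q ^ j + y / q) * base_factor q y x n \<le> q ^ (n choose 2) * (1 + y / q) ^ n * coeff_bound"
    using base_factor_nonneg[OF assms, of n] q y unfolding coeff_bound_def by (intro mult_mono) auto
  then have "x ^ (k * n) * (q ^ (k * n * n) * (\<Prod>j<n. q ^ j + y / q) * base_factor q y x n) \<le> x ^ (k * n) * (q ^ (n choose 2) * (1 + y / q) ^ n * coeff_bound)"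
    using assms by (intro mult_left_mono) auto
  moreover have "\<bar>base_coeff q y k x n\<bar> = x ^ (k * n) * (q ^ (k * n * n) * (\<Prod>j<n. q ^ j + y / q) * base_factor q y x n)"
    unfolding base_coeff_def using assms q pn base_factor_nonneg[OF assms, of n] by (simp add: abs_mult power_abs)
  ultimately show ?thesis by (simp add: majorant_def mult_ac)
qed

lemma coeff_bound_nonneg: "0 \<le> coeff_bound"
  unfolding coeff_bound_def using qp_ge_1[OF q0 q(2) y] by simp

lemma summable_base_coeff:
  assumes "0 \<le> x" "x \<le> 1" "\<And>n. \<bar>c n\<bar> \<le> 1"
  shows "summable (\<lambda>n. base_coeff q y k x n * c n)"
proof (rule summable_comparison_test)
  show "\<exists>N. \<forall>n\<ge>N. norm (base_coeff q y k x n * c n) \<le> coeff_bound * majorant n"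
  proof (intro exI allI impI)
    fix n
    have M: "0 \<le> coeff_bound * majorant n" unfolding majorant_def using coeff_bound_nonneg y q by auto
    have "\<bar>base_coeff q y k x n\<bar> * \<bar>c n\<bar> \<le> (coeff_bound * majorant n) * 1"
      using base_coeff_le[OF assms(1,2), of n] mult_right_mono[of "x ^ (k * n)" 1 "coeff_bound * majorant n"] M assms
      by (intro mult_mono) (auto simp: power_le_one)
    then show "norm (base_coeff q y k x n * c n) \<le> coeff_bound * majorant n" by (simp add: abs_mult)
  qed
  show "summable (\<lambda>n. coeff_bound * majorant n)" using summable_majorant by (rule summable_mult)
qed

lemma unit_pow: "0 \<le> x \<Longrightarrow> x \<le> 1 \<Longrightarrow> 0 \<le> x ^ a * q ^ b \<and> x ^ a * q ^ b \<le> 1"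
  using q by (auto intro!: mult_le_one simp: power_le_one)

lemma unit_base_term: "0 \<le> x \<Longrightarrow> x \<le> 1 \<Longrightarrow> \<bar>q ^ a * (1 - (x * q ^ b) ^ i)\<bar> \<le> 1"
proof -
  assume x: "0 \<le> x" "x \<le> 1"
  have "0 \<le> 1 - (x * q ^ b) ^ i" "1 - (x * q ^ b) ^ i \<le> 1"
    using unit_pow[OF x, of 1 b] by (auto simp: power_le_one)
  then show ?thesis using q_pow[of a] by (auto simp: abs_mult intro!: mult_le_one)
qed

lemma summable_base_term:
  assumes "0 \<le> x" "x \<le> 1" shows "summable (base_term q y k x i)"
  unfolding base_term_def by (intro summable_base_coeff assms unit_base_term)

lemma base_series_step:
  assumes x: "0 \<le> x" "x \<le> 1" and C: "C < k"
  shows "base_series q y k x (Suc C) - base_series q y k x C = (x * q) ^ C * (base_series q y k (q * x) (k - C) + x * y * q * base_series q y k (q * x) (k - C - 1))"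
proof -
  have x': "0 \<le> q * x" "q * x \<le> 1" using x q by (auto simp: mult_le_one)
  obtain m where m: "k = C + m + 1" using C by (metis Suc_eq_plus1 add_Suc_right less_imp_Suc_add)
  \<comment> \<open>The difference of the terms is split into parts with the factors
    \<open>1 - q ^ n\<close> and \<open>1 - x * q ^ Suc n\<close>, which are the ones that
    \<open>base_factor_shift\<close> absorbs. As \<open>V 0 = 0\<close>, the index of
    \<open>V\<close> can be shifted by one, and then both sides agree term by term.\<close>
  define V where "V n = base_coeff q y k x n * (q ^ ((m + 1) * n) * (1 - q ^ n))" for n
  define W where "W n = base_coeff q y k x n * (x ^ C * q ^ (k * n + C * n + C + n) * (1 - x * q ^ Suc n))" for n
  have sV: "summable V" unfolding V_def
    using unit_base_term[of 1 _ _ 1] by (intro summable_base_coeff x) simp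
  have sW: "summable W" unfolding W_def
  proof (intro summable_base_coeff x)
    fix n
    have ab: "\<bar>a * b\<bar> \<le> 1" if "0 \<le> a \<and> a \<le> 1" "0 \<le> b \<and> b \<le> 1" for a b :: real
      using that by (simp add: mult_le_one)
    have "0 \<le> 1 - x * q ^ Suc n \<and> 1 - x * q ^ Suc n \<le> 1" using unit_pow[OF x, of 1 "Suc n"] by simp
    then show "\<bar>x ^ C * q ^ (k * n + C * n + C + n) * (1 - x * q ^ Suc n)\<bar> \<le> 1"
      by (rule ab[OF unit_pow[OF x]])
  qed
  have VW: "base_term q y k x (Suc C) n - base_term q y k x C n = V n + W n" for n
  proof -
    have e1: "k + 1 - Suc C = m + 1" "k + 1 - C = m + 2" using m by auto
    have e2: "q ^ ((m + 2) * n) = q ^ ((m + 1) * n) * q ^ n" by (simp add: power_add[symmetric] algebra_simps)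
    have e3: "(x * q ^ (2 * n + 1)) ^ Suc C = (x * q ^ (2 * n + 1)) ^ C * (x * q ^ Suc n * q ^ n)"
      by (simp add: power_add[symmetric] mult_2)
    have "q ^ ((m + 1) * n) * (x * q ^ (2 * n + 1)) ^ C * q ^ n = x ^ C * (q ^ ((m + 1) * n) * q ^ ((2 * n + 1) * C) * q ^ n)"
      unfolding power_mult_distrib power_mult[symmetric] by (simp only: mult_ac)
    also have "q ^ ((m + 1) * n) * q ^ ((2 * n + 1) * C) * q ^ n = q ^ (k * n + C * n + C + n)"
      unfolding power_add[symmetric] by (rule arg_cong[of _ _ "(^) q"]) (simp add: m algebra_simps)
    finally have e4: "q ^ ((m + 1) * n) * (x * q ^ (2 * n + 1)) ^ C * q ^ n = x ^ C * q ^ (k * n + C * n + C + n)" .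
    have "base_term q y k x (Suc C) n - base_term q y k x C n = base_coeff q y k x n * (q ^ ((m + 1) * n) * (1 - q ^ n)
       + (q ^ ((m + 1) * n) * (x * q ^ (2 * n + 1)) ^ C * q ^ n) * (1 - x * q ^ Suc n))"
      unfolding base_term_def e1 e2 e3 by (simp add: algebra_simps del: power_Suc)
    then show ?thesis unfolding e4 V_def W_def by (simp add: algebra_simps del: power_Suc)
  qed
  have RHS: "(x * q) ^ C * (base_term q y k (q * x) (k - C) n + x * y * q * base_term q y k (q * x) (k - C - 1) n) = V (Suc n) + W n" for n
  proof -
    define B where "B = (- 1) ^ n * x ^ (k * n) * q ^ (k * n * n) * (\<Prod>j<n. q ^ j + y / q) * base_factor q y (q * x) n"
    define s where "s = q ^ n"
    define D where "D = (x * q * q * s * s) ^ m"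
    define E where "E = x ^ C * q ^ C * q ^ (k * n) * s ^ Suc C"
    have bq: "base_coeff q y k (q * x) n = B * q ^ (k * n)"
      unfolding base_coeff_def B_def by (simp add: power_mult_distrib mult_ac)
    have i: "k - C = Suc m" "Suc m - 1 = m" "k + 1 - Suc m = Suc C" "k + 1 - m = Suc (Suc C)" using m by auto
    have p1: "q * x * q ^ (2 * n + 1) = x * q * q * s * s"
    proof -
      have "2 * n + 1 = n + n + 1" by simp
      then show ?thesis unfolding s_def by (simp only: power_add power_one_right mult_ac)
    qed
    have p2: "q ^ (a * n) = s ^ a" for a by (simp add: s_def power_mult[symmetric] mult.commute)
    have l: "(x * q) ^ C * (base_term q y k (q * x) (k - C) n + x * y * q * base_term q y k (q * x) (k - C - 1) n)
       = B * E * (1 + x * y * q * s - D * (x * q * q * s * s + x * y * q * s))"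
      unfolding i base_term_def bq p1 p2[of "Suc C"] p2[of "Suc (Suc C)"] E_def D_def power_mult_distrib[of x q C]
      by (simp add: algebra_simps)
    have qS: "q ^ Suc n = q * s" by (simp add: s_def)
    have "W n = (- 1) ^ n * x ^ (k * n) * q ^ (k * n * n) * (\<Prod>j<n. q ^ j + y / q) * (base_factor q y x n * (1 - x * q ^ Suc n)) * (x ^ C * q ^ (k * n + C * n + C + n))"
      unfolding W_def base_coeff_def by (simp only: mult_ac)
    also have "\<dots> = B * (x ^ C * q ^ (k * n + C * n + C + n)) * (1 + x * y * q * s)"
      unfolding qS base_factor_shift(1)[OF x, of n, unfolded qS] B_def by (simp only: mult_ac)
    also have "x ^ C * q ^ (k * n + C * n + C + n) = E"
      unfolding E_def by (simp add: power_add p2 mult_ac) (simp add: s_def)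
    finally have w: "W n = B * E * (1 + x * y * q * s)" .
    have "V (Suc n) = - ((- 1) ^ n * x ^ (k * Suc n) * q ^ (k * Suc n * Suc n) * ((\<Prod>j<n. q ^ j + y / q) * (s + y / q)) * (base_factor q y x (Suc n) * (1 - q ^ Suc n)) * q ^ ((m + 1) * Suc n))"
      unfolding V_def base_coeff_def s_def by (simp del: mult_Suc_right)
    also have "\<dots> = - (B * (x ^ k * (q ^ (2 * k * n + k) * q ^ ((m + 1) * Suc n)) * (s + y / q)))"
    proof -
      have "x ^ (k * Suc n) = x ^ (k * n) * x ^ k" by (simp add: power_add)
      moreover have "q ^ (k * Suc n * Suc n) = q ^ (k * n * n) * q ^ (2 * k * n + k)"
        unfolding power_add[symmetric] by (rule arg_cong[of _ _ "(^) q"]) (simp add: algebra_simps)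
      ultimately show ?thesis unfolding base_factor_shift(2)[OF x] B_def by (simp only: mult_ac)
    qed
    also have "x ^ k * (q ^ (2 * k * n + k) * q ^ ((m + 1) * Suc n)) * (s + y / q) = E * D * (x * q * q * s * s + x * y * q * s)"
    proof -
      have "q ^ (2 * k * n + k) * q ^ ((m + 1) * Suc n) = q ^ C * q ^ (k * n) * q ^ (Suc C * n) * q ^ (m + m) * q ^ (m * n) * q ^ (m * n) * (q ^ 2 * q ^ n)"
        unfolding power_add[symmetric] by (rule arg_cong[of _ _ "(^) q"]) (simp add: m algebra_simps)
      also have "\<dots> = q ^ C * q ^ (k * n) * s ^ Suc C * q ^ m * q ^ m * s ^ m * s ^ m * (q ^ 2 * s)"
        unfolding p2[of "Suc C"] p2[of m] power_add[of q m m] s_def by (simp only: mult_ac)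
      finally have e1: "q ^ (2 * k * n + k) * q ^ ((m + 1) * Suc n) = q ^ C * q ^ (k * n) * s ^ Suc C * q ^ m * q ^ m * s ^ m * s ^ m * (q ^ 2 * s)" .
      have e2: "x ^ k = x ^ C * x ^ m * x" by (simp add: m power_add)
      have "x ^ k * (q ^ (2 * k * n + k) * q ^ ((m + 1) * Suc n)) * (s + y / q)
         = E * D * (x * (q ^ 2 * s) * (s + y / q))"
        unfolding e1 e2 E_def D_def power_mult_distrib by (simp only: mult_ac)
      also have "x * (q ^ 2 * s) * (s + y / q) = x * q * q * s * s + x * y * q * s"
        using q by (simp add: power2_eq_square field_simps)
      finally show ?thesis .
    qed
    finally have v: "V (Suc n) = - (B * (E * D * (x * q * q * s * s + x * y * q * s)))" .
    show ?thesis unfolding l w v by (simp add: algebra_simps)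
  qed
  have V0: "V 0 = 0" by (simp add: V_def)
  have "base_series q y k x (Suc C) - base_series q y k x C = (\<Sum>n. V n + W n)"
    unfolding base_series_def VW[symmetric] by (intro suminf_diff summable_base_term x)
  also have "\<dots> = (\<Sum>n. V n) + (\<Sum>n. W n)" by (rule suminf_add[OF sV sW, symmetric])
  also have "(\<Sum>n. V n) = (\<Sum>n. V (Suc n))" using suminf_split_head[OF sV] V0 by simp
  also have "(\<Sum>n. V (Suc n)) + (\<Sum>n. W n) = (\<Sum>n. V (Suc n) + W n)"
    using sV sW by (intro suminf_add) (simp_all only: summable_Suc_iff)
  also have "\<dots> = (x * q) ^ C * (base_series q y k (q * x) (k - C) + x * y * q * base_series q y k (q * x) (k - C - 1))"
    unfolding RHS[symmetric] base_series_def
    by (intro sums_unique[symmetric] sums_mult sums_add summable_sums summable_base_term x')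
  finally show ?thesis .
qed

lemma base_series_sum:
  assumes x: "0 \<le> x" "x \<le> 1" and C: "C < k"
  shows "base_series q y k x (Suc C) = (\<Sum>f\<le>C. (x * q) ^ f * (base_series q y k (q * x) (k - f) + x * y * q * base_series q y k (q * x) (k - f - 1)))"
  using C
proof (induction C)
  case 0
  then show ?case using base_series_step[OF x, of 0] by simp
next
  case (Suc C)
  then show ?case using base_series_step[OF x, of "Suc C"] by simp
qed

text \<open>Every term with \<open>n > 0\<close> carries the power \<open>x ^ (k * n)\<close> and
  disappears as \<open>x = q ^ T\<close> tends to 0. This is the normalization needed in
  \<open>gf_base\<close>.\<close>

lemma base_series_tendsto:
  assumes "1 \<le> i"
  shows "(\<lambda>T. base_series q y k (q ^ T) i) \<longlonglongrightarrow> 1"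
proof -
  have qT: "0 \<le> q ^ T" "q ^ T \<le> 1" for T using q_pow[of T] by auto
  have qz: "(\<lambda>T. q ^ T) \<longlonglongrightarrow> 0" using q by (intro LIMSEQ_power_zero) auto
  have b: "\<bar>base_term q y k (q ^ T) i n\<bar> \<le> (q ^ T) ^ (k * n) * (coeff_bound * majorant n)" for T n
  proof -
    have "\<bar>base_coeff q y k (q ^ T) n\<bar> * \<bar>q ^ ((k + 1 - i) * n) * (1 - (q ^ T * q ^ (2 * n + 1)) ^ i)\<bar> \<le> ((q ^ T) ^ (k * n) * (coeff_bound * majorant n)) * 1"
      using coeff_bound_nonneg y q by (intro mult_mono base_coeff_le unit_base_term qT) (auto simp: majorant_def)
    then show ?thesis by (simp add: base_term_def abs_mult)
  qed
  have M: "0 \<le> coeff_bound * majorant n" for n unfolding majorant_def using coeff_bound_nonneg y q by auto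
  have lim: "(\<lambda>T. base_term q y k (q ^ T) i n) \<longlonglongrightarrow> (if n = 0 then 1 else 0)" for n
  proof (cases "n = 0")
    case True
    have p: "0 < qp (- q) q" using qp_minus_bounds(3)[OF q0 q(2) q0 order_refl q(2)] .
    have "(\<lambda>T. qp (y * q * q ^ T) q) \<longlonglongrightarrow> 1" using y q by (intro qp_shift_tendsto_1) auto
    moreover have "(\<lambda>T. qp ((- q) * q ^ T) q) \<longlonglongrightarrow> 1" using q by (intro qp_tendsto_1) auto
    ultimately have "(\<lambda>T. qp (y * q * q ^ T) q * qp (- q) q / (qp (- q) q * qp ((- q) * q ^ T) q) * (1 - (q ^ T * q) ^ i))
      \<longlonglongrightarrow> 1 * qp (- q) q / (qp (- q) q * 1) * (1 - (0 * q) ^ i)"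
      using p by (intro tendsto_intros qz) auto
    then show ?thesis using True p assms by (simp add: base_term_def base_coeff_def base_factor_def mult_ac zero_power)
  next
    case False
    have "(\<lambda>T. (q ^ T) ^ (k * n) * (coeff_bound * majorant n)) \<longlonglongrightarrow> 0 ^ (k * n) * (coeff_bound * majorant n)"
      by (intro tendsto_intros qz)
    then have "(\<lambda>T. (q ^ T) ^ (k * n) * (coeff_bound * majorant n)) \<longlonglongrightarrow> 0" using False k by (simp add: zero_power)
    then have "(\<lambda>T. base_term q y k (q ^ T) i n) \<longlonglongrightarrow> 0"
      by (rule Lim_null_comparison[rotated]) (use b in auto)
    then show ?thesis using False by simp
  qed
  have "(\<lambda>T. \<Sum>n. base_term q y k (q ^ T) i n) \<longlonglongrightarrow> (\<Sum>n. if n = 0 then 1 else 0)"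
  proof (intro conjunct2[OF conjunct2[OF tannerys_theorem]] lim)
    show "\<forall>\<^sub>F (n, T) in at_top \<times>\<^sub>F sequentially. norm (base_term q y k (q ^ T) i n) \<le> coeff_bound * majorant n"
    proof (intro always_eventually allI, clarify)
      fix n T
      have "(q ^ T) ^ (k * n) * (coeff_bound * majorant n) \<le> 1 * (coeff_bound * majorant n)"
        using M qT[of T] by (intro mult_right_mono) (auto simp: power_le_one)
      then show "norm (base_term q y k (q ^ T) i n) \<le> coeff_bound * majorant n" using b[of T n] by simp
    qed
    show "summable (\<lambda>n. coeff_bound * majorant n)" using summable_majorant by (rule summable_mult)
  qed simp
  moreover have "(\<Sum>n. if n = 0 then 1 else 0 :: real) = 1"
    using suminf_finite[of "{0 :: nat}" "\<lambda>n. if n = 0 then 1 else 0 :: real"] by simp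
  ultimately show ?thesis unfolding base_series_def by simp
qed

end

section \<open>The base model and the series as solutions of one recursion\<close>

lemma sweeps_Bo_Fm:
  "sweeps q T [Bo z f, Fm w 1] C = sweeps q T [Bo z (Suc f), Fm w 0] C"
  by (cases T) (simp_all add: Suc_diff_le)

text \<open>A particle on the \<open>Fm\<close> site counts as one more particle on the
  \<open>Bo\<close> site, since in either case it is available to the carrier just after
  \<open>Bo\<close>. With the total \<open>N\<close> conserved, the content alone then describes the
  state.\<close>

lemma sweeps_base_step:
  assumes "C \<le> N"
  shows "sweeps q (Suc T) [Bo z (N - C), Fm w 0] C = (\<Sum>f\<le>C. z ^ f *
     (sweeps q T [Bo (q * z) (N - (N - f)), Fm (q * w) 0] (N - f)
      + (if f < N then w * sweeps q T [Bo (q * z) (N - (N - f - 1)), Fm (q * w) 0] (N - f - 1) else 0)))"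
proof -
  have "C - i + (N - C) = N - i" "N - (N - i) = i" "i < N \<Longrightarrow> N - (N - i - 1) = Suc i" if "i \<le> C" for i
    using that assms by auto
  moreover have "sweeps q T [Bo (q * z) i, Fm (q * w) 1] D = sweeps q T [Bo (q * z) (Suc i), Fm (q * w) 0] D" for i D
    by (rule sweeps_Bo_Fm)
  ultimately show ?thesis by (auto intro!: sum.cong)
qed

text \<open>The series \<open>F\<close> and the truncated sums \<open>g T\<close> satisfy the same
  recursion with nonnegative coefficients. Their initial values are 1 for \<open>g\<close> and tend
  to 1 for \<open>F\<close>; the recursion preserves the relative error \<open>e\<close>, which
  therefore vanishes in the limit.\<close>

lemma gf_base:
  assumes q: "0 < q" "q < 1" and y: "0 \<le> y" and C: "C \<le> N"
  shows "gf q [Bo q (N - C), Fm (q * y) 0] C = base_series q y (Suc N) 1 (Suc C)"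
proof -
  define g where "g T x C = sweeps q T [Bo (x * q) (N - C), Fm (x * y * q) 0] C" for T x C
  define F where "F x C = base_series q y (Suc N) x (Suc C)" for x C
  have g_Suc: "g (Suc T) x C = (\<Sum>f\<le>C. (x * q) ^ f * (g T (q * x) (N - f) + (if f < N then x * y * q * g T (q * x) (N - f - 1) else 0)))"
    if "C \<le> N" for T x C
    unfolding g_def sweeps_base_step[OF that] by (intro sum.cong refl) (auto simp: mult_ac)
  have F_Suc: "F x C = (\<Sum>f\<le>C. (x * q) ^ f * (F (q * x) (N - f) + (if f < N then x * y * q * F (q * x) (N - f - 1) else 0)))"
    if "C \<le> N" "0 \<le> x" "x \<le> 1" for x C
  proof -
    have "Suc N - f = Suc (N - f)" "f < N \<Longrightarrow> Suc N - f - 1 = Suc (N - f - 1)" "\<not> f < N \<Longrightarrow> Suc N - f - 1 = 0" if "f \<le> C" for f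
      using that \<open>C \<le> N\<close> by auto
    then show ?thesis unfolding F_def using that
      by (subst base_series_sum[OF q y]) (auto intro!: sum.cong)
  qed
  have approx: "\<bar>F x C - g T x C\<bar> \<le> e * g T x C"
    if "C \<le> N" "0 \<le> x" "x \<le> 1" "\<And>C. C \<le> N \<Longrightarrow> \<bar>F (q ^ T * x) C - 1\<bar> \<le> e" for x C T e
    using that
  proof (induction T arbitrary: x C)
    case 0
    then show ?case by (simp add: g_def)
  next
    case (Suc T)
    have ih: "\<bar>F (q * x) D - g T (q * x) D\<bar> \<le> e * g T (q * x) D" if "D \<le> N" for D
      using Suc.prems q that by (intro Suc.IH) (auto simp: mult_le_one mult_ac)
    have "\<bar>F x C - g (Suc T) x C\<bar> = \<bar>\<Sum>f\<le>C. (x * q) ^ f * ((F (q * x) (N - f) - g T (q * x) (N - f)) + (if f < N then x * y * q * (F (q * x) (N - f - 1) - g T (q * x) (N - f - 1)) else 0))\<bar>"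
      unfolding F_Suc[OF Suc.prems(1-3)] g_Suc[OF Suc.prems(1)] sum_subtractf[symmetric]
      by (intro arg_cong[of _ _ abs] sum.cong refl) (simp add: algebra_simps)
    also have "\<dots> \<le> (\<Sum>f\<le>C. (x * q) ^ f * (e * g T (q * x) (N - f) + (if f < N then x * y * q * (e * g T (q * x) (N - f - 1)) else 0)))"
    proof (intro order.trans[OF sum_abs] sum_mono)
      fix f
      have "\<bar>if f < N then x * y * q * (F (q * x) (N - f - 1) - g T (q * x) (N - f - 1)) else 0\<bar> \<le> (if f < N then x * y * q * (e * g T (q * x) (N - f - 1)) else 0)"
        using ih[of "N - f - 1"] Suc.prems q y by (auto simp: abs_mult intro!: mult_left_mono)
      then show "\<bar>(x * q) ^ f * ((F (q * x) (N - f) - g T (q * x) (N - f)) + (if f < N then x * y * q * (F (q * x) (N - f - 1) - g T (q * x) (N - f - 1)) else 0))\<bar>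
        \<le> (x * q) ^ f * (e * g T (q * x) (N - f) + (if f < N then x * y * q * (e * g T (q * x) (N - f - 1)) else 0))"
        unfolding abs_mult using ih[of "N - f"] Suc.prems q
        by (auto simp: abs_mult power_abs intro!: mult_left_mono order.trans[OF abs_triangle_ineq] add_mono)
    qed
    also have "\<dots> = e * g (Suc T) x C"
      unfolding g_Suc[OF Suc.prems(1)] sum_distrib_left by (intro sum.cong refl) (simp add: algebra_simps)
    finally show ?case .
  qed
  define e where "e T = (\<Sum>D\<le>N. \<bar>F (q ^ T) D - 1\<bar>)" for T
  have "(\<lambda>T. F (q ^ T) D) \<longlonglongrightarrow> 1" for D unfolding F_def by (intro base_series_tendsto q y) auto
  then have "e \<longlonglongrightarrow> (\<Sum>D\<le>N. \<bar>1 - 1\<bar>)" unfolding e_def by (intro tendsto_intros)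
  then have e0: "e \<longlonglongrightarrow> 0" by simp
  define c where "c = 1 / (1 - q)"
  have c: "1 \<le> c" "q \<le> 1 - 1 / c" using q by (auto simp: c_def field_simps)
  have gl: "(\<lambda>T. g T 1 C) \<longlonglongrightarrow> gf q [Bo q (N - C), Fm (q * y) 0] C"
    unfolding g_def using sweeps_tendsto[of q c "[Bo q (N - C), Fm (q * y) 0]" C] q y c by (simp add: mult_ac)
  have "\<bar>F 1 C - g T 1 C\<bar> \<le> e T * g T 1 C" for T
  proof (rule approx[OF C])
    fix D assume "D \<le> N"
    then show "\<bar>F (q ^ T * 1) D - 1\<bar> \<le> e T"
      unfolding e_def using member_le_sum[of D "{..N}" "\<lambda>D. \<bar>F (q ^ T) D - 1\<bar>"] by simp
  qed auto
  then have "\<forall>\<^sub>F T in sequentially. norm (F 1 C - g T 1 C) \<le> e T * g T 1 C" by simp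
  moreover have "(\<lambda>T. e T * g T 1 C) \<longlonglongrightarrow> 0" using tendsto_mult[OF e0 gl] by simp
  ultimately have "(\<lambda>T. F 1 C - g T 1 C) \<longlonglongrightarrow> 0" by (rule Lim_null_comparison)
  then have "(\<lambda>T. F 1 C - (F 1 C - g T 1 C)) \<longlonglongrightarrow> F 1 C - 0" by (intro tendsto_intros)
  then have "(\<lambda>T. g T 1 C) \<longlonglongrightarrow> F 1 C" by simp
  with gl show ?thesis unfolding F_def by (rule LIMSEQ_unique)
qed

section \<open>Product formulas for the base models and for symmetric weights\<close>

lemma sweeps_Fm_0: "sweeps q T [Bo z f, Fm 0 0] C = sweeps q T [Bo z f] C"
  by (induction T arbitrary: z f C) (auto intro!: sum.cong)

lemma gf_Fm_0: "gf q [Bo z f, Fm 0 0] C = gf q [Bo z f] C"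
  unfolding gf_def sweeps_Fm_0 ..

lemma two_choose_two: "2 * (n choose 2) + n = n * n"
  by (induction n) (auto simp: numeral_2_eq_2)

text \<open>The product of Andrews-Gordon type:
  \<open>(g ^ m; g ^ m) * (g ^ r; g ^ m) * (g ^ (m - r); g ^ m)\<close> over
  \<open>(g ^ 2; g ^ 2)\<close>. The base \<open>g\<close> is a square root of \<open>q\<close>, so
  that an odd number of residues leads to no half-integral exponents.\<close>

definition theta_quot :: "real \<Rightarrow> nat \<Rightarrow> nat \<Rightarrow> real" where
  "theta_quot g m r = qp (- (g ^ m)) (g ^ m) * qp (- (g ^ r)) (g ^ m) * qp (- (g ^ (m - r))) (g ^ m) / qp (- (g\<^sup>2)) (g\<^sup>2)"

text \<open>For \<open>y = 0\<close> all infinite products except \<open>L\<close> cancel, and the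
  series is a theta series in \<open>q ^ (2 * k + 1)\<close>.\<close>

lemma gf_no_Fm:
  assumes g: "0 < g" "g < 1" and r: "1 \<le> r" "r \<le> k"
  shows "gf (g\<^sup>2) [Bo (g\<^sup>2) (k - r)] (r - 1) = theta_quot g (2 * (2 * k + 1)) (2 * r)"
proof -
  define q where "q = g\<^sup>2"
  have q: "0 < q" "q < 1" using g by (auto simp: q_def power_less_one_iff)
  define L where "L = qp (- q) q"
  have L: "0 < L" unfolding L_def using qp_minus_bounds(3)[of q q q] q by simp
  have "gf q [Bo q ((k - 1) - (r - 1)), Fm (q * 0) 0] (r - 1) = base_series q 0 (Suc (k - 1)) 1 (Suc (r - 1))"
    using r by (intro gf_base q) auto
  then have "gf q [Bo q (k - r)] (r - 1) = base_series q 0 k 1 r"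
    using r gf_Fm_0[of q q "k - r" "r - 1"] by simp
  also have "\<dots> = (\<Sum>n. ((- 1) ^ n * (q ^ (2 * k + 1)) ^ (n choose 2) * (q ^ (2 * k + 1 - r)) ^ n * (1 - (q ^ r) ^ (2 * n + 1))) / L)"
    unfolding base_series_def
  proof (intro suminf_cong)
    fix n
    have A: "base_factor q 0 1 n = 1 / L"
    proof -
      have "q ^ Suc n < 1" using q by (intro power_Suc_less_one)
      then have "0 < qp (- (q ^ Suc n)) q" using qp_minus_bounds(3)[of q "q ^ Suc n" "q ^ Suc n"] q by simp
      moreover have "qp 0 q = 1" unfolding qp_def by simp
      ultimately show ?thesis unfolding base_factor_def L_def by (simp del: power_Suc)
    qed
    have P: "(\<Prod>j<n. q ^ j + 0 / q) = q ^ (n choose 2)"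
      by (induction n) (simp_all add: numeral_2_eq_2 power_add[symmetric] add_ac)
    \<comment> \<open>With \<open>n * n = 2 * (n choose 2) + n\<close> every exponent is linear in
      \<open>n choose 2\<close> and \<open>n\<close>.\<close>
    have e: "q ^ (k * n * n) * q ^ (n choose 2) * q ^ ((k + 1 - r) * n) = (q ^ (2 * k + 1)) ^ (n choose 2) * (q ^ (2 * k + 1 - r)) ^ n"
      unfolding power_mult[symmetric] power_add[symmetric]
    proof (rule arg_cong[of _ _ "(^) q"])
      define c where "c = n choose 2"
      have c: "n * n = 2 * c + n" using two_choose_two[of n] by (simp add: c_def)
      obtain d where d: "k = r + d" using r by (metis le_add_diff_inverse)
      have "k * n * n = k * (2 * c + n)" by (simp only: c[symmetric] mult.assoc)
      moreover have "k + 1 - r = d + 1" "2 * k + 1 - r = d + k + 1" using d by auto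
      ultimately show "k * n * n + (n choose 2) + (k + 1 - r) * n = (2 * k + 1) * (n choose 2) + (2 * k + 1 - r) * n"
        unfolding c_def[symmetric] by (simp only:) (simp add: algebra_simps)
    qed
    have u: "(1 * q ^ (2 * n + 1)) ^ r = (q ^ r) ^ (2 * n + 1)"
      by (simp only: power_mult[symmetric] mult_1 mult.commute)
    show "base_term q 0 k 1 r n = ((- 1) ^ n * (q ^ (2 * k + 1)) ^ (n choose 2) * (q ^ (2 * k + 1 - r)) ^ n * (1 - (q ^ r) ^ (2 * n + 1))) / L"
      unfolding base_term_def base_coeff_def A P u
      using arg_cong[OF e, of "\<lambda>z. (- 1) ^ n * z * (1 - (q ^ r) ^ (2 * n + 1)) / L"] by (simp add: mult_ac del: power_Suc)
  qed
  also have "\<dots> = (qp (- (q ^ (2 * k + 1))) (q ^ (2 * k + 1)) * qp (- (q ^ r)) (q ^ (2 * k + 1)) * qp (- (q ^ (2 * k + 1 - r))) (q ^ (2 * k + 1))) / L"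
  proof (intro sums_unique[symmetric] sums_divide triple_product)
    show "q ^ r * q ^ (2 * k + 1 - r) = q ^ (2 * k + 1)" using r by (simp add: power_add[symmetric])
  qed (use q in \<open>auto simp: power_less_one_iff power_Suc_less_one simp del: power_Suc\<close>)
  also have "\<dots> = theta_quot g (2 * (2 * k + 1)) (2 * r)"
  proof -
    have "q ^ j = g ^ (2 * j)" for j by (simp add: q_def power_mult)
    moreover have "2 * (2 * k + 1 - r) = 2 * (2 * k + 1) - 2 * r" by simp
    ultimately show ?thesis unfolding theta_quot_def L_def q_def[symmetric] by (simp only:)
  qed
  finally show ?thesis by (simp add: q_def)
qed

text \<open>Starting the sweep with the site \<open>g\<close> gives the series at \<open>r\<close>
  plus \<open>g\<close> times the series at \<open>r - 1\<close>. Their terms combine to a multiple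
  of \<open>1 + g * q ^ n\<close>, the one factor missing between the finite product in
  \<open>base_coeff\<close> and the tail in \<open>base_factor\<close>; so \<open>qp g q\<close>
  comes out and a theta series in \<open>g ^ (4 * k)\<close> remains.\<close>

lemma gf_one_Fm:
  assumes g: "0 < g" "g < 1" and r: "1 \<le> r" "r \<le> k"
  shows "gf (g\<^sup>2) [Fm g 0, Bo (g\<^sup>2) (k - r)] (r - 1) = qp g (g\<^sup>2) * theta_quot g (4 * k) (2 * r - 1)"
proof -
  define q where "q = g\<^sup>2"
  have q: "0 < q" "q < 1" using g by (auto simp: q_def power_less_one_iff)
  define L where "L = qp (- q) q"
  have L: "0 < L" unfolding L_def using qp_minus_bounds(3)[of q q q] q by simp
  define c where "c = 1 / (1 - q)"
  have c: "1 \<le> c" "q \<le> 1 - 1 / c" using q by (auto simp: c_def field_simps)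
  have b: "gf q [Bo q ((k - 1) - C), Fm (q * g) 0] C = base_series q g (Suc (k - 1)) 1 (Suc C)" if "C \<le> k - 1" for C
    using that g by (intro gf_base q) auto
  have Z1: "gf q [Bo q (k - r), Fm (q * g) 0] (r - 1) = base_series q g k 1 r"
    using b[of "r - 1"] r by simp
  have Z2: "gf q [Bo q (k - r), Fm (q * g) 1] (r - 1 - 1) = base_series q g k 1 (r - 1)" if "r - 1 \<noteq> 0"
  proof -
    have "gf q [Bo q (k - r), Fm (q * g) 1] (r - 1 - 1) = gf q [Bo q (Suc (k - r)), Fm (q * g) 0] (r - 1 - 1)"
      unfolding gf_def sweeps_Bo_Fm ..
    moreover have "Suc (k - r) = (k - 1) - (r - 1 - 1)" "Suc (r - 1 - 1) = r - 1" using r that by auto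
    ultimately show ?thesis using b[of "r - 1 - 1"] r by simp
  qed
  have "gf q [Fm g 0, Bo q (k - r)] (r - 1) = base_series q g k 1 r + g * base_series q g k 1 (r - 1)"
    using gf_Fm[of q c g 0 "[Bo q (k - r)]" "r - 1"] q g c Z1 Z2 by (cases "r - 1 = 0") simp_all
  also have "\<dots> = (\<Sum>n. base_term q g k 1 r n + g * base_term q g k 1 (r - 1) n)"
    unfolding base_series_def using g r by (intro sums_unique sums_add sums_mult summable_sums summable_base_term q) auto
  also have "\<dots> = (\<Sum>n. ((- 1) ^ n * (g ^ (4 * k)) ^ (n choose 2) * (g ^ (4 * k - (2 * r - 1))) ^ n * (1 - (g ^ (2 * r - 1)) ^ (2 * n + 1))) * (qp g q / L))"
  proof (intro suminf_cong)
    fix n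
    define s where "s = q ^ n"
    define P where "P = (\<Prod>j<n. q ^ j + g / q)"
    have P: "P * g ^ n = (\<Prod>j<n. 1 + g * q ^ j)"
      unfolding P_def using g
      by (induction n) (simp_all add: q_def power2_eq_square field_simps)
    have PA: "P * base_factor q g 1 n * (1 + g * s) * g ^ n = qp g q / L"
    proof -
      have "q ^ Suc n < 1" using q by (intro power_Suc_less_one)
      then have "0 < qp (- (q ^ Suc n)) q" using qp_minus_bounds(3)[of q "q ^ Suc n" "q ^ Suc n"] q by simp
      then have "base_factor q g 1 n = qp (g * q ^ Suc n) q / L" unfolding base_factor_def L_def by (simp del: power_Suc)
      then have "P * base_factor q g 1 n * (1 + g * s) * g ^ n = (P * g ^ n) * (1 + g * s) * qp (g * q ^ Suc n) q / L" by (simp del: power_Suc)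
      also have "(P * g ^ n) * (1 + g * s) * qp (g * q ^ Suc n) q = qp g q"
        using qp_split[of q g "Suc n"] q unfolding P s_def by (simp del: power_Suc)
      finally show ?thesis .
    qed
    obtain d where d: "k = r + d" using r by (metis le_add_diff_inverse)
    obtain m where m: "r = Suc m" using r by (cases r) auto
    have i: "k + 1 - r = d + 1" "k + 1 - m = d + 2" "r - 1 = m" using d m by auto
    define D where "D = (q * s * s) ^ m"
    have p1: "1 * q ^ (2 * n + 1) = q * s * s"
    proof -
      have "2 * n + 1 = n + n + 1" by simp
      then show ?thesis unfolding s_def by (simp only: power_add power_one_right mult_ac)
    qed
    have p2: "q ^ (a * n) = s ^ a" for a by (simp add: s_def power_mult[symmetric] mult.commute)
    have gg: "g * g = q" by (simp add: q_def power2_eq_square)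
    have br: "q ^ ((d + 1) * n) * (1 - (1 * q ^ (2 * n + 1)) ^ r) + g * (q ^ ((d + 2) * n) * (1 - (1 * q ^ (2 * n + 1)) ^ m))
       = s ^ (d + 1) * (1 + g * s) * (1 - D * (g * s))"
      unfolding p1 p2 D_def m by (simp add: algebra_simps gg[symmetric])
    have u: "D * (g * s) = (g ^ (2 * r - 1)) ^ (2 * n + 1)"
    proof -
      have "D * (g * s) = (g ^ (2 * (2 * n + 1))) ^ m * g ^ (2 * n + 1)"
      proof -
        have "q * s * s = g ^ (2 * (2 * n + 1))" unfolding p1[symmetric] by (simp only: q_def power_mult mult_1)
        moreover have "g * s = g ^ (2 * n + 1)" unfolding s_def q_def by (simp add: power_mult)
        ultimately show ?thesis unfolding D_def by (simp only:)
      qed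
      also have "\<dots> = (g ^ (2 * r - 1)) ^ (2 * n + 1)"
        unfolding power_mult[symmetric] power_add[symmetric] m
        by (rule arg_cong[of _ _ "(^) g"]) (simp add: algebra_simps)
      finally show ?thesis .
    qed
    have e: "q ^ (k * n * n) * s ^ (d + 1) = (g ^ (4 * k)) ^ (n choose 2) * (g ^ (4 * k - (2 * r - 1))) ^ n * g ^ n"
    proof -
      define c where "c = n choose 2"
      have c: "n * n = 2 * c + n" using two_choose_two[of n] by (simp add: c_def)
      have k: "4 * k - (2 * r - 1) = 2 * k + 2 * d + 1" using d m by auto
      have "k * n * n = k * (2 * c + n)" by (simp only: c[symmetric] mult.assoc)
      then have "2 * (k * n * n) + 2 * ((d + 1) * n) = 4 * k * c + (2 * k + 2 * d + 1) * n + n"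
        by (simp only:) (simp add: algebra_simps)
      moreover have "q ^ (k * n * n) * s ^ (d + 1) = g ^ (2 * (k * n * n) + 2 * ((d + 1) * n))"
        unfolding p2[symmetric] q_def power_mult[symmetric] power_add[symmetric] by (simp add: mult_ac)
      ultimately show ?thesis
        unfolding k c_def[symmetric] power_mult[symmetric] power_add[symmetric] by (simp only:)
    qed
    have "base_term q g k 1 r n + g * base_term q g k 1 (r - 1) n
      = (- 1) ^ n * q ^ (k * n * n) * P * base_factor q g 1 n * (s ^ (d + 1) * (1 + g * s) * (1 - D * (g * s)))"
      unfolding base_term_def base_coeff_def br[symmetric] i P_def[symmetric] by (simp add: algebra_simps del: power_Suc)
    also have "\<dots> = (- 1) ^ n * (q ^ (k * n * n) * s ^ (d + 1)) * (P * base_factor q g 1 n * (1 + g * s)) * (1 - D * (g * s))"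
      by (simp only: mult_ac)
    also have "\<dots> = ((- 1) ^ n * (g ^ (4 * k)) ^ (n choose 2) * (g ^ (4 * k - (2 * r - 1))) ^ n * (1 - (g ^ (2 * r - 1)) ^ (2 * n + 1))) * (P * base_factor q g 1 n * (1 + g * s) * g ^ n)"
      unfolding e u by (simp only: mult_ac)
    finally show "base_term q g k 1 r n + g * base_term q g k 1 (r - 1) n
      = ((- 1) ^ n * (g ^ (4 * k)) ^ (n choose 2) * (g ^ (4 * k - (2 * r - 1))) ^ n * (1 - (g ^ (2 * r - 1)) ^ (2 * n + 1))) * (qp g q / L)"
      unfolding PA .
  qed
  also have "\<dots> = (qp (- (g ^ (4 * k))) (g ^ (4 * k)) * qp (- (g ^ (2 * r - 1))) (g ^ (4 * k)) * qp (- (g ^ (4 * k - (2 * r - 1)))) (g ^ (4 * k))) * (qp g q / L)"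
  proof (intro sums_unique[symmetric] sums_mult2 triple_product)
    show "g ^ (2 * r - 1) * g ^ (4 * k - (2 * r - 1)) = g ^ (4 * k)" using r by (simp add: power_add[symmetric])
  qed (use g r in \<open>auto simp: power_less_one_iff\<close>)
  finally show ?thesis by (simp add: theta_quot_def L_def q_def)
qed

text \<open>The outermost pair has weights \<open>a\<close> and \<open>q / a\<close>;
  \<open>gf_move\<close> brings them together and \<open>gf_pair\<close> removes them. This replaces
  \<open>k\<close> and \<open>r\<close> by \<open>k - 1\<close> and \<open>r - 1\<close> and
  shortens \<open>ws\<close> by 2, so the parameters of \<open>theta_quot\<close> stay the same. A
  residue paired with itself has weight \<open>g\<close>.\<close>

theorem gf_symmetric:
  assumes g: "0 < g" "g < 1" and ws: "\<forall>w\<in>set ws. 0 < w"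
    and sym: "\<And>i. i < length ws \<Longrightarrow> ws ! i * ws ! (length ws - 1 - i) = g\<^sup>2"
    and r: "1 \<le> r" "length ws \<le> r" "r \<le> k"
  shows "gf (g\<^sup>2) (fms ws @ [Bo (g\<^sup>2) (k - r)]) (r - 1)
     = (\<Prod>w\<leftarrow>ws. qp w (g\<^sup>2)) * theta_quot g (2 * (2 * k + 1 - length ws)) (2 * r - length ws)"
  using ws sym r
proof (induction "length ws" arbitrary: ws r k rule: less_induct)
  case less
  define q where "q = g\<^sup>2"
  have q: "0 < q" "q < 1" using g by (auto simp: q_def power_less_one_iff)
  define c where "c = 1 / (1 - q)"
  have c: "1 \<le> c" "q \<le> 1 - 1 / c" using q by (auto simp: c_def field_simps)
  consider "ws = []" | w where "ws = [w]" | a b mid where "ws = a # mid @ [b]"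
  proof (cases ws)
    case (Cons a xs)
    then show thesis using that by (cases xs rule: rev_cases) auto
  qed (use that in auto)
  then show ?case
  proof cases
    case 1
    then show ?thesis using gf_no_Fm[OF g, of r k] less.prems by simp
  next
    case 2
    have "w * w = g * g" using less.prems(2)[of 0] 2 by (simp add: power2_eq_square)
    then have "w = g" using less.prems(1) 2 g by (simp add: square_eq_iff)
    then show ?thesis using gf_one_Fm[OF g, of r k] less.prems 2 by simp
  next
    case 3
    have ab: "0 < a" "0 < b" "b = q / a"
      using less.prems(1) less.prems(2)[of 0] 3 by (auto simp: q_def nth_append field_simps)
    have mid: "\<forall>w\<in>set mid. 0 < w" "length mid + 2 = length ws" using less.prems(1) 3 by auto
    have len: "length mid < r - 1" using mid less.prems by auto
    have sym: "mid ! i * mid ! (length mid - 1 - i) = g\<^sup>2" if "i < length mid" for i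
    proof -
      have "ws ! Suc i = mid ! i" using 3 that by (simp add: nth_append)
      moreover have "length ws - 1 - Suc i = Suc (length mid - 1 - i)" using that 3 by simp
      moreover have "length mid - 1 - i < length mid" using that by simp
      then have "ws ! Suc (length mid - 1 - i) = mid ! (length mid - 1 - i)" using 3 by (simp add: nth_append)
      ultimately show ?thesis using less.prems(2)[of "Suc i"] that 3 by simp
    qed
    have "gf q (fms ws @ [Bo q (k - r)]) (r - 1) = gf q (([Fm a 0]) @ fms mid @ Fm b 0 # [Bo q (k - r)]) (r - 1)"
      using 3 by simp
    also have "\<dots> = gf q ([Fm a 0] @ Fm b 0 # fms mid @ [Bo q (k - r)]) (r - 1)"
      using q c ab mid by (intro gf_move[where c = c, symmetric]) (auto intro: less_imp_le)
    also have "\<dots> = qp a q * qp b q * gf q (fms mid @ [Bo q (k - r)]) (r - 1 - 1)"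
      using gf_pair[OF q ab(1) mid(1) len, of "k - r"] ab by simp
    also have "gf q (fms mid @ [Bo q (k - r)]) (r - 1 - 1) = gf q (fms mid @ [Bo q ((k - 1) - (r - 1))]) (r - 1 - 1)"
      using less.prems mid by (metis Suc_diff_1 diff_Suc_1 diff_Suc_Suc le_trans less_eq_Suc_le One_nat_def Suc_pred)
    also have "\<dots> = (\<Prod>w\<leftarrow>mid. qp w q) * theta_quot g (2 * (2 * (k - 1) + 1 - length mid)) (2 * (r - 1) - length mid)"
      unfolding q_def using mid sym less.prems len by (intro less.hyps) auto
    also have "2 * (2 * (k - 1) + 1 - length mid) = 2 * (2 * k + 1 - length ws)" using mid less.prems len by simp
    also have "2 * (r - 1) - length mid = 2 * r - length ws" using mid less.prems len by simp
    finally show ?thesis using 3 by (simp add: q_def mult_ac)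
  qed
qed

section \<open>Slots\<close>

text \<open>
  Slot \<open>n\<close> stands for the \<open>n\<close>-th smallest possible part, so that a shift by \<open>\<eta>\<close> is a shift by
  \<open>l + 2\<close> slots, and the bosonic slots are the multiples of \<open>\<eta>\<close> that are not overlined.
  In an occupation function \<open>v\<close> the value \<open>v (n + p)\<close> is the multiplicity of slot \<open>n\<close>; the values
  below \<open>p\<close> are fictitious parts that encode the initial state.
\<close>

locale slots =
  fixes l k r :: nat and wt :: "nat \<Rightarrow> real" and q :: real
  assumes kr: "1 \<le> r" "r \<le> k" "l \<le> r" "l + 1 < k"
    and wt_period: "\<And>n. wt (n + (l + 2)) = q * wt n"
begin

definition p :: nat where "p = l + 2"

definition bosonic :: "nat \<Rightarrow> bool" where "bosonic n \<longleftrightarrow> n mod p = l"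

text \<open>This replays \<open>runb\<close> on an occupation function and records content and bit
  just before slot \<open>n\<close>.\<close>

primrec state :: "(nat \<Rightarrow> nat) \<Rightarrow> nat \<Rightarrow> nat \<times> nat" where
  "state v 0 = (r - 1, 0)"
| "state v (Suc n) = (if bosonic n
     then (fst (state v n) - v (n + p) + v n, (snd (state v n) + (fst (state v n) - v (n + p))) mod 2)
     else (fst (state v n) + v n - v (n + p), snd (state v n)))"

definition admissible :: "(nat \<Rightarrow> nat) \<Rightarrow> nat \<Rightarrow> bool" where
  "admissible v n \<longleftrightarrow> (if bosonic n then v (n + p) + snd (state v n) \<le> fst (state v n)
     else v (n + p) \<le> 1 \<and> v (n + p) + snd (state v n) \<le> fst (state v n) + v n)"

primrec slot_sum :: "nat \<Rightarrow> (nat \<Rightarrow> nat) \<Rightarrow> nat \<Rightarrow> ((nat \<Rightarrow> nat) \<Rightarrow> real) \<Rightarrow> real" where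
  "slot_sum 0 v n G = G v"
| "slot_sum (Suc m) v n G = (\<Sum>x | admissible (v(n + p := x)) n. wt n ^ x * slot_sum m (v(n + p := x)) (Suc n) G)"

lemma p_pos: "0 < p" "l < p" by (auto simp: p_def)

lemma wt_p: "wt (n + p) = q * wt n" using wt_period[of n] by (simp only: p_def)

lemma state_cong: "(\<And>i. i < n + p \<Longrightarrow> v i = w i) \<Longrightarrow> state v n = state w n"
  by (induction n) (auto simp: p_pos)

lemma state_upd: "n + p \<le> j \<Longrightarrow> state (v(j := x)) n = state v n"
  by (rule state_cong) auto

lemma admissible_upd: "admissible (v(n + p := x)) n \<longleftrightarrow> (if bosonic n then x + snd (state v n) \<le> fst (state v n)
     else x \<le> 1 \<and> x + snd (state v n) \<le> fst (state v n) + v n)"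
  using p_pos by (simp add: admissible_def state_upd)

lemma finite_admissible: "finite {x. admissible (v(n + p := x)) n}"
  by (rule finite_subset[of _ "{..max 1 (fst (state v n))}"]) (auto simp: admissible_upd split: if_splits)

lemma slot_sum_cong:
  "(\<And>w. (\<And>i. i < n + p \<Longrightarrow> w i = v i) \<Longrightarrow> G w = H w) \<Longrightarrow> slot_sum m v n G = slot_sum m v n H"
proof (induction m arbitrary: v n)
  case (Suc m)
  show ?case unfolding slot_sum.simps
    by (intro sum.cong refl arg_cong2[where f = "(*)"] Suc.IH Suc.prems) auto
qed simp

lemma slot_sum_add: "slot_sum (a + b) v n G = slot_sum a v n (\<lambda>w. slot_sum b w (n + a) G)"
proof (induction a arbitrary: v n)
  case (Suc a)
  show ?case unfolding add_Suc slot_sum.simps Suc.IH by simp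
qed simp

definition mk_site :: "nat \<Rightarrow> nat \<Rightarrow> site" where
  "mk_site n a = (if bosonic n then Bo (wt n) a else Fm (wt n) a)"

text \<open>Site \<open>i\<close> has the weight of slot \<open>i\<close>, where the next particle
  would go, but the occupation \<open>v i\<close> of the slot one period earlier.\<close>

definition sites :: "(nat \<Rightarrow> nat) \<Rightarrow> nat \<Rightarrow> nat \<Rightarrow> site list" where
  "sites v n m = map (\<lambda>i. mk_site i (v i)) [n..<n + m]"

lemma sites_Suc: "sites v n (Suc m) = mk_site n (v n) # sites v (Suc n) m"
  by (simp add: sites_def upt_conv_Cons del: upt_Suc)

lemma sites_0: "sites v n 0 = []" by (simp add: sites_def)

lemma bosonic_p: "bosonic (n + p) \<longleftrightarrow> bosonic n" by (simp add: bosonic_def)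

text \<open>The carrier writes one period ahead, so for \<open>m \<le> p\<close> the sites still to
  be visited are not affected by what it has left.\<close>

lemma runb_sites:
  "m \<le> p \<Longrightarrow> runb q (sites v n m) (fst (state v n)) (snd (state v n)) K
    = slot_sum m v n (\<lambda>w. K (sites w (n + p) m) (fst (state w (n + m))) (snd (state w (n + m))))"
proof (induction m arbitrary: v n K)
  case 0
  show ?case by (simp add: sites_0)
next
  case (Suc m)
  have s: "sites (v(n + p := x)) (Suc n) m = sites v (Suc n) m" for x
    unfolding sites_def using Suc.prems by (intro map_cong refl) auto
  have state': "fst (state (v(n + p := x)) (Suc n)) = (if bosonic n then fst (state v n) - x + v n else fst (state v n) + v n - x)"
    "snd (state (v(n + p := x)) (Suc n)) = (if bosonic n then (snd (state v n) + (fst (state v n) - x)) mod 2 else snd (state v n))" for x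
    using p_pos by (simp_all add: state_upd)
  have ih: "runb q (sites v (Suc n) m) (fst (state (v(n + p := x)) (Suc n))) (snd (state (v(n + p := x)) (Suc n))) (\<lambda>S'. K (mk_site (n + p) x # S'))
     = slot_sum m (v(n + p := x)) (Suc n) (\<lambda>w. K (sites w (n + p) (Suc m)) (fst (state w (n + Suc m))) (snd (state w (n + Suc m))))" for x
  proof -
    have "runb q (sites v (Suc n) m) (fst (state (v(n + p := x)) (Suc n))) (snd (state (v(n + p := x)) (Suc n))) (\<lambda>S'. K (mk_site (n + p) x # S'))
      = slot_sum m (v(n + p := x)) (Suc n) (\<lambda>w. K (mk_site (n + p) x # sites w (Suc n + p) m) (fst (state w (Suc n + m))) (snd (state w (Suc n + m))))"
      unfolding s[of x, symmetric] using Suc.prems by (intro Suc.IH) auto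
    also have "\<dots> = slot_sum m (v(n + p := x)) (Suc n) (\<lambda>w. K (sites w (n + p) (Suc m)) (fst (state w (n + Suc m))) (snd (state w (n + Suc m))))"
      by (rule slot_sum_cong) (simp add: sites_Suc)
    finally show ?thesis .
  qed
  have "runb q (sites v n (Suc m)) (fst (state v n)) (snd (state v n)) K
    = (\<Sum>x | admissible (v(n + p := x)) n. wt n ^ x * runb q (sites v (Suc n) m) (fst (state (v(n + p := x)) (Suc n)))
        (snd (state (v(n + p := x)) (Suc n))) (\<lambda>S'. K (mk_site (n + p) x # S')))"
    by (cases "bosonic n") (simp_all only: sites_Suc mk_site_def if_True if_False bosonic_p wt_p runb.simps admissible_upd state')
  then show ?case unfolding ih slot_sum.simps .
qed

lemma sweepsb_sites:
  "sweepsb q T (sites v n p) (fst (state v n)) (snd (state v n)) = slot_sum (T * p) v n (\<lambda>_. 1)"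
proof (induction T arbitrary: v n)
  case (Suc T)
  have "sweepsb q (Suc T) (sites v n p) (fst (state v n)) (snd (state v n))
    = slot_sum p v n (\<lambda>w. sweepsb q T (sites w (n + p) p) (fst (state w (n + p))) (snd (state w (n + p))))"
    unfolding sweepsb.simps by (rule runb_sites) simp
  then show ?case unfolding Suc.IH by (simp add: slot_sum_add)
qed simp

section \<open>The nested sum as a sum over occupation functions\<close>

definition occupations :: "nat \<Rightarrow> (nat \<Rightarrow> nat) \<Rightarrow> nat \<Rightarrow> (nat \<Rightarrow> nat) set" where
  "occupations m v n = {w. (\<forall>i. i < n + p \<or> n + m + p \<le> i \<longrightarrow> w i = v i) \<and> (\<forall>i\<in>{n..<n + m}. admissible w i)}"

lemma admissible_cong: "(\<And>i. i \<le> n + p \<Longrightarrow> v i = w i) \<Longrightarrow> admissible v n \<longleftrightarrow> admissible w n"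
  unfolding admissible_def using state_cong[of n v w] by simp

lemma occupations_0: "occupations 0 v n = {v}"
  unfolding occupations_def by (auto simp: fun_eq_iff) (metis linorder_not_less)

lemma occupations_Suc: "occupations (Suc m) v n = (\<Union>x\<in>{x. admissible (v(n + p := x)) n}. occupations m (v(n + p := x)) (Suc n))"
proof (intro set_eqI iffI)
  fix w assume w: "w \<in> occupations (Suc m) v n"
  have "admissible (v(n + p := w (n + p))) n \<longleftrightarrow> admissible w n"
    using w by (intro admissible_cong) (auto simp: occupations_def)
  then have "admissible (v(n + p := w (n + p))) n" using w by (auto simp: occupations_def)
  moreover have "w \<in> occupations m (v(n + p := w (n + p))) (Suc n)"
    using w by (auto simp: occupations_def less_Suc_eq)
  ultimately show "w \<in> (\<Union>x\<in>{x. admissible (v(n + p := x)) n}. occupations m (v(n + p := x)) (Suc n))" by blast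
next
  fix w assume "w \<in> (\<Union>x\<in>{x. admissible (v(n + p := x)) n}. occupations m (v(n + p := x)) (Suc n))"
  then obtain x where x: "admissible (v(n + p := x)) n" "w \<in> occupations m (v(n + p := x)) (Suc n)" by blast
  have "admissible (v(n + p := x)) n \<longleftrightarrow> admissible w n"
    using x by (intro admissible_cong) (auto simp: occupations_def)
  then have "admissible w i" if "i \<in> {n..<n + Suc m}" for i
    using x that by (cases "i = n") (auto simp: occupations_def)
  moreover have "w i = v i" if "i < n + p \<or> n + Suc m + p \<le> i" for i
  proof -
    have "i < Suc n + p \<or> Suc n + m + p \<le> i" "i \<noteq> n + p" using that by auto
    then show ?thesis using x(2) unfolding occupations_def by auto
  qed
  ultimately show "w \<in> occupations (Suc m) v n" unfolding occupations_def by blast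
qed

lemma finite_occupations: "finite (occupations m v n)"
  by (induction m arbitrary: v n) (auto simp: occupations_0 occupations_Suc finite_admissible)

lemma slot_sum_eq_sum: "slot_sum m v n (\<lambda>_. 1) = (\<Sum>w\<in>occupations m v n. \<Prod>i\<in>{n..<n + m}. wt i ^ w (i + p))"
proof (induction m arbitrary: v n)
  case 0
  show ?case by (simp add: occupations_0)
next
  case (Suc m)
  have val: "w (n + p) = x" if "w \<in> occupations m (v(n + p := x)) (Suc n)" for w x
    using that by (auto simp: occupations_def)
  have "(\<Sum>w\<in>occupations (Suc m) v n. \<Prod>i\<in>{n..<n + Suc m}. wt i ^ w (i + p))
    = (\<Sum>x | admissible (v(n + p := x)) n. \<Sum>w\<in>occupations m (v(n + p := x)) (Suc n). \<Prod>i\<in>{n..<n + Suc m}. wt i ^ w (i + p))"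
    unfolding occupations_Suc
  proof (rule sum.UNION_disjoint)
    show "\<forall>x\<in>{x. admissible (v(n + p := x)) n}. \<forall>y\<in>{x. admissible (v(n + p := x)) n}. x \<noteq> y \<longrightarrow>
      occupations m (v(n + p := x)) (Suc n) \<inter> occupations m (v(n + p := y)) (Suc n) = {}"
      using val by blast
  qed (auto simp: finite_admissible finite_occupations)
  also have "\<dots> = (\<Sum>x | admissible (v(n + p := x)) n. wt n ^ x * slot_sum m (v(n + p := x)) (Suc n) (\<lambda>_. 1))"
    unfolding Suc.IH sum_distrib_left
  proof (intro sum.cong refl)
    fix x w assume "w \<in> occupations m (v(n + p := x)) (Suc n)"
    then show "(\<Prod>i\<in>{n..<n + Suc m}. wt i ^ w (i + p)) = wt n ^ x * (\<Prod>i\<in>{Suc n..<Suc n + m}. wt i ^ w (i + p))"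
      by (simp add: prod.atLeast_Suc_lessThan val del: prod.op_ivl_Suc)
  qed
  finally show ?case by simp
qed

end

section \<open>From the local carrier rules to window conditions\<close>

context slots
begin

text \<open>With \<open>k - r\<close> fictitious copies of the part \<open>0\<close>, the bound on small parts becomes a window condition.\<close>

definition v_init :: "nat \<Rightarrow> nat" where "v_init i = (if i = l then k - r else 0)"

text \<open>A window that ends at a bosonic slot also contains the slot exactly one period before,
  because the difference condition is strict there.\<close>

definition start :: "nat \<Rightarrow> nat" where "start n = (if bosonic n then n else Suc n)"

definition window_count :: "(nat \<Rightarrow> nat) \<Rightarrow> nat \<Rightarrow> nat" where
  "window_count v n = (\<Sum>i\<in>{start n..n + p}. v i)"

text \<open>The value \<open>v i\<close> belongs to slot \<open>i - p\<close>, for which the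
  quotient of the size by \<eta> is \<open>(i + 2) div p - 1\<close>.\<close>

definition window_floor :: "(nat \<Rightarrow> nat) \<Rightarrow> nat \<Rightarrow> int" where
  "window_floor v n = (\<Sum>i\<in>{start n..n + p}. int (v i) * (int ((i + 2) div p) - 1))"

definition overlined_below :: "(nat \<Rightarrow> nat) \<Rightarrow> nat \<Rightarrow> nat" where
  "overlined_below v n = (\<Sum>t | t < n \<and> \<not> bosonic t. v (t + p))"

text \<open>Counts the parts placed since the last multiple of \<eta> was reached. A window contains
  parts of two consecutive quotients by \<eta>, and these are the parts with the larger one.\<close>

definition current :: "(nat \<Rightarrow> nat) \<Rightarrow> nat \<Rightarrow> nat" where
  "current v n = (\<Sum>i\<in>{((n + 1) div p + 1) * p - 2..<n + p}. v i)"

text \<open>The integer whose parity the bit records. After a full window it equals the expression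
  in the parity condition, namely \<open>window_floor\<close> minus the number of overlined parts
  minus \<open>r - 1\<close>.\<close>

definition parity_count :: "(nat \<Rightarrow> nat) \<Rightarrow> nat \<Rightarrow> int" where
  "parity_count v n = (int ((n + 1) div p) - 1) * (int k - 1) + int (current v n) - int (overlined_below v n) - (int r - 1)"

lemma overlined_below_Suc: "overlined_below v (Suc n) = overlined_below v n + (if bosonic n then 0 else v (n + p))"
proof -
  have "{t. t < Suc n \<and> \<not> bosonic t} = (if bosonic n then {t. t < n \<and> \<not> bosonic t} else insert n {t. t < n \<and> \<not> bosonic t})"
    by (auto simp: less_Suc_eq)
  then show ?thesis by (simp add: overlined_below_def)
qed

lemma sum_split_first: "(a :: nat) < b \<Longrightarrow> (\<Sum>i\<in>{a..<b}. f i) = f a + (\<Sum>i\<in>{Suc a..<b}. f i :: nat)"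
  by (rule sum.atLeast_Suc_lessThan)

text \<open>Conservation of particles, with initial total \<open>(r - 1) + (k - r)\<close>.
  Admissibility prevents the natural subtractions in \<open>state\<close> from truncating.\<close>

lemma state_conserved:
  assumes v: "\<And>i. i < p \<Longrightarrow> v i = v_init i" and "\<And>i. i < n \<Longrightarrow> admissible v i"
  shows "fst (state v n) + (\<Sum>i\<in>{n..<n + p}. v i) = k - 1"
  using assms(2)
proof (induction n)
  case 0
  have "(\<Sum>i\<in>{0..<p}. v i) = (\<Sum>i\<in>{0..<p}. if i = l then k - r else 0)"
    using v by (intro sum.cong) (auto simp: v_init_def)
  then show ?case using p_pos kr by simp
next
  case (Suc n)
  have ih: "fst (state v n) + (\<Sum>i\<in>{n..<n + p}. v i) = k - 1" using Suc by simp
  have "(\<Sum>i\<in>{n..<n + p}. v i) = v n + (\<Sum>i\<in>{Suc n..<n + p}. v i)"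
    using p_pos by (intro sum_split_first) simp
  moreover have "(\<Sum>i\<in>{Suc n..<Suc n + p}. v i) = (\<Sum>i\<in>{Suc n..<n + p}. v i) + v (n + p)"
    using p_pos by (simp add: sum.op_ivl_Suc)
  moreover have "admissible v n" using Suc by simp
  ultimately show ?case using ih by (auto simp: admissible_def split: if_splits)
qed

lemma snd_st_le: "snd (state v n) \<le> 1"
  by (induction n) auto

lemma bosonic_iff: "bosonic n \<longleftrightarrow> p dvd n + 2"
proof -
  have "p dvd n + 2 \<longleftrightarrow> (n mod p + 2) mod p = 0" unfolding dvd_eq_mod_eq_0 mod_add_left_eq ..
  also have "\<dots> \<longleftrightarrow> n mod p = l"
  proof (cases "n mod p < l")
    case True
    then show ?thesis by (simp add: p_def)
  next
    case False
    have "n mod p < p" using p_pos by simp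
    then have "n mod p = l \<or> n mod p = l + 1" using False p_def by linarith
    then show ?thesis
    proof
      assume "n mod p = l + 1"
      then have "(n mod p + 2) mod p = 1" by (simp add: p_def mod_Suc numeral_3_eq_3)
      with \<open>n mod p = l + 1\<close> show ?thesis by simp
    qed (simp add: p_def)
  qed
  finally show ?thesis by (simp add: bosonic_def)
qed

lemma floor_step: "(n + 2) div p = (n + 1) div p + (if bosonic n then 1 else 0)"
proof -
  have "(Suc (n + 1)) div p = (if Suc (n + 1) mod p = 0 then Suc ((n + 1) div p) else (n + 1) div p)"
    by (rule div_Suc)
  then show ?thesis by (simp add: bosonic_iff dvd_eq_mod_eq_0)
qed

lemma current_Suc: "current v (Suc n) = (if bosonic n then v (n + p) else current v n + v (n + p))"
proof (cases "bosonic n")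
  case True
  then have "((n + 2) div p) * p = n + 2" using bosonic_iff by simp
  then have "(Suc n + 1) div p * p + p - 2 = n + p" by simp
  then show ?thesis using True by (simp add: current_def add_mult_distrib)
next
  case False
  have e: "(Suc n + 1) div p = (n + 1) div p" using floor_step[of n] False by simp
  have "((n + 1) div p + 1) * p - 2 \<le> n + p"
    using div_times_less_eq_dividend[of "n + 1" p] unfolding add_mult_distrib by linarith
  then show ?thesis using False unfolding current_def e by (simp add: sum.op_ivl_Suc)
qed

text \<open>At an \<open>Fm\<close> slot the new particles enter \<open>current\<close> and
  \<open>overlined_below\<close> alike and cancel. At a bosonic slot the count jumps, by
  conservation, by the content plus \<open>v (n + p)\<close>, which modulo 2 is the content left
  over, that is, what \<open>state\<close> adds to the bit.\<close>

lemma parity_state: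
  assumes v: "\<And>i. i < p \<Longrightarrow> v i = v_init i" and "\<And>i. i < n \<Longrightarrow> admissible v i"
  shows "even (int (snd (state v n)) - parity_count v n)"
  using assms(2)
proof (induction n)
  case 0
  have "(\<Sum>i\<in>{p - 2..<p}. v i) = k - r"
  proof -
    have "{p - 2..<p} = {l, Suc l}" by (auto simp: p_def)
    then show ?thesis using v[of l] v[of "Suc l"] by (simp add: p_def v_init_def)
  qed
  moreover have "1 div p = 0" by (simp add: p_def)
  ultimately have "parity_count v 0 = - (int k - 1) + (int k - int r) - (int r - 1)"
    using kr by (simp add: parity_count_def current_def overlined_below_def of_nat_diff)
  then show ?case by simp
next
  case (Suc n)
  have ih: "even (int (snd (state v n)) - parity_count v n)" and admissible: "admissible v n" using Suc by auto
  have cons: "fst (state v n) + (\<Sum>i\<in>{n..<n + p}. v i) = k - 1" using state_conserved[OF v] Suc by simp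
  show ?case
  proof (cases "bosonic n")
    case True
    have le: "v (n + p) \<le> fst (state v n)" using admissible True by (simp add: admissible_def)
    have f: "(Suc n + 1) div p = (n + 1) div p + 1" using floor_step[of n] True by simp
    have "((n + 2) div p) * p = n + 2" using True bosonic_iff by simp
    then have "((n + 1) div p + 1) * p = n + 2" using f by simp
    then have c: "current v n = (\<Sum>i\<in>{n..<n + p}. v i)" by (simp add: current_def)
    have "parity_count v (Suc n) - parity_count v n = (int k - 1) + int (v (n + p)) - int (current v n)"
      unfolding parity_count_def f current_Suc overlined_below_Suc using True by (simp add: algebra_simps)
    also have "\<dots> = int (fst (state v n)) + int (v (n + p))"
      using arg_cong[OF cons, of int] kr unfolding c by (simp add: of_nat_diff)
    finally have Z: "parity_count v (Suc n) = parity_count v n + int (fst (state v n)) + int (v (n + p))" by simp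
    have "int (snd (state v (Suc n))) = (int (snd (state v n)) + (int (fst (state v n)) - int (v (n + p)))) mod 2"
      using True le by (simp add: of_nat_diff zmod_int add_diff_eq)
    then show ?thesis unfolding Z using ih by presburger
  next
    case False
    have f: "(Suc n + 1) div p = (n + 1) div p" using floor_step[of n] False by simp
    have "parity_count v (Suc n) = parity_count v n" unfolding parity_count_def f current_Suc overlined_below_Suc using False by simp
    then show ?thesis using ih False by simp
  qed
qed

lemma window_floor_eq:
  assumes v: "\<And>i. i < p \<Longrightarrow> v i = v_init i"
  shows "window_floor v n = (int ((n + 2) div p) - 1) * int (window_count v n) + int (current v (Suc n))"
proof -
  define \<rho> where "\<rho> = (n + 2) div p"
  have \<rho>: "\<rho> * p \<le> n + 2" "n + 2 < \<rho> * p + p"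
    unfolding \<rho>_def using div_times_less_eq_dividend[of "n + 2" p] dividend_less_div_times[of p "n + 2"] p_pos by auto
  have state: "\<rho> * p \<le> start n + 2" using \<rho> by (simp add: start_def)
  have trm: "int (v i) * (int ((i + 2) div p) - 1) = (int \<rho> - 1) * int (v i) + (if (\<rho> + 1) * p - 2 \<le> i then int (v i) else 0)"
    if i: "i \<in> {start n..n + p}" for i
  proof -
    have "(i + 2) div p = (if (\<rho> + 1) * p - 2 \<le> i then \<rho> + 1 else \<rho>)"
    proof (cases "(\<rho> + 1) * p - 2 \<le> i")
      case True
      have "p \<le> (\<rho> + 1) * p" by simp
      then have "(\<rho> + 1) * p \<le> i + 2" using True p_def by linarith
      moreover have "i + 2 < (\<rho> + 1) * p + p" using i \<rho> by (simp add: add_mult_distrib)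
      ultimately have "(i + 2) div p = \<rho> + 1" by (intro div_nat_eqI) (simp_all add: mult.commute)
      then show ?thesis using True by simp
    next
      case False
      then have "i + 2 < \<rho> * p + p" by (simp add: add_mult_distrib)
      moreover have "\<rho> * p \<le> i + 2" using state i by simp
      ultimately have "(i + 2) div p = \<rho>" by (intro div_nat_eqI) (simp_all add: mult.commute)
      then show ?thesis using False by simp
    qed
    then show ?thesis by (simp add: algebra_simps)
  qed
  have "window_floor v n = (\<Sum>i\<in>{start n..n + p}. (int \<rho> - 1) * int (v i) + (if (\<rho> + 1) * p - 2 \<le> i then int (v i) else 0))"
    unfolding window_floor_def by (intro sum.cong refl trm)
  also have "\<dots> = (int \<rho> - 1) * int (window_count v n) + (\<Sum>i\<in>{start n..n + p}. if (\<rho> + 1) * p - 2 \<le> i then int (v i) else 0)"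
    by (simp add: sum.distrib sum_distrib_left window_count_def)
  also have "(\<Sum>i\<in>{start n..n + p}. if (\<rho> + 1) * p - 2 \<le> i then int (v i) else 0)
    = (\<Sum>i\<in>{i\<in>{start n..n + p}. (\<rho> + 1) * p - 2 \<le> i}. int (v i))"
    by (rule sum.inter_filter[symmetric]) simp
  also have "{i\<in>{start n..n + p}. (\<rho> + 1) * p - 2 \<le> i} = {(\<rho> + 1) * p - 2..<Suc n + p}"
  proof -
    have "start n \<le> Suc n" "n + 2 < \<rho> * p + p" using \<rho> by (auto simp: start_def)
    then have "start n \<le> (\<rho> + 1) * p - 2" by (simp add: add_mult_distrib)
    then show ?thesis by auto
  qed
  finally show ?thesis by (simp add: current_def \<rho>_def)
qed

text \<open>By conservation, admissibility says that the window count plus the bit is at most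
  \<open>k - 1\<close>. As the bit is at most 1, it matters only for a full window, where it has to
  vanish.\<close>

lemma admissible_iff:
  assumes v: "\<And>i. i < p \<Longrightarrow> v i = v_init i" and admissible: "\<And>i. i < n \<Longrightarrow> admissible v i"
  shows "admissible v n \<longleftrightarrow> (\<not> bosonic n \<longrightarrow> v (n + p) \<le> 1) \<and> window_count v n \<le> k - 1
    \<and> (window_count v n = k - 1 \<longrightarrow> even (window_floor v n - int (overlined_below v (Suc n)) - (int r - 1)))"
proof -
  define W where "W = window_count v n"
  define b where "b = snd (state v n)"
  have cons: "fst (state v n) + (\<Sum>i\<in>{n..<n + p}. v i) = k - 1" using state_conserved[OF v admissible] by simp
  have sp: "(\<Sum>i\<in>{n..<n + p}. v i) = v n + (\<Sum>i\<in>{Suc n..<n + p}. v i)"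
    using p_pos by (intro sum_split_first) simp
  have W: "W = (if bosonic n then v n else 0) + (\<Sum>i\<in>{Suc n..<n + p}. v i) + v (n + p)"
  proof -
    have "{start n..n + p} = insert (n + p) (if bosonic n then insert n {Suc n..<n + p} else {Suc n..<n + p})"
      using p_pos by (auto simp: start_def)
    then show ?thesis using p_pos by (simp add: W_def window_count_def)
  qed
  have ok1: "admissible v n \<longleftrightarrow> (\<not> bosonic n \<longrightarrow> v (n + p) \<le> 1) \<and> W + b \<le> k - 1"
  proof (cases "bosonic n")
    case True
    then have "W = (\<Sum>i\<in>{n..<n + p}. v i) + v (n + p)" using W sp by simp
    then show ?thesis using True cons unfolding admissible_def b_def by auto
  next
    case False
    then have "W + v n = (\<Sum>i\<in>{n..<n + p}. v i) + v (n + p)" using W sp by simp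
    then show ?thesis using False cons unfolding admissible_def b_def by auto
  qed
  have b: "b \<le> 1" unfolding b_def by (rule snd_st_le)
  have parity_cond: "even (int b) \<longleftrightarrow> even (window_floor v n - int (overlined_below v (Suc n)) - (int r - 1))" if full: "W = k - 1"
  proof -
    have Z: "window_floor v n - int (overlined_below v (Suc n)) - (int r - 1) = parity_count v (Suc n)"
    proof -
      have "window_floor v n = (int ((n + 2) div p) - 1) * int (window_count v n) + int (current v (Suc n))" using v by (rule window_floor_eq)
      moreover have "int (window_count v n) = int k - 1" using full kr by (simp add: W_def of_nat_diff)
      moreover have "Suc n + 1 = n + 2" by simp
      ultimately show ?thesis unfolding parity_count_def by (simp only:)
    qed
    have e: "even (int b - parity_count v n)" unfolding b_def by (rule parity_state[OF v admissible])
    \<comment> \<open>When the window is full, slot \<open>n\<close> changes the count by an even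
      number, so the bit before the slot can be compared with the count after it.\<close>
    have "even (parity_count v (Suc n) - parity_count v n)"
    proof (cases "bosonic n")
      case True
      have f: "(Suc n + 1) div p = (n + 1) div p + 1" using floor_step[of n] True by simp
      have "((n + 2) div p) * p = n + 2" using True bosonic_iff by simp
      then have "((n + 1) div p + 1) * p = n + 2" using f by simp
      then have c: "current v n = (\<Sum>i\<in>{n..<n + p}. v i)" by (simp add: current_def)
      have "parity_count v (Suc n) - parity_count v n = (int k - 1) + int (v (n + p)) - int (current v n)"
        unfolding parity_count_def f current_Suc overlined_below_Suc using True by (simp add: algebra_simps)
      also have "int k - 1 = int W" using full kr by (simp add: of_nat_diff)
      also have "W = current v n + v (n + p)" using True W sp c by simp
      finally show ?thesis by simp
    next
      case False
      have f: "(Suc n + 1) div p = (n + 1) div p" using floor_step[of n] False by simp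
      show ?thesis unfolding parity_count_def f current_Suc overlined_below_Suc using False by simp
    qed
    then show ?thesis unfolding Z using e by presburger
  qed
  show ?thesis
  proof (cases "W = k - 1")
    case True
    have "W + b \<le> k - 1 \<longleftrightarrow> b = 0" using True by simp
    also have "\<dots> \<longleftrightarrow> even (int b)" using b by (cases "b = 0") (auto simp: le_Suc_eq)
    also have "\<dots> \<longleftrightarrow> even (window_floor v n - int (overlined_below v (Suc n)) - (int r - 1))" using parity_cond True by simp
    finally show ?thesis using True ok1 unfolding W_def by simp
  next
    case False
    then have "W + b \<le> k - 1 \<longleftrightarrow> W \<le> k - 1" using b by auto
    then show ?thesis using False ok1 unfolding W_def by simp
  qed
qed

lemma all_ok_iff:
  assumes v: "\<And>i. i < p \<Longrightarrow> v i = v_init i"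
  shows "(\<forall>n<m. admissible v n) \<longleftrightarrow> (\<forall>n<m. (\<not> bosonic n \<longrightarrow> v (n + p) \<le> 1) \<and> window_count v n \<le> k - 1
    \<and> (window_count v n = k - 1 \<longrightarrow> even (window_floor v n - int (overlined_below v (Suc n)) - (int r - 1))))"
proof (induction m)
  case (Suc m)
  then show ?case using admissible_iff[OF v, of m] by (metis less_Suc_eq)
qed simp

end

section \<open>Occupation functions and decreasing lists of slots\<close>

lemma filter_prefix:
  assumes "sorted_wrt (\<ge>) xs" "\<And>x y. x \<le> y \<Longrightarrow> P x \<Longrightarrow> P (y :: nat)" "i < length xs"
  shows "P (xs ! i) \<longleftrightarrow> i < length (filter P xs)"
  using assms(1,3)
proof (induction xs arbitrary: i)
  case (Cons x xs)
  show ?case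
  proof (cases "P x")
    case True
    then show ?thesis using Cons by (cases i) auto
  next
    case False
    have "\<not> P y" if "y \<in> set xs" for y using False assms(2) Cons.prems(1) that by auto
    then have "filter P xs = []" by (simp add: filter_empty_conv)
    moreover have "\<not> P ((x # xs) ! i)" using False Cons.prems assms(2) by (cases i) (auto dest!: nth_mem)
    ultimately show ?thesis using False by simp
  qed
qed simp

lemma sum_list_filter_nth:
  "sum_list (map f (filter P xs)) = (\<Sum>j | j < length xs \<and> P (xs ! j). f (xs ! j) :: 'a :: comm_monoid_add)"
proof -
  have "sum_list (map f (filter P xs)) = sum_list (map (\<lambda>x. if P x then f x else 0) xs)"
    by (induction xs) auto
  also have "\<dots> = (\<Sum>j\<in>{0..<length xs}. if P (xs ! j) then f (xs ! j) else 0)"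
    by (simp add: sum_list_sum_nth)
  also have "\<dots> = (\<Sum>j | j \<in> {0..<length xs} \<and> P (xs ! j). f (xs ! j))"
    by (rule sum.inter_filter[symmetric]) simp
  finally show ?thesis by simp
qed

lemma sum_count_list:
  assumes "finite T"
  shows "(\<Sum>t\<in>T. int (count_list xs t) * f t) = sum_list (map f (filter (\<lambda>x. x \<in> T) xs))"
proof (induction xs)
  case (Cons x xs)
  have "(\<Sum>t\<in>T. int (count_list (x # xs) t) * f t) = (\<Sum>t\<in>T. int (count_list xs t) * f t + (if t = x then f t else 0))"
    by (intro sum.cong) (auto simp: algebra_simps)
  then show ?case using assms Cons by (simp add: sum.distrib)
qed simp

context slots
begin

text \<open>A weak inequality in the difference condition means a distance of \<open>p\<close>
  slots, a strict one of \<open>p + 1\<close>; strictness is required below a non-overlined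
  part.\<close>

definition window_len :: "nat \<Rightarrow> nat" where "window_len t = (if bosonic t then Suc p else p)"

definition slot_conds :: "nat list \<Rightarrow> bool" where
  "slot_conds xs \<longleftrightarrow>
     (\<forall>t. \<not> bosonic t \<longrightarrow> count_list xs t \<le> 1) \<and>
     (\<forall>i. i + k - 1 < length xs \<longrightarrow> xs ! (i + k - 1) + window_len (xs ! i) \<le> xs ! i) \<and>
     length (filter (\<lambda>x. x \<le> l) xs) \<le> r - 1 \<and>
     (\<forall>i. i + k - 2 < length xs \<and> xs ! i < xs ! (i + k - 2) + window_len (xs ! i) \<longrightarrow>
        even (int (\<Sum>j = i..i + k - 2. (xs ! j + 2) div p)
          - int (length (filter (\<lambda>x. \<not> bosonic x \<and> x \<le> xs ! i) xs)) - (int r - 1)))"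

definition occupancy :: "nat list \<Rightarrow> nat \<Rightarrow> nat" where
  "occupancy xs i = (if i < p then v_init i else count_list xs (i - p))"

text \<open>In a decreasing list the parts in the window ending at slot \<open>n\<close> have the
  indices from \<open>above_count\<close> up to, but excluding, \<open>reach_count\<close>.\<close>

definition above_count :: "nat list \<Rightarrow> nat \<Rightarrow> nat" where "above_count xs n = length (filter (\<lambda>x. n < x) xs)"

definition reach_count :: "nat list \<Rightarrow> nat \<Rightarrow> nat" where "reach_count xs n = length (filter (\<lambda>x. n < x + window_len n) xs)"

lemma bosonic_l: "n \<le> l \<Longrightarrow> bosonic n \<longleftrightarrow> n = l"
  using p_pos by (simp add: bosonic_def)

text \<open>The fictitious parts at index \<open>l\<close> lie in the windows of the slots
  \<open>n \<le> l\<close> and in no others.\<close>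

lemma window_sum:
  "(\<Sum>i\<in>{start n..n + p}. int (occupancy xs i) * f i) = (if n \<le> l then int (k - r) * f l else 0)
     + sum_list (map (\<lambda>t. f (t + p)) (filter (\<lambda>x. x \<le> n \<and> n < x + window_len n) xs))"
proof -
  have state: "start n \<le> Suc n" by (simp add: start_def)
  have "{start n..n + p} = {start n..<p} \<union> {max p (start n)..n + p}" using state p_pos by auto
  then have "(\<Sum>i\<in>{start n..n + p}. int (occupancy xs i) * f i)
    = (\<Sum>i\<in>{start n..<p}. int (occupancy xs i) * f i) + (\<Sum>i\<in>{max p (start n)..n + p}. int (occupancy xs i) * f i)"
    by (simp only:) (intro sum.union_disjoint, auto)
  also have "(\<Sum>i\<in>{start n..<p}. int (occupancy xs i) * f i) = (\<Sum>i\<in>{start n..<p}. if i = l then int (k - r) * f l else 0)"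
    by (intro sum.cong) (auto simp: occupancy_def v_init_def)
  also have "\<dots> = (if n \<le> l then int (k - r) * f l else 0)"
  proof -
    have "l \<in> {start n..<p} \<longleftrightarrow> n \<le> l" using p_pos bosonic_l[of n] by (auto simp: start_def)
    then show ?thesis by simp
  qed
  also have "(\<Sum>i\<in>{max p (start n)..n + p}. int (occupancy xs i) * f i) = (\<Sum>t | t \<le> n \<and> n < t + window_len n. int (count_list xs t) * f (t + p))"
    by (rule sum.reindex_bij_witness[where i = "\<lambda>t. t + p" and j = "\<lambda>i. i - p"])
       (auto simp: occupancy_def window_len_def start_def split: if_splits)
  also have "\<dots> = sum_list (map (\<lambda>t. f (t + p)) (filter (\<lambda>x. x \<in> {t. t \<le> n \<and> n < t + window_len n}) xs))"
    by (rule sum_count_list) simp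
  finally show ?thesis by simp
qed

context
  fixes xs :: "nat list"
  assumes sorted: "sorted_wrt (\<ge>) xs"
begin

lemma above_count_iff: "i < length xs \<Longrightarrow> n < xs ! i \<longleftrightarrow> i < above_count xs n"
  unfolding above_count_def by (rule filter_prefix[OF sorted]) auto

lemma reach_count_iff: "i < length xs \<Longrightarrow> n < xs ! i + window_len n \<longleftrightarrow> i < reach_count xs n"
  unfolding reach_count_def by (rule filter_prefix[OF sorted]) auto

lemma reach_count_le: "reach_count xs n \<le> length xs" by (simp add: reach_count_def)

lemma above_count_le_reach_count: "above_count xs n \<le> reach_count xs n"
  unfolding above_count_def reach_count_def by (induction xs) auto

lemma window_indices: "{j. j < length xs \<and> xs ! j \<le> n \<and> n < xs ! j + window_len n} = {above_count xs n..<reach_count xs n}"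
  using above_count_iff reach_count_iff reach_count_le[of n] by (auto simp: not_less) (meson leD not_le order_less_le_trans)+

lemma window_sum_nth:
  "sum_list (map f (filter (\<lambda>x. x \<le> n \<and> n < x + window_len n) xs)) = (\<Sum>j\<in>{above_count xs n..<reach_count xs n}. f (xs ! j) :: int)"
  unfolding sum_list_filter_nth window_indices ..

lemma window_count_occupancy: "window_count (occupancy xs) n = (reach_count xs n - above_count xs n) + (if n \<le> l then k - r else 0)"
proof -
  have "int (window_count (occupancy xs) n) = int ((reach_count xs n - above_count xs n) + (if n \<le> l then k - r else 0))"
    using window_sum[of xs "\<lambda>_. 1" n] window_sum_nth[of "\<lambda>_. 1" n] by (simp add: window_count_def)
  then show ?thesis by (simp only: of_nat_eq_iff)
qed

lemma window_floor_occupancy: "window_floor (occupancy xs) n = (\<Sum>j\<in>{above_count xs n..<reach_count xs n}. int ((xs ! j + 2) div p))"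
proof -
  have e1: "int ((l + 2) div p) - 1 = 0" by (simp add: p_def)
  have e2: "int ((t + p + 2) div p) - 1 = int ((t + 2) div p)" for t
  proof -
    have "(t + p + 2) div p = ((t + 2) + p) div p" by (simp only: ac_simps)
    also have "\<dots> = (t + 2) div p + 1" using p_pos by (intro div_add_self2) simp
    finally show ?thesis by simp
  qed
  show ?thesis
    unfolding window_floor_def window_sum[of xs "\<lambda>i. int ((i + 2) div p) - 1" n] e1 e2 window_sum_nth by simp
qed

lemma overlined_below_occupancy: "overlined_below (occupancy xs) (Suc n) = length (filter (\<lambda>x. \<not> bosonic x \<and> x \<le> n) xs)"
proof -
  have "int (overlined_below (occupancy xs) (Suc n)) = (\<Sum>t | t < Suc n \<and> \<not> bosonic t. int (count_list xs t) * 1)"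
    by (simp add: overlined_below_def occupancy_def)
  also have "\<dots> = sum_list (map (\<lambda>_. 1) (filter (\<lambda>x. x \<in> {t. t < Suc n \<and> \<not> bosonic t}) xs))"
    by (rule sum_count_list) simp
  also have "\<dots> = int (length (filter (\<lambda>x. \<not> bosonic x \<and> x \<le> n) xs))"
    by (simp add: sum_list_triv less_Suc_eq_le conj_commute)
  finally show ?thesis by (simp only: of_nat_eq_iff)
qed

definition parity_cond :: "nat \<Rightarrow> bool" where
  "parity_cond n \<longleftrightarrow> even ((\<Sum>j\<in>{above_count xs n..<reach_count xs n}. int ((xs ! j + 2) div p))
     - int (length (filter (\<lambda>x. \<not> bosonic x \<and> x \<le> n) xs)) - (int r - 1))"

text \<open>A part up to slot \<open>l\<close> is either overlined with quotient 0 or the part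
  \<eta> with quotient 1. The quotients thus sum to \<open>r - 1\<close> minus the number of
  overlined parts, and the parity condition holds automatically.\<close>

lemma parity_cond_early:
  assumes n: "n \<le> l" and w: "reach_count xs n - above_count xs n = r - 1"
  shows "parity_cond n"
proof -
  have window_len: "n < x + window_len n" for x using n p_pos by (auto simp: window_len_def)
  have "(\<Sum>j\<in>{above_count xs n..<reach_count xs n}. int ((xs ! j + 2) div p)) + int (length (filter (\<lambda>x. \<not> bosonic x \<and> x \<le> n) xs))
    = sum_list (map (\<lambda>t. int ((t + 2) div p)) (filter (\<lambda>x. x \<le> n) xs)) + int (length (filter (\<lambda>x. \<not> bosonic x \<and> x \<le> n) xs))"
    using window_sum_nth[of "\<lambda>t. int ((t + 2) div p)" n] window_len by (simp only: conj_commute simp_thms)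
  also have "\<dots> = int (length (filter (\<lambda>x. x \<le> n) xs))"
  proof (induction xs)
    case (Cons x xs)
    have "int ((x + 2) div p) + (if bosonic x then 0 else 1) = 1" if "x \<le> n"
      using that n bosonic_l[of x] by (auto simp: p_def)
    with Cons show ?case by auto
  qed simp
  also have "\<dots> = (\<Sum>j\<in>{above_count xs n..<reach_count xs n}. 1)"
    using window_sum_nth[of "\<lambda>t. 1" n] window_len by (simp add: sum_list_triv)
  also have "\<dots> = int r - 1" using w kr by (simp add: of_nat_diff)
  finally have "(\<Sum>j\<in>{above_count xs n..<reach_count xs n}. int ((xs ! j + 2) div p)) = int r - 1 - int (length (filter (\<lambda>x. \<not> bosonic x \<and> x \<le> n) xs))"
    by simp
  then show ?thesis unfolding parity_cond_def by simp
qed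

lemma above_count_window_early: "n \<le> l \<Longrightarrow> reach_count xs n - above_count xs n = length (filter (\<lambda>x. x \<le> n) xs)"
proof -
  assume n: "n \<le> l"
  have window_len: "n < x + window_len n" for x using n p_pos by (auto simp: window_len_def)
  have "int (reach_count xs n - above_count xs n) = sum_list (map (\<lambda>_. 1) (filter (\<lambda>x. x \<le> n \<and> n < x + window_len n) xs))"
    using window_sum_nth[of "\<lambda>t. 1" n] by simp
  then show ?thesis using window_len by (simp add: sum_list_triv)
qed

text \<open>If \<open>xs ! i < n\<close>, passing from \<open>n\<close> to \<open>xs ! i\<close>
  gains at least one slot, which pays for the longer window of a bosonic \<open>n\<close>.\<close>

lemma shift_window:
  assumes "xs ! i \<le> n" "n < y + window_len n"
  shows "xs ! i < y + window_len (xs ! i)"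
proof (cases "xs ! i = n")
  case False
  then show ?thesis using assms by (auto simp: window_len_def split: if_splits)
qed (use assms in simp)

text \<open>\<open>slot_conds\<close> looks at windows that end at an occurring part,
  \<open>admissible\<close> at windows that end at any slot. By \<open>shift_window\<close> the
  latter reduce to the window of the largest part not above the slot. For \<open>n \<le> l\<close>
  the \<open>k - r\<close> fictitious parts turn the bound \<open>k - 1\<close> into
  \<open>r - 1\<close>; the case \<open>n = l\<close> is the condition on small parts, and the
  parity is settled by \<open>parity_cond_early\<close>.\<close>

lemma slot_conds_iff:
  assumes set: "set xs \<subseteq> {..<m}" and m: "l < m"
  shows "slot_conds xs \<longleftrightarrow> (\<forall>n<m. admissible (occupancy xs) n)"
proof
  assume sc: "slot_conds xs"
  have W: "reach_count xs n - above_count xs n \<le> k - 1" for n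
  proof (rule ccontr)
    assume "\<not> ?thesis"
    then have b: "above_count xs n + k - 1 < reach_count xs n" by simp
    then have len: "above_count xs n + k - 1 < length xs" "above_count xs n < length xs" using reach_count_le[of n] kr by auto
    have "xs ! above_count xs n \<le> n" using above_count_iff[OF len(2), of n] by simp
    moreover have "n < xs ! (above_count xs n + k - 1) + window_len n" using reach_count_iff[OF len(1), of n] b by simp
    ultimately have "xs ! above_count xs n < xs ! (above_count xs n + k - 1) + window_len (xs ! above_count xs n)" by (rule shift_window)
    moreover have "xs ! (above_count xs n + k - 1) + window_len (xs ! above_count xs n) \<le> xs ! above_count xs n"
      using sc len(1) unfolding slot_conds_def by blast
    ultimately show False by simp
  qed
  have P: "parity_cond n" if full: "reach_count xs n - above_count xs n = k - 1" for n
  proof -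
    define i where "i = above_count xs n"
    have b: "reach_count xs n = Suc (i + k - 2)" using full kr above_count_le_reach_count[of n] by (auto simp: i_def)
    then have len: "i + k - 2 < length xs" "i < length xs" using reach_count_le[of n] kr by auto
    have le: "xs ! i \<le> n" using above_count_iff[OF len(2), of n] by (simp add: i_def)
    moreover have "n < xs ! (i + k - 2) + window_len n" using reach_count_iff[OF len(1), of n] b by simp
    ultimately have "xs ! i < xs ! (i + k - 2) + window_len (xs ! i)" by (rule shift_window)
    then have e: "even (int (\<Sum>j = i..i + k - 2. (xs ! j + 2) div p)
          - int (length (filter (\<lambda>x. \<not> bosonic x \<and> x \<le> xs ! i) xs)) - (int r - 1))"
      using sc len(1) unfolding slot_conds_def by blast
    \<comment> \<open>No part lies strictly above \<open>xs ! i\<close> and at or below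
      \<open>n\<close>, so both bounds count the same overlined parts.\<close>
    have f: "filter (\<lambda>x. \<not> bosonic x \<and> x \<le> xs ! i) xs = filter (\<lambda>x. \<not> bosonic x \<and> x \<le> n) xs"
    proof (rule filter_cong[OF refl])
      fix x assume "x \<in> set xs"
      then obtain j where j: "j < length xs" "x = xs ! j" by (auto simp: in_set_conv_nth)
      have "x \<le> n \<longleftrightarrow> i \<le> j" using above_count_iff[OF j(1), of n] j(2) by (auto simp: i_def)
      moreover have "i \<le> j \<Longrightarrow> x \<le> xs ! i"
        using sorted_wrt_nth_less[OF sorted, of i j] j by (cases "i = j") auto
      ultimately show "(\<not> bosonic x \<and> x \<le> xs ! i) = (\<not> bosonic x \<and> x \<le> n)" using le by auto
    qed
    have "{above_count xs n..<reach_count xs n} = {i..i + k - 2}" unfolding b i_def by auto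
    then show ?thesis using e unfolding parity_cond_def f by simp
  qed
  have c4: "length (filter (\<lambda>x. x \<le> l) xs) \<le> r - 1" using sc by (simp add: slot_conds_def)
  have early: "reach_count xs n - above_count xs n \<le> r - 1" if "n \<le> l" for n
  proof -
    have "length (filter (\<lambda>x. x \<le> n) xs) \<le> length (filter (\<lambda>x. x \<le> l) xs)"
      using that by (induction xs) auto
    then show ?thesis using c4 above_count_window_early[OF that] by simp
  qed
  show "\<forall>n<m. admissible (occupancy xs) n"
  proof (subst all_ok_iff)
    show "\<forall>n<m. (\<not> bosonic n \<longrightarrow> occupancy xs (n + p) \<le> 1) \<and> window_count (occupancy xs) n \<le> k - 1 \<and>
      (window_count (occupancy xs) n = k - 1 \<longrightarrow> even (window_floor (occupancy xs) n - int (overlined_below (occupancy xs) (Suc n)) - (int r - 1)))"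
    proof (intro allI impI conjI)
      fix n
      show "occupancy xs (n + p) \<le> 1" if "\<not> bosonic n" using sc that by (simp add: occupancy_def slot_conds_def)
      show "window_count (occupancy xs) n \<le> k - 1" unfolding window_count_occupancy using W[of n] early[of n] kr by (cases "n \<le> l") auto
      show "even (window_floor (occupancy xs) n - int (overlined_below (occupancy xs) (Suc n)) - (int r - 1))" if "window_count (occupancy xs) n = k - 1"
        unfolding window_floor_occupancy overlined_below_occupancy parity_cond_def[symmetric]
        using that unfolding window_count_occupancy using P[of n] parity_cond_early[of n] kr by (cases "n \<le> l") auto
    qed
  qed (simp add: occupancy_def)
next
  assume "\<forall>n<m. admissible (occupancy xs) n"
  then have all: "\<forall>n<m. (\<not> bosonic n \<longrightarrow> occupancy xs (n + p) \<le> 1) \<and> window_count (occupancy xs) n \<le> k - 1 \<and>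
      (window_count (occupancy xs) n = k - 1 \<longrightarrow> even (window_floor (occupancy xs) n - int (overlined_below (occupancy xs) (Suc n)) - (int r - 1)))"
    by (subst (asm) all_ok_iff) (simp_all add: occupancy_def)
  have W: "reach_count xs n - above_count xs n \<le> k - 1" if "n < m" for n
    using all[rule_format, OF that] unfolding window_count_occupancy by auto
  have early: "reach_count xs n - above_count xs n \<le> r - 1" if "n < m" "n \<le> l" for n
    using all[rule_format, OF that(1)] that(2) kr unfolding window_count_occupancy by auto
  have P: "parity_cond n" if "n < m" "reach_count xs n - above_count xs n = k - 1" for n
  proof (cases "n \<le> l")
    case True
    then show ?thesis using early[OF that(1)] that(2) kr by (intro parity_cond_early) auto
  next
    case False
    then show ?thesis
      using all[rule_format, OF that(1)] that(2) unfolding window_count_occupancy window_floor_occupancy overlined_below_occupancy parity_cond_def[symmetric] by auto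
  qed
  have less: "xs ! i < m" if "i < length xs" for i using set that nth_mem by fastforce
  show "slot_conds xs"
    unfolding slot_conds_def
  proof (intro conjI allI impI)
    fix t assume t: "\<not> bosonic t"
    show "count_list xs t \<le> 1"
    proof (cases "t < m")
      case True
      then show ?thesis using all t by (simp add: occupancy_def)
    next
      case False
      then have "t \<notin> set xs" using set by auto
      then show ?thesis by (simp add: count_list_0_iff)
    qed
  next
    fix i assume i: "i + k - 1 < length xs"
    then have i': "i < length xs" using kr by simp
    show "xs ! (i + k - 1) + window_len (xs ! i) \<le> xs ! i"
    proof (rule ccontr)
      assume "\<not> ?thesis"
      then have "i + k - 1 < reach_count xs (xs ! i)" using reach_count_iff[OF i, of "xs ! i"] by simp
      moreover have "above_count xs (xs ! i) \<le> i" using above_count_iff[OF i', of "xs ! i"] by simp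
      ultimately show False using W[OF less[OF i']] kr by simp
    qed
  next
    show "length (filter (\<lambda>x. x \<le> l) xs) \<le> r - 1"
      using early[OF m order_refl] above_count_window_early[OF order_refl] by simp
  next
    fix i assume i: "i + k - 2 < length xs \<and> xs ! i < xs ! (i + k - 2) + window_len (xs ! i)"
    then have i': "i < length xs" using kr by linarith
    have b: "i + k - 2 < reach_count xs (xs ! i)" using reach_count_iff[of "i + k - 2" "xs ! i"] i by simp
    have a: "above_count xs (xs ! i) \<le> i" using above_count_iff[OF i', of "xs ! i"] by simp
    have eq: "above_count xs (xs ! i) = i" "reach_count xs (xs ! i) = Suc (i + k - 2)"
      using W[OF less[OF i']] a b kr by auto
    have "parity_cond (xs ! i)" using eq kr by (intro P less i') auto
    moreover have "{above_count xs (xs ! i)..<reach_count xs (xs ! i)} = {i..i + k - 2}" unfolding eq by auto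
    ultimately show "even (int (\<Sum>j = i..i + k - 2. (xs ! j + 2) div p)
          - int (length (filter (\<lambda>x. \<not> bosonic x \<and> x \<le> xs ! i) xs)) - (int r - 1))"
      unfolding parity_cond_def by simp
  qed
qed

end

lemma sorted_eq_if_count:
  assumes "sorted_wrt (\<ge>) xs" "sorted_wrt (\<ge>) (ys :: nat list)" "\<And>t. count_list xs t = count_list ys t"
  shows "xs = ys"
proof -
  have "mset xs = mset ys" using assms(3) by (intro multiset_eqI) (simp add: count_mset)
  then have "mset (rev xs) = mset (rev ys)" by simp
  moreover have "sorted (rev xs)" "sorted (rev ys)" using assms(1,2) by (simp_all add: sorted_wrt_rev)
  ultimately have "rev xs = rev ys" by (metis properties_for_sort)
  then show ?thesis by simp
qed

definition slot_lists :: "nat \<Rightarrow> nat list set" where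
  "slot_lists m = {xs. sorted_wrt (\<ge>) xs \<and> set xs \<subseteq> {..<m} \<and> slot_conds xs}"

lemma occupancy_bij:
  assumes m: "l < m"
  shows "bij_betw occupancy (slot_lists m) (occupations m v_init 0)"
proof (rule bij_betw_imageI)
  show "inj_on occupancy (slot_lists m)"
  proof (rule inj_onI)
    fix xs ys assume x: "xs \<in> slot_lists m" and y: "ys \<in> slot_lists m" and e: "occupancy xs = occupancy ys"
    have "count_list xs t = count_list ys t" for t
      using fun_cong[OF e, of "t + p"] by (simp add: occupancy_def)
    then show "xs = ys" using x y by (intro sorted_eq_if_count) (auto simp: slot_lists_def)
  qed
  show "occupancy ` slot_lists m = occupations m v_init 0"
  proof (intro set_eqI iffI)
    fix v assume "v \<in> occupancy ` slot_lists m"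
    then obtain xs where xs: "sorted_wrt (\<ge>) xs" "set xs \<subseteq> {..<m}" "slot_conds xs" "v = occupancy xs"
      by (auto simp: slot_lists_def)
    have "\<forall>n<m. admissible v n" using slot_conds_iff[OF xs(1,2) m] xs by simp
    moreover have "v i = v_init i" if "m + p \<le> i" for i
    proof -
      have "i - p \<notin> set xs" using xs(2) that by auto
      then show ?thesis using that xs(4) p_pos by (auto simp: occupancy_def v_init_def count_list_0_iff)
    qed
    ultimately show "v \<in> occupations m v_init 0" using xs(4) by (auto simp: occupations_def occupancy_def)
  next
    fix v assume v: "v \<in> occupations m v_init 0"
    define M where "M = (\<Sum>t<m. replicate_mset (v (t + p)) t)"
    define xs where "xs = rev (sorted_list_of_multiset M)"
    have "count_list xs t = count M t" for t
      unfolding xs_def count_mset[symmetric] by simp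
    moreover have "count M t = (if t < m then v (t + p) else 0)" for t
      unfolding M_def by (simp add: count_sum)
    ultimately have c: "count_list xs t = (if t < m then v (t + p) else 0)" for t by simp
    have s: "sorted_wrt (\<ge>) xs" unfolding xs_def by (simp add: sorted_wrt_rev)
    have set: "set xs \<subseteq> {..<m}"
      using c by (metis count_list_0_iff lessThan_iff subsetI)
    have o: "occupancy xs = v"
    proof
      fix i
      show "occupancy xs i = v i" using v p_pos by (auto simp: occupancy_def c occupations_def v_init_def)
    qed
    have "slot_conds xs" using v slot_conds_iff[OF s set m] unfolding o by (auto simp: occupations_def)
    then show "v \<in> occupancy ` slot_lists m" using s set o by (auto simp: slot_lists_def)
  qed
qed

lemma sweepsb_slot_lists:
  assumes T: "0 < T"
  shows "sweepsb q T (sites v_init 0 p) (r - 1) 0 = (\<Sum>xs\<in>slot_lists (T * p). \<Prod>x\<leftarrow>xs. wt x)"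
proof -
  have "1 * p \<le> T * p" using T by (intro mult_le_mono1) simp
  then have m: "l < T * p" using p_pos(2) by linarith
  have "sweepsb q T (sites v_init 0 p) (r - 1) 0 = (\<Sum>w\<in>occupations (T * p) v_init 0. \<Prod>i\<in>{0..<0 + T * p}. wt i ^ w (i + p))"
    using sweepsb_sites[of T v_init 0] unfolding slot_sum_eq_sum by simp
  also have "\<dots> = (\<Sum>xs\<in>slot_lists (T * p). \<Prod>i\<in>{0..<0 + T * p}. wt i ^ occupancy xs (i + p))"
    by (rule sum.reindex_bij_betw[OF occupancy_bij[OF m], symmetric])
  also have "\<dots> = (\<Sum>xs\<in>slot_lists (T * p). \<Prod>x\<leftarrow>xs. wt x)"
  proof (intro sum.cong refl)
    fix xs assume "xs \<in> slot_lists (T * p)"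
    then have "set xs \<subseteq> {0..<T * p}" by (auto simp: slot_lists_def)
    then have "(\<Prod>i\<in>{0..<T * p}. wt i ^ count_list xs i) = (\<Prod>x\<leftarrow>xs. wt x)"
    proof (induction xs)
      case (Cons x xs)
      have "(\<Prod>i\<in>{0..<T * p}. wt i ^ count_list (x # xs) i) = (\<Prod>i\<in>{0..<T * p}. wt i ^ count_list xs i * (if i = x then wt i else 1))"
        by (intro prod.cong) auto
      then show ?case using Cons by (simp add: prod.distrib prod.delta)
    qed simp
    then show "(\<Prod>i\<in>{0..<0 + T * p}. wt i ^ occupancy xs (i + p)) = (\<Prod>x\<leftarrow>xs. wt x)"
      by (simp add: occupancy_def)
  qed
  finally show ?thesis .
qed

lemma finite_slot_lists: "l < m \<Longrightarrow> finite (slot_lists m)"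
  by (rule bij_betw_finite[OF occupancy_bij, THEN iffD2, OF _ finite_occupations])

end

text \<open>The truncated coefficients stay below \<open>c\<close> and each is eventually exact. For
  nonnegative terms this justifies the interchange of the limit with the summation.\<close>

lemma sums_from_truncations:
  fixes c :: "nat \<Rightarrow> real"
  assumes b: "\<And>T n. 0 \<le> b T n" "\<And>T n. b T n \<le> c n" "\<And>T n. n < T \<Longrightarrow> b T n = c n"
    and S: "\<And>T. b T sums S T" "S \<longlonglongrightarrow> Z"
  shows "c sums Z"
proof -
  have c0: "0 \<le> c n" for n using b(1)[of "Suc n" n] b(3)[of n "Suc n"] by simp
  have part: "(\<Sum>n<M. c n) \<le> Z" for M
  proof (rule LIMSEQ_le_const[OF S(2)], intro exI allI impI)
    fix T assume "M \<le> T"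
    then have "(\<Sum>n<M. c n) = (\<Sum>n<M. b T n)" using b(3) by (intro sum.cong) auto
    also have "\<dots> \<le> S T" using S(1)[of T] b(1) by (metis sum_le_suminf sums_unique sums_summable finite_lessThan)
    finally show "(\<Sum>n<M. c n) \<le> S T" .
  qed
  have s: "summable c" using c0 part by (intro summableI_nonneg_bounded)
  have "suminf c \<le> Z" using part s by (intro suminf_le_const)
  moreover have "Z \<le> suminf c"
  proof (rule LIMSEQ_le_const2[OF S(2)], intro exI allI impI)
    fix T show "S T \<le> suminf c"
      using S(1)[of T] s b(2) suminf_le[of "b T" c] by (simp add: sums_iff)
  qed
  ultimately show ?thesis using s summable_sums by fastforce
qed

lemma sum_power_by_size:
  assumes "finite A"
  shows "(\<lambda>n. real (card {x \<in> A. f x = n}) * Q ^ n) sums (\<Sum>x\<in>A. Q ^ f x)"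
proof -
  have "(\<Sum>x\<in>A. Q ^ f x) = (\<Sum>n\<in>f ` A. \<Sum>x | x \<in> A \<and> f x = n. Q ^ f x)"
    by (rule sum.image_gen[OF assms])
  also have "\<dots> = (\<Sum>n\<in>f ` A. real (card {x \<in> A. f x = n}) * Q ^ n)"
    by (intro sum.cong refl) simp
  finally have e: "(\<Sum>x\<in>A. Q ^ f x) = (\<Sum>n\<in>f ` A. real (card {x \<in> A. f x = n}) * Q ^ n)" .
  have "real (card {x \<in> A. f x = n}) * Q ^ n = 0" if "n \<notin> f ` A" for n
  proof -
    have "{x \<in> A. f x = n} = {}" using that by auto
    then show ?thesis by (simp only: card.empty of_nat_0 mult_zero_left)
  qed
  then show ?thesis unfolding e using assms by (intro sums_finite) auto
qed

section \<open>The numbering of the possible parts by slots\<close>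

locale residues =
  fixes l \<eta> :: nat and \<alpha> :: "nat \<Rightarrow> nat"
  assumes eta: "0 < \<eta>" and alpha: "\<And>i. i \<in> {1..l} \<Longrightarrow> 0 < \<alpha> i \<and> \<alpha> i < \<eta>"
    and alpha_mono: "strict_mono_on {1..l} \<alpha>"
begin

text \<open>A period lists the overlined residues between two multiples of \<eta> and then the upper
  multiple, first plain, then overlined. Thus site \<open>l\<close> is the \<open>Bo\<close> site,
  and the \<open>Fm\<close> site after it has the same weight, which is what
  \<open>sweepsb_eq\<close> requires.\<close>

definition part_of :: "nat \<Rightarrow> part" where
  "part_of t = (let M = t div (l + 2); j = t mod (l + 2) in
     if j < l then Part (M * \<eta> + \<alpha> (j + 1)) True
     else if j = l then Part ((M + 1) * \<eta>) False else Part ((M + 1) * \<eta>) True)"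

lemma part_of_add: "j < l + 2 \<Longrightarrow> part_of (M * (l + 2) + j) =
   (if j < l then Part (M * \<eta> + \<alpha> (j + 1)) True
    else if j = l then Part ((M + 1) * \<eta>) False else Part ((M + 1) * \<eta>) True)"
proof -
  assume j: "j < l + 2"
  then have "(M * (l + 2) + j) mod (l + 2) = j" "(M * (l + 2) + j) div (l + 2) = M" by (simp_all del: add_2_eq_Suc')
  then show ?thesis unfolding part_of_def Let_def by (simp only:)
qed

lemma slot_cases:
  obtains M j where "t = M * (l + 2) + j" "j < l + 2"
  by (metis div_mod_decomp mod_less_divisor add_gr_0 zero_less_numeral)

lemma part_of_Suc: "part_of t < part_of (Suc t)"
proof -
  obtain M j where t: "t = M * (l + 2) + j" "j < l + 2" by (rule slot_cases)
  show ?thesis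
  proof (cases "j = l + 1")
    case True
    have "Suc t = (M + 1) * (l + 2) + 0" using t True by simp
    then have "part_of (Suc t) = (if 0 < l then Part ((M + 1) * \<eta> + \<alpha> (0 + 1)) True else Part ((M + 1 + 1) * \<eta>) False)"
      using part_of_add[of 0 "M + 1"] by auto
    moreover have "0 < l \<Longrightarrow> 0 < \<alpha> 1" using alpha[of 1] by auto
    ultimately show ?thesis using t True eta part_of_add[of j M] by (auto simp: less_part_def)
  next
    case False
    have "Suc t = M * (l + 2) + Suc j" using t by simp
    then have s: "part_of (Suc t) = (if Suc j < l then Part (M * \<eta> + \<alpha> (Suc j + 1)) True
      else if Suc j = l then Part ((M + 1) * \<eta>) False else Part ((M + 1) * \<eta>) True)"
      using part_of_add[of "Suc j" M] t False by simp
    have "\<alpha> (j + 1) < \<alpha> (Suc j + 1)" if "Suc j < l"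
      using strict_mono_onD[OF alpha_mono, of "j + 1" "Suc j + 1"] that by auto
    moreover have "\<alpha> (j + 1) < \<eta>" if "j < l" using alpha[of "j + 1"] that by auto
    ultimately show ?thesis unfolding s using t False part_of_add[of j M] by (auto simp: less_part_def)
  qed
qed

lemma part_of_mono: "strict_mono part_of"
  using part_of_Suc by (simp add: strict_mono_Suc_iff)

lemma part_of_le [simp]: "part_of x \<le> part_of y \<longleftrightarrow> x \<le> y"
  using part_of_mono by (rule strict_mono_less_eq)

lemma part_of_less [simp]: "part_of x < part_of y \<longleftrightarrow> x < y"
  using part_of_mono by (rule strict_mono_less)

lemma part_of_shift: "shift (part_of t) \<eta> = part_of (t + (l + 2))"
proof -
  obtain M j where t: "t = M * (l + 2) + j" "j < l + 2" by (rule slot_cases)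
  have "t + (l + 2) = (M + 1) * (l + 2) + j" using t by simp
  then show ?thesis using t part_of_add[of j M] part_of_add[of j "M + 1"] by (simp add: shift_def algebra_simps)
qed

lemma overlined_part_of: "overlined (part_of t) \<longleftrightarrow> t mod (l + 2) \<noteq> l"
  by (simp add: part_of_def Let_def)

lemma floor_part_of: "psize (part_of t) div \<eta> = (t + 2) div (l + 2)"
proof -
  obtain M j where t: "t = M * (l + 2) + j" "j < l + 2" by (rule slot_cases)
  have "\<alpha> (j + 1) < \<eta>" if "j < l" using alpha[of "j + 1"] that by auto
  then have "psize (part_of t) div \<eta> = (if j < l then M else M + 1)"
    using t part_of_add[of j M] eta by (auto simp: div_mult_self4)
  also have "\<dots> = (t + 2) div (l + 2)"
  proof (cases "j < l")
    case True
    have "(M * (l + 2) + (j + 2)) div (l + 2) = M" using True by (intro div_nat_eqI) (auto simp: algebra_simps)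
    then show ?thesis using True t by (simp add: add.assoc)
  next
    case False
    have "(M * (l + 2) + (j + 2)) div (l + 2) = M + 1" using False t by (intro div_nat_eqI) (auto simp: algebra_simps)
    then show ?thesis using False t by (simp add: add.assoc)
  qed
  finally show ?thesis .
qed

lemma psize_part_of: "0 < psize (part_of t)" "t div (l + 2) \<le> psize (part_of t)"
proof -
  obtain M j where t: "t = M * (l + 2) + j" "j < l + 2" by (rule slot_cases)
  have "M \<le> M * \<eta>" using eta by simp
  moreover have "0 < \<alpha> (j + 1)" if "j < l" using alpha[of "j + 1"] that by auto
  ultimately show "0 < psize (part_of t)" "t div (l + 2) \<le> psize (part_of t)"
    using t part_of_add[of j M] eta by (auto simp del: add_2_eq_Suc' add_2_eq_Suc mult_Suc_right intro: order.trans trans_le_add1 trans_le_add2)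
qed

lemma part_of_l: "part_of l = Part \<eta> False"
  using part_of_add[of l 0] by simp

lemma allowed_size_iff: "allowed_size l \<eta> \<alpha> m \<longleftrightarrow> m mod \<eta> = 0 \<or> (\<exists>i\<in>{1..l}. m mod \<eta> = \<alpha> i)"
  using alpha by (auto simp: allowed_size_def cong_def)

lemma allowed_part_of:
  "allowed_size l \<eta> \<alpha> (psize (part_of t))" "\<not> overlined (part_of t) \<Longrightarrow> \<eta> dvd psize (part_of t)"
proof -
  obtain M j where t: "t = M * (l + 2) + j" "j < l + 2" by (rule slot_cases)
  have "\<alpha> (j + 1) < \<eta>" if "j < l" using alpha[of "j + 1"] that by auto
  then have "psize (part_of t) mod \<eta> = (if j < l then \<alpha> (j + 1) else 0)"
    using t part_of_add[of j M] by auto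
  then show "allowed_size l \<eta> \<alpha> (psize (part_of t))" unfolding allowed_size_iff by (cases "j < l") auto
  show "\<eta> dvd psize (part_of t)" if "\<not> overlined (part_of t)"
    using that t part_of_add[of j M] by (auto split: if_splits)
qed

lemma part_of_surj:
  assumes "0 < psize x" "allowed_size l \<eta> \<alpha> (psize x)" "\<not> overlined x \<Longrightarrow> \<eta> dvd psize x"
  shows "x \<in> range part_of"
proof -
  define s where "s = psize x"
  define M where "M = s div \<eta>"
  have s: "s = M * \<eta> + s mod \<eta>" by (simp add: M_def)
  show ?thesis
  proof (cases "s mod \<eta> = 0")
    case True
    then have sM: "s = M * \<eta>" "0 < M" using s assms(1) by (auto simp: s_def)
    then have M: "M = (M - 1) + 1" by simp
    show ?thesis
    proof (cases "overlined x")
      case True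
      have "x = part_of ((M - 1) * (l + 2) + (l + 1))"
        using part_of_add[of "l + 1" "M - 1"] sM M True by (intro part.expand) (simp add: s_def[symmetric])
      then show ?thesis by blast
    next
      case False
      have "x = part_of ((M - 1) * (l + 2) + l)"
        using part_of_add[of l "M - 1"] sM M False by (intro part.expand) (simp add: s_def[symmetric])
      then show ?thesis by blast
    qed
  next
    case False
    then obtain i where i: "i \<in> {1..l}" "s mod \<eta> = \<alpha> i"
      using assms(2) unfolding allowed_size_iff s_def by auto
    have "overlined x" using False assms(3) unfolding s_def by (metis dvd_eq_mod_eq_0)
    then have "x = part_of (M * (l + 2) + (i - 1))"
      using part_of_add[of "i - 1" M] s i by (intro part.expand) (auto simp: s_def[symmetric])
    then show ?thesis by blast
  qed
qed

end

section \<open>The generating function of \<open>B0\<close>\<close>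

locale B0_model = residues +
  fixes k r :: nat and Q :: real
  assumes r: "1 \<le> r" "r \<le> k" "l \<le> r" and k: "l + 1 < k" and Q: "0 < Q" "Q < 1"
begin

definition wt :: "nat \<Rightarrow> real" where "wt t = Q ^ psize (part_of t)"

sublocale slots l k r wt "Q ^ \<eta>"
proof
  fix n
  have "psize (part_of (n + (l + 2))) = \<eta> + psize (part_of n)"
    unfolding part_of_shift[symmetric] by (simp add: shift_def)
  then show "wt (n + (l + 2)) = Q ^ \<eta> * wt n" by (simp add: wt_def power_add)
qed (use r k in auto)

definition weight :: "nat list \<Rightarrow> nat" where "weight xs = (\<Sum>x\<leftarrow>xs. psize (part_of x))"

lemma count_map_part_of: "count_list (map part_of xs) (part_of t) = count_list xs t"
  using strict_mono_eq[OF part_of_mono] by (induction xs) auto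

text \<open>\<open>part_of\<close> is an order isomorphism onto the possible parts that turns a
  shift by \<eta> into a shift by one period and preserves the quotients, so the conditions can be
  translated one by one.\<close>

lemma B0_set_eq:
  "B0_set l \<alpha> \<eta> k r n = map part_of ` {xs. sorted_wrt (\<ge>) xs \<and> slot_conds xs \<and> weight xs = n}"
proof -
  have iff: "map part_of xs \<in> B0_set l \<alpha> \<eta> k r n \<longleftrightarrow> sorted_wrt (\<ge>) xs \<and> slot_conds xs \<and> weight xs = n" for xs
  proof -
    have 1: "sorted_wrt (\<ge>) (map part_of xs) \<longleftrightarrow> sorted_wrt (\<ge>) xs"
      by (simp add: sorted_wrt_map)
    have 2: "(\<forall>m. count_list (map part_of xs) (Part m True) \<le> 1) \<longleftrightarrow> (\<forall>t. \<not> bosonic t \<longrightarrow> count_list xs t \<le> 1)"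
    proof (intro iffI allI impI)
      fix t assume a: "\<forall>m. count_list (map part_of xs) (Part m True) \<le> 1" and t: "\<not> bosonic t"
      have "part_of t = Part (psize (part_of t)) True"
        using t by (intro part.expand) (simp add: overlined_part_of bosonic_def p_def)
      then show "count_list xs t \<le> 1" using a by (metis count_map_part_of)
    next
      fix m assume a: "\<forall>t. \<not> bosonic t \<longrightarrow> count_list xs t \<le> 1"
      show "count_list (map part_of xs) (Part m True) \<le> 1"
      proof (cases "Part m True \<in> range part_of")
        case True
        then obtain t where t: "Part m True = part_of t" by blast
        have "overlined (part_of t)" unfolding t[symmetric] by simp
        then have "\<not> bosonic t" by (simp add: overlined_part_of bosonic_def p_def)
        then show ?thesis unfolding t count_map_part_of using a by simp
      next
        case False
        then have "Part m True \<notin> set (map part_of xs)" by auto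
        then have "count_list (map part_of xs) (Part m True) = 0" by (rule count_notin)
        then show ?thesis by linarith
      qed
    qed
    have 3: "(\<forall>i. i + k - 1 < length (map part_of xs) \<longrightarrow>
        map part_of xs ! i \<ge> shift (map part_of xs ! (i + k - 1)) \<eta> \<and>
        (\<not> overlined (map part_of xs ! i) \<longrightarrow> map part_of xs ! i > shift (map part_of xs ! (i + k - 1)) \<eta>))
      \<longleftrightarrow> (\<forall>i. i + k - 1 < length xs \<longrightarrow> xs ! (i + k - 1) + window_len (xs ! i) \<le> xs ! i)"
      unfolding length_map
    proof (intro all_cong1 imp_cong refl)
      fix i assume i: "i + k - 1 < length xs"
      then have "i < length xs" using k by linarith
      then show "(map part_of xs ! i \<ge> shift (map part_of xs ! (i + k - 1)) \<eta> \<and>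
        (\<not> overlined (map part_of xs ! i) \<longrightarrow> map part_of xs ! i > shift (map part_of xs ! (i + k - 1)) \<eta>))
        \<longleftrightarrow> xs ! (i + k - 1) + window_len (xs ! i) \<le> xs ! i"
        using i by (auto simp: part_of_shift overlined_part_of window_len_def bosonic_def p_def)
    qed
    have 4: "int (length (filter (\<lambda>p. p \<le> Part \<eta> False) (map part_of xs))) \<le> int r - 1
      \<longleftrightarrow> length (filter (\<lambda>x. x \<le> l) xs) \<le> r - 1"
      unfolding part_of_l[symmetric] filter_map o_def using r by (simp add: of_nat_diff[symmetric]) linarith
    have 5: "(\<forall>i. i + k - 2 < length (map part_of xs) \<and>
          map part_of xs ! i \<le> shift (map part_of xs ! (i + k - 2)) \<eta> \<and>
          (overlined (map part_of xs ! i) \<longrightarrow> map part_of xs ! i < shift (map part_of xs ! (i + k - 2)) \<eta>) \<longrightarrow>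
        [int (\<Sum>j = i..i + k - 2. psize (map part_of xs ! j) div \<eta>)
           = int r - 1 + int (overlined_upto (map part_of xs) (map part_of xs ! i))] (mod 2))
      \<longleftrightarrow> (\<forall>i. i + k - 2 < length xs \<and> xs ! i < xs ! (i + k - 2) + window_len (xs ! i) \<longrightarrow>
        even (int (\<Sum>j = i..i + k - 2. (xs ! j + 2) div p)
          - int (length (filter (\<lambda>x. \<not> bosonic x \<and> x \<le> xs ! i) xs)) - (int r - 1)))"
    proof (intro all_cong1)
      fix i
      show "(i + k - 2 < length (map part_of xs) \<and>
          map part_of xs ! i \<le> shift (map part_of xs ! (i + k - 2)) \<eta> \<and>
          (overlined (map part_of xs ! i) \<longrightarrow> map part_of xs ! i < shift (map part_of xs ! (i + k - 2)) \<eta>) \<longrightarrow>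
        [int (\<Sum>j = i..i + k - 2. psize (map part_of xs ! j) div \<eta>)
           = int r - 1 + int (overlined_upto (map part_of xs) (map part_of xs ! i))] (mod 2))
       \<longleftrightarrow> (i + k - 2 < length xs \<and> xs ! i < xs ! (i + k - 2) + window_len (xs ! i) \<longrightarrow>
        even (int (\<Sum>j = i..i + k - 2. (xs ! j + 2) div p)
          - int (length (filter (\<lambda>x. \<not> bosonic x \<and> x \<le> xs ! i) xs)) - (int r - 1)))"
      proof (cases "i + k - 2 < length xs")
        case len: True
        then have i: "i < length xs" using k by linarith
        have c: "(map part_of xs ! i \<le> shift (map part_of xs ! (i + k - 2)) \<eta> \<and>
          (overlined (map part_of xs ! i) \<longrightarrow> map part_of xs ! i < shift (map part_of xs ! (i + k - 2)) \<eta>))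
          \<longleftrightarrow> xs ! i < xs ! (i + k - 2) + window_len (xs ! i)"
          using i len by (auto simp: part_of_shift overlined_part_of window_len_def bosonic_def p_def)
        have s: "(\<Sum>j = i..i + k - 2. psize (map part_of xs ! j) div \<eta>) = (\<Sum>j = i..i + k - 2. (xs ! j + 2) div p)"
          using len by (intro sum.cong refl) (simp add: floor_part_of p_def del: add_2_eq_Suc')
        have o: "overlined_upto (map part_of xs) (map part_of xs ! i) = length (filter (\<lambda>x. \<not> bosonic x \<and> x \<le> xs ! i) xs)"
          unfolding overlined_upto_def filter_map o_def using i by (simp add: overlined_part_of bosonic_def p_def)
        show ?thesis unfolding s o using c len by (auto simp: cong_iff_dvd_diff algebra_simps)
      qed simp
    qed
    have 6: "(\<forall>p\<in>set (map part_of xs). 0 < psize p)" "(\<forall>p\<in>set (map part_of xs). allowed_size l \<eta> \<alpha> (psize p))"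
      "(\<forall>p\<in>set (map part_of xs). \<not> overlined p \<longrightarrow> \<eta> dvd psize p)"
      using psize_part_of allowed_part_of by auto
    have 7: "sum_list (map psize (map part_of xs)) = weight xs" by (simp add: weight_def o_def)
    show ?thesis
      unfolding B0_set_def overpartitions_def mem_Collect_eq 1 2 3 4 5 7 slot_conds_def using 6 by blast
  qed
  moreover have "\<exists>xs. \<pi> = map part_of xs" if "\<pi> \<in> B0_set l \<alpha> \<eta> k r n" for \<pi>
  proof -
    have "set \<pi> \<subseteq> range part_of"
      using that by (auto simp: B0_set_def overpartitions_def intro!: part_of_surj)
    then have "\<pi> \<in> lists (range part_of)" by auto
    then show ?thesis unfolding lists_image by auto
  qed
  ultimately show ?thesis by blast
qed

lemma inj_map_part_of: "inj (map part_of)"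
  using part_of_mono by (simp add: strict_mono_imp_inj_on)

lemma weight_set_bound: "x \<in> set xs \<Longrightarrow> x < (weight xs + 1) * p"
proof -
  assume "x \<in> set xs"
  then have "psize (part_of x) \<le> weight xs" unfolding weight_def by (intro member_le_sum_list) auto
  then have "x div p \<le> weight xs" using psize_part_of(2)[of x] by (simp add: p_def)
  then have "x div p < weight xs + 1" by simp
  then show ?thesis using p_pos by (simp add: div_less_iff_less_mult)
qed

text \<open>A slot of index at least \<open>(n + 1) * p\<close> has size greater than
  \<open>n\<close>, so the coefficient of index \<open>n\<close> is exact once \<open>n + 1\<close>
  periods are available.\<close>

lemma B0_truncation:
  shows "card {xs \<in> slot_lists (Suc T * p). weight xs = n} \<le> B0 l \<alpha> \<eta> k r n"
    and "n < Suc T \<Longrightarrow> card {xs \<in> slot_lists (Suc T * p). weight xs = n} = B0 l \<alpha> \<eta> k r n"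
proof -
  define A where "A = {xs. sorted_wrt (\<ge>) xs \<and> slot_conds xs \<and> weight xs = n}"
  have B: "B0 l \<alpha> \<eta> k r n = card A"
    unfolding B0_def B0_set_eq A_def[symmetric]
    by (rule card_image) (rule inj_on_subset[OF inj_map_part_of subset_UNIV])
  have eq: "{xs \<in> slot_lists (Suc m * p). weight xs = n} = A" if "n < Suc m" for m
  proof -
    have "set xs \<subseteq> {..<Suc m * p}" if xs: "weight xs = n" for xs
    proof
      fix x assume "x \<in> set xs"
      then have "x < (n + 1) * p" using weight_set_bound xs by blast
      also have "\<dots> \<le> Suc m * p" using \<open>n < Suc m\<close> by (intro mult_le_mono1) simp
      finally show "x \<in> {..<Suc m * p}" by simp
    qed
    then show ?thesis unfolding A_def slot_lists_def by blast
  qed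
  have fin: "finite (slot_lists (Suc m * p))" for m
    using p_pos by (intro finite_slot_lists) simp
  have finA: "finite A" unfolding eq[of n, symmetric, OF lessI] using fin by simp
  show "card {xs \<in> slot_lists (Suc T * p). weight xs = n} \<le> B0 l \<alpha> \<eta> k r n"
    unfolding B by (intro card_mono finA) (auto simp: slot_lists_def A_def)
  show "card {xs \<in> slot_lists (Suc T * p). weight xs = n} = B0 l \<alpha> \<eta> k r n" if "n < Suc T"
    unfolding B using eq[OF that] by simp
qed

lemma B0_sums:
  assumes "(\<lambda>T. sweepsb (Q ^ \<eta>) T (sites v_init 0 p) (r - 1) 0) \<longlonglongrightarrow> Z"
  shows "(\<lambda>n. real (B0 l \<alpha> \<eta> k r n) * Q ^ n) sums Z"
proof (rule sums_from_truncations)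
  show "(\<lambda>n. real (card {xs \<in> slot_lists (Suc T * p). weight xs = n}) * Q ^ n) sums sweepsb (Q ^ \<eta>) (Suc T) (sites v_init 0 p) (r - 1) 0" for T
  proof -
    have "(\<Prod>x\<leftarrow>xs. wt x) = Q ^ weight xs" for xs
      unfolding weight_def wt_def by (induction xs) (auto simp: power_add)
    then have "sweepsb (Q ^ \<eta>) (Suc T) (sites v_init 0 p) (r - 1) 0 = (\<Sum>xs\<in>slot_lists (Suc T * p). Q ^ weight xs)"
      by (subst sweepsb_slot_lists) auto
    then show ?thesis using p_pos by (simp only: sum_power_by_size finite_slot_lists trans_less_add1 mult_Suc)
  qed
  show "(\<lambda>T. sweepsb (Q ^ \<eta>) (Suc T) (sites v_init 0 p) (r - 1) 0) \<longlonglongrightarrow> Z"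
    using assms by (rule LIMSEQ_Suc)
qed (use B0_truncation Q in \<open>auto intro!: mult_right_mono simp del: mult_Suc\<close>)

lemma sites_v_init:
  "sites v_init 0 p = fms (map (\<lambda>i. Q ^ \<alpha> (i + 1)) [0..<l]) @ [Bo (Q ^ \<eta>) (k - r), Fm (Q ^ \<eta>) 0]"
proof -
  have "sites v_init 0 p = map (\<lambda>i. mk_site i (v_init i)) [0..<l] @ [mk_site l (v_init l), mk_site (Suc l) (v_init (Suc l))]"
    by (simp add: sites_def p_def)
  moreover have "map (\<lambda>i. mk_site i (v_init i)) [0..<l] = fms (map (\<lambda>i. Q ^ \<alpha> (i + 1)) [0..<l])"
    unfolding fms_def map_map
    by (intro map_cong refl) (auto simp: mk_site_def bosonic_def p_def v_init_def wt_def part_of_add[of _ 0, simplified])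
  moreover have "mk_site l (v_init l) = Bo (Q ^ \<eta>) (k - r)"
    by (simp add: mk_site_def bosonic_def p_def v_init_def wt_def part_of_l)
  moreover have "mk_site (Suc l) (v_init (Suc l)) = Fm (Q ^ \<eta>) 0"
    using part_of_add[of "Suc l" 0] by (simp add: mk_site_def bosonic_def p_def v_init_def wt_def)
  ultimately show ?thesis by simp
qed

end

section \<open>Generating functions of overpartitions with restricted parts\<close>

definition overpartitions_in :: "(part \<Rightarrow> bool) \<Rightarrow> nat \<Rightarrow> part list set" where
  "overpartitions_in P n = {\<pi> \<in> overpartitions n. \<forall>p\<in>set \<pi>. P p}"

lemma finite_overpartitions: "finite (overpartitions n)"
proof (rule finite_subset)
  let ?S = "(\<lambda>(m, b). Part m b) ` ({..n} \<times> UNIV)"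
  show "overpartitions n \<subseteq> {xs. set xs \<subseteq> ?S \<and> length xs \<le> n}"
  proof
    fix \<pi> assume "\<pi> \<in> overpartitions n"
    then have pos: "\<And>p. p \<in> set \<pi> \<Longrightarrow> 0 < psize p" and s: "sum_list (map psize \<pi>) = n"
      by (auto simp: overpartitions_def)
    have "p \<in> ?S" if "p \<in> set \<pi>" for p
    proof -
      have "psize p \<le> n" unfolding s[symmetric] using that by (intro member_le_sum_list) auto
      then show ?thesis by (intro image_eqI[of _ _ "(psize p, overlined p)"]) auto
    qed
    moreover have "length \<pi> \<le> sum_list (map psize \<pi>)"
      using pos
    proof (induction \<pi>)
      case (Cons p \<pi>)
      then have "length \<pi> \<le> sum_list (map psize \<pi>)" "0 < psize p" by auto
      then show ?case by simp
    qed simp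
    ultimately show "\<pi> \<in> {xs. set xs \<subseteq> ?S \<and> length xs \<le> n}" using s by auto
  qed
  show "finite {xs. set xs \<subseteq> ?S \<and> length xs \<le> n}" by (intro finite_lists_length_le) auto
qed

lemma psize_le_total: "\<pi> \<in> overpartitions n \<Longrightarrow> p \<in> set \<pi> \<Longrightarrow> psize p \<le> n"
  by (auto simp: overpartitions_def intro!: member_le_sum_list)

lemma finite_overpartitions_in [simp]: "finite (overpartitions_in P n)"
  using finite_overpartitions by (simp add: overpartitions_in_def)

lemma Cons_in_overpartitions_in:
  "x # \<pi> \<in> overpartitions_in P n \<longleftrightarrow> P x \<and> 0 < psize x \<and> psize x \<le> n \<and> (\<forall>p\<in>set \<pi>. p \<le> x)
     \<and> (overlined x \<longrightarrow> x \<notin> set \<pi>) \<and> \<pi> \<in> overpartitions_in P (n - psize x)"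
proof -
  have "(\<forall>m. count_list (x # \<pi>) (Part m True) \<le> 1) \<longleftrightarrow>
    (overlined x \<longrightarrow> x \<notin> set \<pi>) \<and> (\<forall>m. count_list \<pi> (Part m True) \<le> 1)" (is "?L \<longleftrightarrow> ?R")
  proof
    assume L: ?L
    have "count_list \<pi> (Part m True) \<le> 1" for m using L[rule_format, of m] by (simp split: if_splits)
    moreover have "x \<notin> set \<pi>" if "overlined x"
    proof -
      have x: "x = Part (psize x) True" using that by (intro part.expand) simp
      then have "count_list (x # \<pi>) x \<le> 1" using L by metis
      then show ?thesis by (simp add: count_list_0_iff)
    qed
    ultimately show ?R by blast
  next
    assume R: ?R
    show ?L
    proof
      fix m
      show "count_list (x # \<pi>) (Part m True) \<le> 1"
        using R by (cases "x = Part m True") (auto simp: count_notin)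
    qed
  qed
  moreover have "sum_list (map psize (x # \<pi>)) = n \<longleftrightarrow> psize x \<le> n \<and> sum_list (map psize \<pi>) = n - psize x"
    by auto
  ultimately show ?thesis
    unfolding overpartitions_in_def overpartitions_def mem_Collect_eq sorted_wrt.simps list.set ball_simps
    by (simp only: conj_ac)
qed

text \<open>As \<open>x\<close> exceeds all parts in \<open>P\<close>, it can only occur at the
  head. Removing the head leaves parts in \<open>P\<close> if \<open>x\<close> is overlined and
  cannot recur, and parts in \<open>P'\<close> otherwise.\<close>

lemma overpartitions_in_insert:
  assumes x: "\<not> P x" "0 < psize x" and less: "\<And>p. P p \<Longrightarrow> p < x"
  defines "P' \<equiv> \<lambda>p. p = x \<or> P p"
  defines "R \<equiv> if overlined x then P else P'"
  shows "card (overpartitions_in P' n) = card (overpartitions_in P n) +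
    (if psize x \<le> n then card (overpartitions_in R (n - psize x)) else 0)"
proof -
  define B where "B = (if psize x \<le> n then Cons x ` overpartitions_in R (n - psize x) else {})"
  have "overpartitions_in P' n = overpartitions_in P n \<union> B"
  proof (intro set_eqI)
    fix \<pi>
    show "\<pi> \<in> overpartitions_in P' n \<longleftrightarrow> \<pi> \<in> overpartitions_in P n \<union> B"
    proof (cases "\<exists>\<rho>. \<pi> = x # \<rho>")
      case True
      then obtain \<rho> where \<rho>: "\<pi> = x # \<rho>" by blast
      have "\<pi> \<notin> overpartitions_in P n" using x unfolding \<rho> Cons_in_overpartitions_in by simp
      moreover have "\<pi> \<in> B \<longleftrightarrow> psize x \<le> n \<and> \<rho> \<in> overpartitions_in R (n - psize x)"
        unfolding \<rho> B_def by auto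
      moreover have "(\<forall>p\<in>set \<rho>. p \<le> x) \<and> (overlined x \<longrightarrow> x \<notin> set \<rho>) \<and> \<rho> \<in> overpartitions_in P' m
        \<longleftrightarrow> \<rho> \<in> overpartitions_in R m" for m
      proof -
        have "P p \<Longrightarrow> p \<le> x" for p using less[of p] by simp
        then show ?thesis using x unfolding R_def P'_def overpartitions_in_def by auto
      qed
      moreover have "P' x" by (simp add: P'_def)
      ultimately show ?thesis using x(2) unfolding \<rho> Cons_in_overpartitions_in[of x \<rho> P'] Un_iff by blast
    next
      case False
      have "x \<notin> set \<pi>" if "\<pi> \<in> overpartitions_in P' n"
      proof
        assume in\<pi>: "x \<in> set \<pi>"
        then obtain y \<rho> where y: "\<pi> = y # \<rho>" by (cases \<pi>) auto
        then have "x \<le> y" "P' y" using in\<pi> that by (auto simp: overpartitions_in_def overpartitions_def)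
        then have "y = x" using less[of y] unfolding P'_def by auto
        then show False using False y by simp
      qed
      then show ?thesis using False by (auto simp: overpartitions_in_def P'_def B_def)
    qed
  qed
  moreover have "overpartitions_in P n \<inter> B = {}"
    using x unfolding B_def by (auto simp: Cons_in_overpartitions_in)
  moreover have "card B = (if psize x \<le> n then card (overpartitions_in R (n - psize x)) else 0)"
    unfolding B_def by (simp add: card_image)
  moreover have "finite B" unfolding B_def by simp
  ultimately show ?thesis by (simp add: card_Un_disjoint)
qed

lemma sums_shift:
  fixes c :: "nat \<Rightarrow> real"
  assumes "(\<lambda>n. c n * Q ^ n) sums Z"
  shows "(\<lambda>n. (if m \<le> n then c (n - m) else 0) * Q ^ n) sums (Z * Q ^ m)"
proof -
  have "(\<lambda>n. c n * Q ^ n * Q ^ m) sums (Z * Q ^ m)" using assms by (rule sums_mult2)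
  then have "(\<lambda>n. (if m \<le> n + m then c (n + m - m) else 0) * Q ^ (n + m)) sums (Z * Q ^ m)"
    by (simp add: power_add mult.assoc)
  then show ?thesis by (subst (asm) sums_zero_iff_shift) auto
qed

text \<open>Summability of the second series has to come first: the recurrence bounds its partial
  sums. Only then can it be solved for the limit.\<close>

lemma sums_recurrence:
  fixes c d :: "nat \<Rightarrow> real"
  assumes c: "(\<lambda>n. c n * Q ^ n) sums Z" and c0: "\<And>n. 0 \<le> c n" and d0: "\<And>n. 0 \<le> d n"
    and Q: "0 < Q" "Q < 1" and m: "0 < m"
    and d: "\<And>n. d n = c n + (if m \<le> n then d (n - m) else 0)"
  shows "(\<lambda>n. d n * Q ^ n) sums (Z / (1 - Q ^ m))"
proof -
  have qm: "Q ^ m < 1" using Q m by (simp add: power_less_one_iff)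
  have dQ: "d n * Q ^ n = c n * Q ^ n + (if m \<le> n then d (n - m) else 0) * Q ^ n" for n
    by (subst d[of n]) (simp only: distrib_right)
  have bound: "(\<Sum>n<M. d n * Q ^ n) \<le> Z / (1 - Q ^ m)" for M
  proof -
    have "(\<Sum>n<M. (if m \<le> n then d (n - m) else 0) * Q ^ n) = (\<Sum>n\<in>{m..<M}. d (n - m) * Q ^ n)"
      by (intro sum.mono_neutral_cong_right) auto
    also have "\<dots> = (\<Sum>n<M - m. d n * Q ^ (n + m))"
      by (rule sum.reindex_bij_witness[of _ "\<lambda>n. n + m" "\<lambda>n. n - m"]) auto
    also have "\<dots> \<le> (\<Sum>n<M. d n * Q ^ (n + m))"
      using d0 Q by (intro sum_mono2) auto
    also have "\<dots> = Q ^ m * (\<Sum>n<M. d n * Q ^ n)" by (simp add: sum_distrib_left power_add mult_ac)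
    finally have "(\<Sum>n<M. (if m \<le> n then d (n - m) else 0) * Q ^ n) \<le> Q ^ m * (\<Sum>n<M. d n * Q ^ n)" .
    moreover have "(\<Sum>n<M. c n * Q ^ n) \<le> Z"
      using sum_le_suminf[OF sums_summable[OF c], of "{..<M}"] sums_unique[OF c] c0 Q by simp
    moreover have "(\<Sum>n<M. d n * Q ^ n) = (\<Sum>n<M. c n * Q ^ n) + (\<Sum>n<M. (if m \<le> n then d (n - m) else 0) * Q ^ n)"
      unfolding sum.distrib[symmetric] by (intro sum.cong refl dQ)
    ultimately have "(\<Sum>n<M. d n * Q ^ n) * (1 - Q ^ m) \<le> Z" by (simp add: algebra_simps)
    then show ?thesis using qm by (simp add: pos_le_divide_eq)
  qed
  have "summable (\<lambda>n. d n * Q ^ n)"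
    using bound d0 Q by (intro summableI_nonneg_bounded) auto
  then obtain W where W: "(\<lambda>n. d n * Q ^ n) sums W" by (auto simp: summable_def)
  have "(\<lambda>n. c n * Q ^ n + (if m \<le> n then d (n - m) else 0) * Q ^ n) sums (Z + W * Q ^ m)"
    by (intro sums_add c sums_shift W)
  then have "W = Z + W * Q ^ m" using W unfolding dQ[symmetric] by (intro sums_unique2)
  then have "W = Z / (1 - Q ^ m)" using qm by (simp add: field_simps)
  then show ?thesis using W by simp
qed

text \<open>The two parts of size \<open>Suc N\<close> are inserted in increasing order, plain
  before overlined, as \<open>overpartitions_in_insert\<close> requires; they contribute a geometric
  series and a single factor.\<close>

lemma overpartitions_in_bounded_sums:
  assumes Q: "0 < Q" "Q < (1::real)"
  shows "(\<lambda>n. real (card (overpartitions_in (\<lambda>p. psize p \<le> N \<and> P p) n)) * Q ^ n) sums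
    (\<Prod>m<N. (if P (Part (Suc m) True) then 1 + Q ^ Suc m else 1) /
            (if P (Part (Suc m) False) then 1 - Q ^ Suc m else 1))"
proof (induction N)
  case 0
  have "overpartitions_in (\<lambda>p. psize p \<le> 0 \<and> P p) n = (if n = 0 then {[]} else {})" for n
  proof (intro set_eqI)
    fix \<pi> show "\<pi> \<in> overpartitions_in (\<lambda>p. psize p \<le> 0 \<and> P p) n \<longleftrightarrow> \<pi> \<in> (if n = 0 then {[]} else {})"
      by (cases \<pi>) (auto simp: overpartitions_in_def overpartitions_def)
  qed
  then have "(\<lambda>n. real (card (overpartitions_in (\<lambda>p. psize p \<le> 0 \<and> P p) n)) * Q ^ n) =
    (\<lambda>n. if n = 0 then 1 else 0)" by auto
  then show ?case using sums_single[of 0 "\<lambda>_. 1::real"] by simp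
next
  case (Suc N)
  define P0 where "P0 = (\<lambda>p. psize p \<le> N \<and> P p)"
  define x where "x = Part (Suc N) False"
  define y where "y = Part (Suc N) True"
  define P1 where "P1 = (\<lambda>p. (p = x \<and> P x) \<or> P0 p)"
  define Z where "Z = (\<Prod>m<N. (if P (Part (Suc m) True) then 1 + Q ^ Suc m else 1) /
            (if P (Part (Suc m) False) then 1 - Q ^ Suc m else 1))"
  define Z1 where "Z1 = Z / (if P x then 1 - Q ^ Suc N else 1)"
  have 0: "(\<lambda>n. real (card (overpartitions_in P0 n)) * Q ^ n) sums Z"
    using Suc unfolding P0_def Z_def .
  have 1: "(\<lambda>n. real (card (overpartitions_in P1 n)) * Q ^ n) sums Z1"
  proof (cases "P x")
    case True
    have P1: "P1 = (\<lambda>p. p = x \<or> P0 p)" using True by (auto simp: P1_def)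
    have e: "card (overpartitions_in P1 n) = card (overpartitions_in P0 n) +
      (if Suc N \<le> n then card (overpartitions_in P1 (n - Suc N)) else 0)" for n
      unfolding P1 by (subst overpartitions_in_insert) (auto simp: P0_def x_def less_part_def)
    have "real (card (overpartitions_in P1 n)) = real (card (overpartitions_in P0 n)) +
      (if Suc N \<le> n then real (card (overpartitions_in P1 (n - Suc N))) else 0)" for n
      by (subst e[of n]) simp
    from sums_recurrence[OF 0 _ _ Q _ this] show ?thesis unfolding Z1_def if_P[OF True] by simp
  next
    case False
    then have "P1 = P0" by (auto simp: P1_def)
    then show ?thesis using 0 False by (simp add: Z1_def)
  qed
  have P2: "(\<lambda>p. psize p \<le> Suc N \<and> P p) = (\<lambda>p. (p = y \<and> P y) \<or> P1 p)"
  proof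
    fix p show "(psize p \<le> Suc N \<and> P p) = ((p = y \<and> P y) \<or> P1 p)"
      by (cases p; cases "overlined p") (auto simp: P1_def P0_def x_def y_def le_Suc_eq)
  qed
  have 2: "(\<lambda>n. real (card (overpartitions_in (\<lambda>p. psize p \<le> Suc N \<and> P p) n)) * Q ^ n) sums
    (Z1 * (if P y then 1 + Q ^ Suc N else 1))"
  proof (cases "P y")
    case True
    then have P2': "(\<lambda>p. psize p \<le> Suc N \<and> P p) = (\<lambda>p. p = y \<or> P1 p)" unfolding P2 by auto
    have "card (overpartitions_in (\<lambda>p. p = y \<or> P1 p) n) = card (overpartitions_in P1 n) +
      (if Suc N \<le> n then card (overpartitions_in P1 (n - Suc N)) else 0)" for n
      by (subst overpartitions_in_insert) (auto simp: P1_def P0_def x_def y_def less_part_def)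
    then have "real (card (overpartitions_in (\<lambda>p. p = y \<or> P1 p) n)) * Q ^ n = real (card (overpartitions_in P1 n)) * Q ^ n +
      (if Suc N \<le> n then real (card (overpartitions_in P1 (n - Suc N))) else 0) * Q ^ n" for n
      by (simp add: distrib_right)
    moreover have "Z1 * (1 + Q ^ Suc N) = Z1 + Z1 * Q ^ Suc N" by (simp add: algebra_simps)
    ultimately show ?thesis unfolding P2' if_P[OF True] by (simp only:) (intro sums_add 1 sums_shift)
  next
    case False
    then show ?thesis using 1 unfolding P2 by simp
  qed
  have "Z1 * (if P y then 1 + Q ^ Suc N else 1) = (\<Prod>m<Suc N. (if P (Part (Suc m) True) then 1 + Q ^ Suc m else 1) /
            (if P (Part (Suc m) False) then 1 - Q ^ Suc m else 1))"
    unfolding prod.lessThan_Suc Z_def[symmetric] Z1_def x_def y_def by simp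
  then show ?case using 2 by simp
qed

text \<open>The free bound \<open>f T\<close> on the part sizes allows the products to be cut at
  multiples of their period.\<close>

lemma overpartitions_in_sums:
  assumes Q: "0 < Q" "Q < (1::real)" and f: "\<And>T. T \<le> f T"
    and lim: "(\<lambda>T. \<Prod>m<f T. (if P (Part (Suc m) True) then 1 + Q ^ Suc m else 1) /
            (if P (Part (Suc m) False) then 1 - Q ^ Suc m else 1)) \<longlonglongrightarrow> Z"
  shows "(\<lambda>n. real (card (overpartitions_in P n)) * Q ^ n) sums Z"
proof (rule sums_from_truncations)
  let ?b = "\<lambda>T n. overpartitions_in (\<lambda>p. psize p \<le> f T \<and> P p) n"
  show "(\<lambda>n. real (card (?b T n)) * Q ^ n) sums
    (\<Prod>m<f T. (if P (Part (Suc m) True) then 1 + Q ^ Suc m else 1) /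
            (if P (Part (Suc m) False) then 1 - Q ^ Suc m else 1))" for T
    by (rule overpartitions_in_bounded_sums[OF Q])
  show "real (card (?b T n)) * Q ^ n \<le> real (card (overpartitions_in P n)) * Q ^ n" for T n
    using Q by (intro mult_right_mono of_nat_mono card_mono) (auto simp: overpartitions_in_def finite_overpartitions)
  show "real (card (?b T n)) * Q ^ n = real (card (overpartitions_in P n)) * Q ^ n" if "n < T" for T n
  proof -
    have "?b T n = overpartitions_in P n"
      using psize_le_total[of _ n] f[of T] that by (fastforce simp: overpartitions_in_def)
    then show ?thesis by simp
  qed
qed (use Q lim in auto)

section \<open>Infinite products over residue classes\<close>

lemma prod_blocks:
  fixes G :: "nat \<Rightarrow> 'a::comm_monoid_mult"
  assumes R: "R \<subseteq> {1..b}" and one: "\<And>j s. s \<in> {1..b} - R \<Longrightarrow> G (j * b + s) = 1"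
  shows "(\<Prod>m<T * b. G (Suc m)) = (\<Prod>j<T. \<Prod>s\<in>R. G (j * b + s))"
proof -
  have "(\<Prod>m<T * b. G (Suc m)) = (\<Prod>j<T. \<Prod>m = j * b..<j * b + b. G (Suc m))"
    by (rule prod.nat_group[symmetric])
  also have "\<dots> = (\<Prod>j<T. \<Prod>s\<in>R. G (j * b + s))"
  proof (rule prod.cong[OF refl])
    fix j
    have "(\<Prod>m = j * b..<j * b + b. G (Suc m)) = (\<Prod>s\<in>{1..b}. G (j * b + s))"
      by (rule prod.reindex_bij_witness[of _ "\<lambda>s. j * b + s - 1" "\<lambda>m. Suc m - j * b"]) auto
    also have "\<dots> = (\<Prod>s\<in>R. G (j * b + s))"
      using R one by (intro prod.mono_neutral_right) auto
    finally show "(\<Prod>m = j * b..<j * b + b. G (Suc m)) = (\<Prod>s\<in>R. G (j * b + s))" .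
  qed
  finally show ?thesis .
qed

lemma tendsto_multiples:
  fixes f :: "nat \<Rightarrow> 'a::topological_space"
  assumes "f \<longlonglongrightarrow> L" "0 < b"
  shows "(\<lambda>T. f (T * b)) \<longlonglongrightarrow> L"
  using LIMSEQ_subseq_LIMSEQ[OF assms(1), of "\<lambda>T. T * b"] assms(2) by (simp add: strict_mono_def o_def)

lemma tendsto_power_blocks:
  fixes x q :: real
  assumes q: "0 \<le> q" "q < 1" and R: "finite R"
  shows "(\<lambda>T. \<Prod>j<T. \<Prod>s\<in>R. 1 + c s * q ^ j) \<longlonglongrightarrow> (\<Prod>s\<in>R. qp (c s) q)"
  by (subst prod.swap) (intro tendsto_prod qp_tendsto q)

lemma qp_minus_nonzero:
  assumes "0 < g" "g < (1::real)" "0 < m" "0 < s"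
  shows "qp (- (g ^ s)) (g ^ m) \<noteq> 0"
proof -
  have "0 < g ^ m" "g ^ m < 1" "0 < g ^ s" "g ^ s < 1" using assms by (auto simp: power_less_one_iff)
  then show ?thesis using qp_minus_bounds(3)[of "g ^ m" "g ^ s" "g ^ s"] by auto
qed

text \<open>Deleting the factors of three residue classes divides the limit by the corresponding
  theta product. The condition \<open>2 * \<rho> \<noteq> m\<close> keeps the classes of \<rho> and
  \<open>m - \<rho>\<close> apart.\<close>

lemma prod_avoiding_residues:
  fixes g :: real
  assumes g: "0 < g" "g < 1" and \<rho>: "0 < \<rho>" "\<rho> < m" "2 * \<rho> \<noteq> m"
    and F: "\<And>j. j mod m \<in> {0, \<rho>, m - \<rho>} \<Longrightarrow> F j = 1 - g ^ j"
    and lim: "(\<lambda>T. \<Prod>j<T * m. F (Suc j)) \<longlonglongrightarrow> A"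
  shows "(\<lambda>T. \<Prod>j<T * m. if Suc j mod m \<in> {0, \<rho>, m - \<rho>} then 1 else F (Suc j)) \<longlonglongrightarrow>
    A / (qp (- (g ^ m)) (g ^ m) * qp (- (g ^ \<rho>)) (g ^ m) * qp (- (g ^ (m - \<rho>))) (g ^ m))"
proof -
  define G where "G j = (if j mod m \<in> {0, \<rho>, m - \<rho>} then 1 - g ^ j else 1)" for j
  have gm: "0 < g ^ m" "g ^ m < 1" using g \<rho> by (auto simp: power_less_one_iff)
  have G0: "G (Suc j) \<noteq> 0" for j
  proof -
    have "g ^ Suc j < 1" using g by (intro power_Suc_less_one) auto
    then show ?thesis by (simp add: G_def)
  qed
  have nz: "qp (- (g ^ s)) (g ^ m) \<noteq> 0" if "s \<in> {m, \<rho>, m - \<rho>}" for s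
    using that g \<rho> by (intro qp_minus_nonzero) auto
  have "(\<Prod>j<T * m. G (Suc j)) = (\<Prod>j<T. \<Prod>s\<in>{m, \<rho>, m - \<rho>}. 1 + (- (g ^ s)) * (g ^ m) ^ j)" for T
  proof -
    have mods: "(j * m + s) mod m = (if s = m then 0 else s)" if "s \<in> {1..m}" for j s
      using that by auto
    have "(\<Prod>j<T * m. G (Suc j)) = (\<Prod>j<T. \<Prod>s\<in>{m, \<rho>, m - \<rho>}. G (j * m + s))"
      by (rule prod_blocks) (use \<rho> in \<open>auto simp: G_def mods\<close>)
    also have "\<dots> = (\<Prod>j<T. \<Prod>s\<in>{m, \<rho>, m - \<rho>}. 1 + (- (g ^ s)) * (g ^ m) ^ j)"
    proof (intro prod.cong refl)
      fix j s assume "s \<in> {m, \<rho>, m - \<rho>}"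
      then have "G (j * m + s) = 1 - g ^ (j * m + s)" using \<rho> by (auto simp: G_def mods)
      then show "G (j * m + s) = 1 + (- (g ^ s)) * (g ^ m) ^ j"
        by (simp add: power_add power_mult[symmetric] mult.commute)
    qed
    finally show ?thesis .
  qed
  then have "(\<lambda>T. \<Prod>j<T * m. G (Suc j)) \<longlonglongrightarrow> (\<Prod>s\<in>{m, \<rho>, m - \<rho>}. qp (- (g ^ s)) (g ^ m))"
    using gm by (simp only: tendsto_power_blocks less_imp_le finite.intros)
  moreover have "(\<Prod>s\<in>{m, \<rho>, m - \<rho>}. qp (- (g ^ s)) (g ^ m)) =
    qp (- (g ^ m)) (g ^ m) * qp (- (g ^ \<rho>)) (g ^ m) * qp (- (g ^ (m - \<rho>))) (g ^ m)"
    using \<rho> by (subst prod.insert; (subst prod.insert)?; auto simp: mult.assoc)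
  ultimately have "(\<lambda>T. (\<Prod>j<T * m. F (Suc j)) / (\<Prod>j<T * m. G (Suc j))) \<longlonglongrightarrow>
    A / (qp (- (g ^ m)) (g ^ m) * qp (- (g ^ \<rho>)) (g ^ m) * qp (- (g ^ (m - \<rho>))) (g ^ m))"
    using nz by (intro tendsto_divide lim) simp_all
  moreover have "(\<Prod>j<T * m. F (Suc j)) / (\<Prod>j<T * m. G (Suc j)) =
    (\<Prod>j<T * m. if Suc j mod m \<in> {0, \<rho>, m - \<rho>} then 1 else F (Suc j))" for T
    unfolding prod_dividef[symmetric]
  proof (intro prod.cong refl)
    fix j show "F (Suc j) / G (Suc j) = (if Suc j mod m \<in> {0, \<rho>, m - \<rho>} then 1 else F (Suc j))"
    proof (cases "Suc j mod m \<in> {0, \<rho>, m - \<rho>}")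
      case True
      then have "F (Suc j) = G (Suc j)" using F[OF True] by (simp only: G_def if_True)
      then show ?thesis using True G0[of j] by simp
    next
      case False
      then have "G (Suc j) = 1" by (simp only: G_def if_False)
      then show ?thesis using False by simp
    qed
  qed
  ultimately show ?thesis by simp
qed

lemma theta_quot_flip: "\<rho> \<le> m \<Longrightarrow> theta_quot g m (m - \<rho>) = theta_quot g m \<rho>"
  by (simp add: theta_quot_def mult_ac)

lemma prod_not_2_mod_4:
  fixes g :: real
  assumes g: "0 < g" "g < 1"
  shows "(\<lambda>K. \<Prod>j<4 * K. if Suc j mod 4 = 2 then 1 else 1 - g ^ Suc j) \<longlonglongrightarrow> qp (- g) (g\<^sup>2) * qp (- (g ^ 4)) (g ^ 4)"
proof -
  have g2: "0 \<le> g\<^sup>2" "g\<^sup>2 < 1" "0 \<le> g ^ 4" "g ^ 4 < 1" using g by (auto simp: power_less_one_iff)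
  have "(\<Prod>j<4 * K. if Suc j mod 4 = 2 then 1 else 1 - g ^ Suc j) =
    (\<Prod>i<K * 2. 1 + (- g) * (g\<^sup>2) ^ i) * (\<Prod>i<K. 1 + (- (g ^ 4)) * (g ^ 4) ^ i)" for K
  proof (induction K)
    case (Suc K)
    let ?f = "\<lambda>j. if Suc j mod 4 = 2 then 1 else 1 - g ^ Suc j"
    have m: "Suc (4 * K) mod 4 = 1" "Suc (Suc (4 * K)) mod 4 = 2" "Suc (Suc (Suc (4 * K))) mod 4 = 3"
      "Suc (Suc (Suc (Suc (4 * K)))) mod 4 = 0" by presburger+
    have e: "4 * Suc K = Suc (Suc (Suc (Suc (4 * K))))" "Suc K * 2 = Suc (Suc (K * 2))" by simp_all
    have b: "(g\<^sup>2) ^ (K * 2) = (g ^ K) ^ 4" "(g ^ 4) ^ K = (g ^ K) ^ 4" "g ^ (4 * K) = (g ^ K) ^ 4"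
      by (simp_all add: power_mult[symmetric] mult_ac)
    have p: "g ^ Suc (4 * K) = g * (g\<^sup>2) ^ (K * 2)" "g ^ Suc (Suc (Suc (4 * K))) = g * (g\<^sup>2) ^ (Suc (K * 2))"
      "g ^ Suc (Suc (Suc (Suc (4 * K)))) = g ^ 4 * (g ^ 4) ^ K"
      unfolding power_Suc b by (simp_all add: eval_nat_numeral mult_ac)
    show ?case unfolding e prod.lessThan_Suc Suc m p by (simp add: mult_ac)
  qed simp
  moreover have "(\<lambda>K. (\<Prod>i<K * 2. 1 + (- g) * (g\<^sup>2) ^ i) * (\<Prod>i<K. 1 + (- (g ^ 4)) * (g ^ 4) ^ i))
      \<longlonglongrightarrow> qp (- g) (g\<^sup>2) * qp (- (g ^ 4)) (g ^ 4)"
    using g2 by (intro tendsto_mult tendsto_multiples[OF qp_tendsto] qp_tendsto) auto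
  ultimately show ?thesis by simp
qed

text \<open>Multiplying the factors \<open>1 - g ^ j\<close> and \<open>1 + g ^ j\<close> for odd
  \<open>j\<close> gives \<open>1 - g ^ (2 * j)\<close>; together with the factors at multiples of 4
  these are all factors with even exponent.\<close>

lemma qp_odd_even:
  fixes g :: real
  assumes g: "0 < g" "g < 1"
  shows "qp (- g) (g\<^sup>2) * qp (- (g ^ 4)) (g ^ 4) * qp g (g\<^sup>2) = qp (- (g\<^sup>2)) (g\<^sup>2)"
proof -
  have g2: "0 \<le> g\<^sup>2" "g\<^sup>2 < 1" "0 \<le> g ^ 4" "g ^ 4 < 1" using g by (auto simp: power_less_one_iff)
  have lim: "(\<lambda>n. (\<Prod>i<n. 1 + (- g) * (g\<^sup>2) ^ i) * (\<Prod>i<n. 1 + (- (g ^ 4)) * (g ^ 4) ^ i) * (\<Prod>i<n. 1 + g * (g\<^sup>2) ^ i))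
    \<longlonglongrightarrow> qp (- g) (g\<^sup>2) * qp (- (g ^ 4)) (g ^ 4) * qp g (g\<^sup>2)"
    using g2 by (intro tendsto_mult qp_tendsto)
  have eq: "(\<Prod>i<n. 1 + (- g) * (g\<^sup>2) ^ i) * (\<Prod>i<n. 1 + (- (g ^ 4)) * (g ^ 4) ^ i) * (\<Prod>i<n. 1 + g * (g\<^sup>2) ^ i)
    = (\<Prod>i<n * 2. 1 + (- (g\<^sup>2)) * (g\<^sup>2) ^ i)" for n
  proof (induction n)
    case (Suc n)
    have e: "Suc n * 2 = Suc (Suc (n * 2))" by simp
    have p: "(g\<^sup>2) ^ n = (g ^ n)\<^sup>2" "(g\<^sup>2) ^ (n * 2) = (g ^ n) ^ 4" "(g ^ 4) ^ n = (g ^ n) ^ 4"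
      "(g\<^sup>2) ^ Suc (n * 2) = g\<^sup>2 * (g ^ n) ^ 4"
      by (simp_all add: power_mult[symmetric] mult_ac)
    have "(1 + (- g) * x\<^sup>2) * (1 + (- (g ^ 4)) * x ^ 4) * (1 + g * x\<^sup>2) =
      (1 + (- (g\<^sup>2)) * x ^ 4) * (1 + (- (g\<^sup>2)) * (g\<^sup>2 * x ^ 4))" for x
    proof -
      have d: "(1 + - u) * (1 + - v) * (1 + u) = (1 + - (u * u)) * (1 + - v)" for u v :: real
        by (simp add: algebra_simps)
      have ab: "(g * x\<^sup>2) * (g * x\<^sup>2) = g\<^sup>2 * x ^ 4" "g ^ 4 * x ^ 4 = g\<^sup>2 * (g\<^sup>2 * x ^ 4)"
        by (simp_all add: power4_eq_xxxx power2_eq_square mult_ac)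
      show ?thesis using d[of "g * x\<^sup>2" "g ^ 4 * x ^ 4"] unfolding ab mult_minus_left .
    qed
    then have "(1 + (- g) * (g\<^sup>2) ^ n) * (1 + (- (g ^ 4)) * (g ^ 4) ^ n) * (1 + g * (g\<^sup>2) ^ n) =
      (1 + (- (g\<^sup>2)) * (g\<^sup>2) ^ (n * 2)) * (1 + (- (g\<^sup>2)) * (g\<^sup>2) ^ Suc (n * 2))"
      unfolding p .
    then show ?case unfolding e prod.lessThan_Suc Suc[symmetric] by (simp add: mult_ac)
  qed simp
  have "(\<lambda>n. \<Prod>i<n * 2. 1 + (- (g\<^sup>2)) * (g\<^sup>2) ^ i) \<longlonglongrightarrow> qp (- (g\<^sup>2)) (g\<^sup>2)"
    using g2 by (intro tendsto_multiples[OF qp_tendsto]) auto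
  then show ?thesis using lim unfolding eq by (rule LIMSEQ_unique[symmetric])
qed

lemma cong_scaled:
  assumes "0 < d" "\<rho> < M"
  shows "[int (d * j) = int d * int \<rho>] (mod (int d * int M)) \<longleftrightarrow> j mod M = \<rho>"
proof -
  have "[int (d * j) = int d * int \<rho>] (mod (int d * int M)) \<longleftrightarrow> [d * j = d * \<rho>] (mod (d * M))"
    by (simp only: of_nat_mult[symmetric] cong_int_iff)
  also have "\<dots> \<longleftrightarrow> j mod M = \<rho> mod M" using assms by (simp add: cong_def mult_mod_right[symmetric])
  finally show ?thesis using assms by simp
qed

lemma cong_scaled_neg:
  assumes "0 < d" "0 < \<rho>" "\<rho> < M"
  shows "[int (d * j) = - (int d * int \<rho>)] (mod (int d * int M)) \<longleftrightarrow> j mod M = M - \<rho>"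
proof -
  have "[int (d * j) = - (int d * int \<rho>)] (mod (int d * int M)) \<longleftrightarrow> int d * int M dvd int d * int (j + \<rho>)"
    by (simp add: cong_iff_dvd_diff algebra_simps)
  also have "\<dots> \<longleftrightarrow> int M dvd int (j + \<rho>)" using assms by (subst dvd_times_left_cancel_iff) auto
  also have "\<dots> \<longleftrightarrow> (j mod M + \<rho>) mod M = 0" unfolding int_dvd_int_iff by (simp only: dvd_eq_mod_eq_0 mod_add_left_eq)
  also have "\<dots> \<longleftrightarrow> j mod M = M - \<rho>"
  proof -
    have "j mod M < M" using assms by simp
    then have "j mod M + \<rho> - M < M" using assms by linarith
    then have "(j mod M + \<rho> - M) mod M = j mod M + \<rho> - M" by (rule mod_less)
    then have "(j mod M + \<rho>) mod M = (if j mod M + \<rho> < M then j mod M + \<rho> else j mod M + \<rho> - M)"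
      by (cases "j mod M + \<rho> < M") (simp_all add: le_mod_geq)
    then show ?thesis using assms \<open>j mod M < M\<close> by (simp split: if_splits) linarith
  qed
  finally show ?thesis .
qed

section \<open>Comparison of the generating functions\<close>

locale AB_model = B0_model +
  fixes g :: real
  assumes sym: "\<And>i. i \<in> {1..l} \<Longrightarrow> \<alpha> i + \<alpha> (l + 1 - i) = \<eta>"
    and g: "0 < g" "g\<^sup>2 = Q ^ \<eta>"
begin

definition Z :: real where
  "Z = qp (g\<^sup>2) (g\<^sup>2) * (\<Prod>i\<in>{1..l}. qp (Q ^ \<alpha> i) (g\<^sup>2)) * theta_quot g (2 * (2 * k - 1 - l)) (2 * r - l)"

lemma g_less_1: "g < 1"
proof -
  have "g\<^sup>2 < 1" using g Q eta by (simp add: power_less_one_iff)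
  then show ?thesis using g(1) by (simp add: power_less_one_iff)
qed

lemma g2: "0 \<le> g\<^sup>2" "g\<^sup>2 < 1"
  using g(1) g_less_1 by (auto simp: power_less_one_iff)

definition ws :: "real list" where "ws = map (\<lambda>i. Q ^ \<alpha> (i + 1)) [0..<l]"

lemma length_ws [simp]: "length ws = l"
  by (simp add: ws_def)

lemma ws_pos: "\<forall>w\<in>set ws. 0 < w"
  using Q by (auto simp: ws_def)

lemma ws_sym:
  assumes "i < l"
  shows "ws ! i * ws ! (l - 1 - i) = g\<^sup>2"
proof -
  have "\<alpha> (i + 1) + \<alpha> (l + 1 - (i + 1)) = \<eta>" using assms by (intro sym) auto
  moreover have "l - 1 - i + 1 = l + 1 - (i + 1)" using assms by simp
  ultimately show ?thesis using assms unfolding g ws_def by (simp add: power_add[symmetric])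
qed

lemma prod_ws: "(\<Prod>w\<leftarrow>ws. f w) = (\<Prod>i\<in>{1..l}. f (Q ^ \<alpha> i))"
proof -
  have "(\<Prod>w\<leftarrow>ws. f w) = (\<Prod>i<l. f (Q ^ \<alpha> (Suc i)))"
    using prod.distinct_set_conv_list[of "[0..<l]" "\<lambda>i. f (Q ^ \<alpha> (Suc i))"]
    by (simp add: ws_def o_def atLeast0LessThan)
  also have "\<dots> = (\<Prod>i\<in>{1..l}. f (Q ^ \<alpha> i))"
    by (rule prod.reindex_bij_witness[of _ "\<lambda>i. i - 1" Suc]) auto
  finally show ?thesis .
qed

text \<open>The model without the bit has \<open>k - 1\<close> for \<open>k\<close> and admits only
  \<open>r \<le> k - 1\<close>. For \<open>r = k\<close> the exponents
  \<open>2 * (k - 1) - l\<close> and \<open>2 * k - l\<close> are complementary modulo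
  \<open>2 * (2 * k - 1 - l)\<close>.\<close>

lemma theta_quot_min: "theta_quot g (2 * (2 * k - 1 - l)) (2 * min r (k - 1) - l) = theta_quot g (2 * (2 * k - 1 - l)) (2 * r - l)"
proof (cases "r = k")
  case True
  then have "2 * min r (k - 1) - l = 2 * (2 * k - 1 - l) - (2 * r - l)" using k by simp
  moreover have "2 * r - l \<le> 2 * (2 * k - 1 - l)" using True k by simp
  ultimately show ?thesis by (simp only: theta_quot_flip)
next
  case False
  then have "min r (k - 1) = r" using r by simp
  then show ?thesis by simp
qed

lemma B0_sums_Z: "(\<lambda>n. real (B0 l \<alpha> \<eta> k r n) * Q ^ n) sums Z"
proof (rule B0_sums)
  define s where "s = min r (k - 1)"
  have s: "1 \<le> s" "l \<le> s" "s \<le> k - 1" using r k by (auto simp: s_def)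
  have all: "all_Fm (fms ws)" and occs: "occs (fms ws) = 0"
    by (auto simp: all_Fm_def fms_def occs_def o_def)
  have len: "length (fms ws) = l" by (simp add: fms_def)
  have "sweepsb (Q ^ \<eta>) T (sites v_init 0 p) (r - 1) 0 =
    (\<Prod>i<T. 1 + g\<^sup>2 * (g\<^sup>2) ^ i) * sweeps (g\<^sup>2) T (fms ws @ [Bo (g\<^sup>2) (k - 1 - s)]) (s - 1)" for T
  \<comment> \<open>For \<open>r = k\<close> there are no fictitious parts and the carrier starts
    one particle fuller: this is the second case of \<open>sweepsb_eq\<close>.\<close>
  proof (cases "r = k")
    case True
    then have "k - r = 0" "r - 1 = Suc (k - 2)" "k - 1 - s = 0" "s - 1 = k - 2" using k by (auto simp: s_def)
    then show ?thesis unfolding sites_v_init ws_def[symmetric] g(2)[symmetric]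
      using sweepsb_eq(2)[OF all, of "k - 2" 0] k len by simp
  next
    case False
    then have "s = r" using r by (simp add: s_def)
    have "length (fms ws) \<le> r - 1 + occs (fms ws) + (k - 1 - r)" "k - r + 0 + 0 = (k - 1 - r) + 1"
      using k len False r by simp_all
    from sweepsb_eq(1)[OF all this, of "g\<^sup>2" T "g\<^sup>2"] show ?thesis
      unfolding sites_v_init ws_def[symmetric] g(2)[symmetric] \<open>s = r\<close> by simp
  qed
  moreover have "(\<lambda>T. (\<Prod>i<T. 1 + g\<^sup>2 * (g\<^sup>2) ^ i) * sweeps (g\<^sup>2) T (fms ws @ [Bo (g\<^sup>2) (k - 1 - s)]) (s - 1))
    \<longlonglongrightarrow> qp (g\<^sup>2) (g\<^sup>2) * gf (g\<^sup>2) (fms ws @ [Bo (g\<^sup>2) (k - 1 - s)]) (s - 1)"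
  proof (intro tendsto_mult qp_tendsto sweeps_tendsto g2)
    show "small (1 / (1 - g\<^sup>2)) (fms ws @ [Bo (g\<^sup>2) (k - 1 - s)])"
      using ws_pos g2 by (auto simp: less_imp_le le_divide_eq)
  qed
  moreover have "gf (g\<^sup>2) (fms ws @ [Bo (g\<^sup>2) (k - 1 - s)]) (s - 1)
    = (\<Prod>i\<in>{1..l}. qp (Q ^ \<alpha> i) (g\<^sup>2)) * theta_quot g (2 * (2 * k - 1 - l)) (2 * r - l)"
  proof -
    have e: "2 * (k - 1) + 1 - l = 2 * k - 1 - l" using k by simp
    show ?thesis
      using gf_symmetric[OF g(1) g_less_1 ws_pos, of s "k - 1"] ws_sym s
      unfolding length_ws prod_ws e theta_quot_min[symmetric] s_def[symmetric] by simp
  qed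
  ultimately show "(\<lambda>T. sweepsb (Q ^ \<eta>) T (sites v_init 0 p) (r - 1) 0) \<longlonglongrightarrow> Z"
    by (simp add: Z_def mult.assoc)
qed

text \<open>The subset \<open>S\<close> serves the case of odd \<open>l\<close>, where the middle
  residue may not be overlined.\<close>

lemma overlined_product:
  assumes S: "S \<subseteq> {1..l}"
  shows "(\<lambda>T. \<Prod>m<T * \<eta>. if Suc m mod \<eta> = 0 \<or> (\<exists>i\<in>S. Suc m mod \<eta> = \<alpha> i) then 1 + Q ^ Suc m else 1)
    \<longlonglongrightarrow> qp (g\<^sup>2) (g\<^sup>2) * (\<Prod>i\<in>S. qp (Q ^ \<alpha> i) (g\<^sup>2))"
proof -
  let ?R = "insert \<eta> (\<alpha> ` S)"
  define F where "F m = (if m mod \<eta> = 0 \<or> (\<exists>i\<in>S. m mod \<eta> = \<alpha> i) then 1 + Q ^ m else 1)" for m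
  have \<alpha>S: "0 < \<alpha> i" "\<alpha> i < \<eta>" if "i \<in> S" for i using alpha S that by auto
  have mods: "(j * \<eta> + s) mod \<eta> = (if s = \<eta> then 0 else s)" if "s \<in> {1..\<eta>}" for j s
    using that by auto
  have fin: "finite S" using S finite_subset by blast
  have "(\<Prod>m<T * \<eta>. F (Suc m)) = (\<Prod>j<T. \<Prod>s\<in>?R. 1 + Q ^ s * (g\<^sup>2) ^ j)" for T
  proof -
    have "(\<Prod>m<T * \<eta>. F (Suc m)) = (\<Prod>j<T. \<Prod>s\<in>?R. F (j * \<eta> + s))"
    proof (rule prod_blocks)
      show "?R \<subseteq> {1..\<eta>}" using \<alpha>S eta by force
      show "F (j * \<eta> + s) = 1" if "s \<in> {1..\<eta>} - ?R" for j s
        using that mods[of s j] unfolding F_def by auto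
    qed
    also have "\<dots> = (\<Prod>j<T. \<Prod>s\<in>?R. 1 + Q ^ s * (g\<^sup>2) ^ j)"
    proof (intro prod.cong refl)
      fix j s assume s: "s \<in> ?R"
      then have "s \<in> {1..\<eta>}" using \<alpha>S eta by force
      then have "F (j * \<eta> + s) = 1 + Q ^ (j * \<eta> + s)" using s mods[of s j] unfolding F_def by auto
      then show "F (j * \<eta> + s) = 1 + Q ^ s * (g\<^sup>2) ^ j"
        by (simp add: g power_add power_mult[symmetric] mult.commute)
    qed
    finally show ?thesis .
  qed
  moreover have "(\<lambda>T. \<Prod>j<T. \<Prod>s\<in>?R. 1 + Q ^ s * (g\<^sup>2) ^ j) \<longlonglongrightarrow> (\<Prod>s\<in>?R. qp (Q ^ s) (g\<^sup>2))"
    using fin by (intro tendsto_power_blocks g2) simp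
  moreover have "(\<Prod>s\<in>?R. qp (Q ^ s) (g\<^sup>2)) = qp (g\<^sup>2) (g\<^sup>2) * (\<Prod>i\<in>S. qp (Q ^ \<alpha> i) (g\<^sup>2))"
  proof -
    have "\<eta> \<notin> \<alpha> ` S" using \<alpha>S by blast
    moreover have "inj_on \<alpha> S" using inj_on_subset[OF strict_mono_on_imp_inj_on[OF alpha_mono] S] .
    ultimately show ?thesis using fin by (simp add: prod.reindex g)
  qed
  ultimately show ?thesis by (simp add: F_def)
qed

abbreviation M0 :: nat where "M0 \<equiv> 2 * k - 1 - l"

abbreviation "good \<equiv> \<lambda>p. allowed_size l \<eta> \<alpha> (psize p) \<and> A0_part l \<eta> k r p"

lemma A0_sums:
  assumes over: "(\<lambda>T. \<Prod>m<T * \<eta>. if good (Part (Suc m) True) then 1 + Q ^ Suc m else 1) \<longlonglongrightarrow> X"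
    and plain: "(\<lambda>T. \<Prod>m<T * (M0 * \<eta>). if good (Part (Suc m) False) then 1 - Q ^ Suc m else 1) \<longlonglongrightarrow> Y"
    and "Y \<noteq> 0" "X / Y = Z"
  shows "(\<lambda>n. real (A0 l \<alpha> \<eta> k r n) * Q ^ n) sums Z"
proof -
  have M0: "0 < M0" using k by simp
  have "(\<lambda>n. real (card (overpartitions_in good n)) * Q ^ n) sums (X / Y)"
  \<comment> \<open>\<open>M0 * \<eta>\<close> is a period of both products; the overlined one
    already has period \<eta>.\<close>
  proof (rule overpartitions_in_sums[OF Q, where f = "\<lambda>T. T * (M0 * \<eta>)"])
    have "1 \<le> M0 * \<eta>" using M0 eta by simp
    then show "T \<le> T * (M0 * \<eta>)" for T by simp
    show "(\<lambda>T. \<Prod>m<T * (M0 * \<eta>). (if good (Part (Suc m) True) then 1 + Q ^ Suc m else 1) /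
            (if good (Part (Suc m) False) then 1 - Q ^ Suc m else 1)) \<longlonglongrightarrow> X / Y"
      unfolding prod_dividef using tendsto_multiples[OF over M0] assms(3) plain
      by (intro tendsto_divide) (simp_all add: mult.assoc)
  qed
  then show ?thesis
    unfolding \<open>X / Y = Z\<close> by (simp add: A0_def A0_set_def overpartitions_in_def)
qed

lemma M_int: "2 * int k - int l - 1 = int M0"
  using k by simp

lemma A0_sums_even:
  assumes l: "even l"
  shows "(\<lambda>n. real (A0 l \<alpha> \<eta> k r n) * Q ^ n) sums Z"
proof (rule A0_sums)
  \<comment> \<open>In units of \<eta> the forbidden classes are 0, \<rho> and
    \<open>- \<rho>\<close> modulo \<open>M0\<close>. As \<open>M0\<close> is odd for even
    \<open>l\<close>, the last two are distinct.\<close>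
  define \<rho> where "\<rho> = r - l div 2"
  have l2: "2 * (l div 2) = l" using l by simp
  have \<rho>: "0 < \<rho>" "\<rho> < M0" "2 * \<rho> \<noteq> M0" "2 * \<rho> = 2 * r - l" "int r - int l div 2 = int \<rho>"
  proof -
    have "M0 + 1 = 2 * (k - l div 2)" using l2 k by linarith
    then have "odd M0" by presburger
    then show "2 * \<rho> \<noteq> M0" by (metis dvd_triv_left)
    show "0 < \<rho>" "\<rho> < M0" "2 * \<rho> = 2 * r - l" using r k l2 unfolding \<rho>_def by linarith+
    show "int r - int l div 2 = int \<rho>" using r l2 unfolding \<rho>_def by (simp add: of_nat_diff zdiv_int)
  qed
  let ?D = "qp (- ((g\<^sup>2) ^ M0)) ((g\<^sup>2) ^ M0) * qp (- ((g\<^sup>2) ^ \<rho>)) ((g\<^sup>2) ^ M0) * qp (- ((g\<^sup>2) ^ (M0 - \<rho>))) ((g\<^sup>2) ^ M0)"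
  have g2': "0 < g\<^sup>2" using g(1) by simp
  show "(\<lambda>T. \<Prod>m<T * \<eta>. if good (Part (Suc m) True) then 1 + Q ^ Suc m else 1) \<longlonglongrightarrow>
    qp (g\<^sup>2) (g\<^sup>2) * (\<Prod>i\<in>{1..l}. qp (Q ^ \<alpha> i) (g\<^sup>2))"
    using overlined_product[of "{1..l}"] l by (simp add: allowed_size_iff A0_part_def)
  have good: "good (Part (j * \<eta>) False) \<longleftrightarrow> j mod M0 \<notin> {0, \<rho>, M0 - \<rho>}" for j
  proof -
    have c: "[int (j * \<eta>) = 0] (mod (int \<eta> * int M0)) \<longleftrightarrow> j mod M0 = 0"
      "[int (j * \<eta>) = int \<eta> * int \<rho>] (mod (int \<eta> * int M0)) \<longleftrightarrow> j mod M0 = \<rho>"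
      "[int (j * \<eta>) = - (int \<eta> * int \<rho>)] (mod (int \<eta> * int M0)) \<longleftrightarrow> j mod M0 = M0 - \<rho>"
      using cong_scaled[OF eta, of 0 M0 j] cong_scaled[OF eta \<rho>(2), of j] cong_scaled_neg[OF eta \<rho>(1,2), of j] \<rho>
      by (simp_all only: mult.commute[of j] of_nat_0 mult_zero_right)
    show ?thesis
      using l unfolding A0_part_def Let_def M_int \<rho>(5) part.sel c allowed_size_iff by simp
  qed
  have "(\<Prod>m<T * (M0 * \<eta>). if good (Part (Suc m) False) then 1 - Q ^ Suc m else 1) =
    (\<Prod>j<T * M0. if Suc j mod M0 \<in> {0, \<rho>, M0 - \<rho>} then 1 else 1 - (g\<^sup>2) ^ Suc j)" for T
  proof -
    have "(\<Prod>m<(T * M0) * \<eta>. if good (Part (Suc m) False) then 1 - Q ^ Suc m else 1) =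
      (\<Prod>j<T * M0. \<Prod>s\<in>{\<eta>}. if good (Part (j * \<eta> + s) False) then 1 - Q ^ (j * \<eta> + s) else 1)"
    proof (rule prod_blocks)
      show "{\<eta>} \<subseteq> {1..\<eta>}" using eta by simp
      fix j s assume "s \<in> {1..\<eta>} - {\<eta>}"
      then have "\<not> \<eta> dvd j * \<eta> + s" by (auto dest: dvd_imp_le)
      then have "\<not> int \<eta> dvd int (j * \<eta> + s)" unfolding int_dvd_int_iff .
      then have "\<not> good (Part (j * \<eta> + s) False)" using l unfolding A0_part_def Let_def by simp
      then show "(if good (Part (j * \<eta> + s) False) then 1 - Q ^ (j * \<eta> + s) else 1) = 1" by (simp only: if_False)
    qed
    also have "\<dots> = (\<Prod>j<T * M0. if Suc j mod M0 \<in> {0, \<rho>, M0 - \<rho>} then 1 else 1 - (g\<^sup>2) ^ Suc j)"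
    proof (rule prod.cong[OF refl])
      fix j
      have "j * \<eta> + \<eta> = Suc j * \<eta>" "Q ^ (Suc j * \<eta>) = (g\<^sup>2) ^ Suc j"
        unfolding g by (simp_all add: power_mult[symmetric] power_add mult.commute)
      then show "(\<Prod>s\<in>{\<eta>}. if good (Part (j * \<eta> + s) False) then 1 - Q ^ (j * \<eta> + s) else 1) =
        (if Suc j mod M0 \<in> {0, \<rho>, M0 - \<rho>} then 1 else 1 - (g\<^sup>2) ^ Suc j)"
        using good[of "Suc j"] by (simp only: prod.insert finite.emptyI empty_iff prod.empty mult_1_right if_not_P if_P simp_thms split: if_splits) auto
    qed
    finally show ?thesis by (simp only: mult.assoc)
  qed
  moreover have "(\<lambda>T. \<Prod>j<T * M0. if Suc j mod M0 \<in> {0, \<rho>, M0 - \<rho>} then 1 else 1 - (g\<^sup>2) ^ Suc j) \<longlonglongrightarrow>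
    qp (- (g\<^sup>2)) (g\<^sup>2) / ?D"
  proof (rule prod_avoiding_residues[OF g2' g2(2) \<rho>(1-3), where F = "\<lambda>j. 1 - (g\<^sup>2) ^ j"])
    have "(\<lambda>T. \<Prod>j<T * M0. 1 + (- (g\<^sup>2)) * (g\<^sup>2) ^ j) \<longlonglongrightarrow> qp (- (g\<^sup>2)) (g\<^sup>2)"
      using \<rho> by (intro tendsto_multiples[OF qp_tendsto] g2) auto
    then show "(\<lambda>T. \<Prod>j<T * M0. 1 - (g\<^sup>2) ^ Suc j) \<longlonglongrightarrow> qp (- (g\<^sup>2)) (g\<^sup>2)" by simp
  qed simp
  ultimately show "(\<lambda>T. \<Prod>m<T * (M0 * \<eta>). if good (Part (Suc m) False) then 1 - Q ^ Suc m else 1) \<longlonglongrightarrow>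
    qp (- (g\<^sup>2)) (g\<^sup>2) / ?D" by (simp only:)
  have nz: "qp (- (g\<^sup>2)) (g\<^sup>2) \<noteq> 0" "?D \<noteq> 0"
    using qp_minus_nonzero[OF g2' g2(2), of 1 1] \<rho> qp_minus_nonzero[OF g2' g2(2)] by simp_all
  then show "qp (- (g\<^sup>2)) (g\<^sup>2) / ?D \<noteq> 0" by simp
  have "theta_quot g (2 * M0) (2 * r - l) = ?D / qp (- (g\<^sup>2)) (g\<^sup>2)"
    unfolding \<rho>(4)[symmetric] theta_quot_def diff_mult_distrib2[symmetric] power_mult by simp
  then show "qp (g\<^sup>2) (g\<^sup>2) * (\<Prod>i\<in>{1..l}. qp (Q ^ \<alpha> i) (g\<^sup>2)) / (qp (- (g\<^sup>2)) (g\<^sup>2) / ?D) = Z"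
    by (simp add: Z_def)
qed

text \<open>By symmetry the middle residue is \<open>h = \<eta> / 2\<close>, so that
  \<open>g = Q ^ h\<close>. Its factor in \<open>Z\<close>, which overlined parts do not provide,
  comes from the plain parts through \<open>qp_odd_even\<close>: these are multiples
  \<open>j * h\<close> with \<open>j\<close> not congruent to 2 modulo 4.\<close>

lemma A0_sums_odd:
  assumes l: "odd l"
  shows "(\<lambda>n. real (A0 l \<alpha> \<eta> k r n) * Q ^ n) sums Z"
proof (rule A0_sums)
  define mid where "mid = (l + 1) div 2"
  define h where "h = \<alpha> mid"
  define \<rho> where "\<rho> = 2 * r - l"
  define m where "m = 2 * M0"
  define S where "S = {1..l} - {mid}"
  have mid: "mid \<in> {1..l}" "l + 1 - mid = mid" using l by (auto simp: mid_def elim!: oddE)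
  have h: "\<eta> = 2 * h" "0 < h" using sym[OF mid(1)] alpha[OF mid(1)] mid(2) by (auto simp: h_def)
  have gQ: "g = Q ^ h"
  proof (rule power2_eq_imp_eq)
    show "g\<^sup>2 = (Q ^ h)\<^sup>2" using g h by (simp add: power_mult[symmetric] mult.commute)
  qed (use g Q in auto)
  define c where "c = k - (l + 1) div 2"
  have c: "M0 = 2 * c" "0 < c" "m = 4 * c"
  proof -
    have "2 * ((l + 1) div 2) = l + 1" using l by simp
    then show "M0 = 2 * c" "0 < c" using k unfolding c_def by linarith+
    then show "m = 4 * c" unfolding m_def by linarith
  qed
  have \<rho>: "0 < \<rho>" "\<rho> < m" "2 * \<rho> \<noteq> m" "odd \<rho>" "4 dvd m" "0 < m"
  proof -
    have "0 < l" using l by (cases l) auto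
    then show "0 < \<rho>" "\<rho> < m" "0 < m" using r k unfolding \<rho>_def m_def by linarith+
    have "l + \<rho> = 2 * r" using r unfolding \<rho>_def by linarith
    then show o: "odd \<rho>" using l by presburger
    show "4 dvd m" unfolding c by simp
    show "2 * \<rho> \<noteq> m" using o unfolding c by presburger
  qed
  let ?D = "qp (- (g ^ m)) (g ^ m) * qp (- (g ^ \<rho>)) (g ^ m) * qp (- (g ^ (m - \<rho>))) (g ^ m)"
  let ?A = "qp (- g) (g\<^sup>2) * qp (- (g ^ 4)) (g ^ 4)"
  have e: "int \<eta> div 2 = int h" "int \<eta> = int h * int 2" "2 * int \<eta> = int h * int 4"
    "int \<eta> * int M0 = int h * int m" "int \<eta> * (2 * int r - int l) div 2 = int h * int \<rho>"
  proof -
    have "2 * int r - int l = int \<rho>" using r unfolding \<rho>_def by simp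
    then show "int \<eta> * (2 * int r - int l) div 2 = int h * int \<rho>" using h by simp
    show "int \<eta> div 2 = int h" "int \<eta> = int h * int 2" "2 * int \<eta> = int h * int 4" using h by simp_all
    show "int \<eta> * int M0 = int h * int m" unfolding h m_def by simp
  qed
  have over: "good (Part n True) \<longleftrightarrow> n mod \<eta> = 0 \<or> (\<exists>i\<in>S. n mod \<eta> = \<alpha> i)" for n
  proof -
    have "[int n = int h] (mod int \<eta>) \<longleftrightarrow> n mod \<eta> = h"
      using h by (subst cong_int_iff) (simp add: cong_def)
    then have "good (Part n True) \<longleftrightarrow> (n mod \<eta> = 0 \<or> (\<exists>i\<in>{1..l}. n mod \<eta> = \<alpha> i)) \<and> n mod \<eta> \<noteq> h"
      using l unfolding A0_part_def Let_def e(1) allowed_size_iff by simp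
    moreover have "(\<exists>i\<in>S. n mod \<eta> = \<alpha> i) \<longleftrightarrow> (\<exists>i\<in>{1..l}. n mod \<eta> = \<alpha> i) \<and> n mod \<eta> \<noteq> h"
      unfolding S_def h_def
      using inj_onD[OF strict_mono_on_imp_inj_on[OF alpha_mono] _ _ mid(1)] by auto
    ultimately show ?thesis using h(2) by auto
  qed
  show "(\<lambda>T. \<Prod>m<T * \<eta>. if good (Part (Suc m) True) then 1 + Q ^ Suc m else 1) \<longlonglongrightarrow>
    qp (g\<^sup>2) (g\<^sup>2) * (\<Prod>i\<in>S. qp (Q ^ \<alpha> i) (g\<^sup>2))"
    unfolding over by (rule overlined_product) (auto simp: S_def)
  have good: "good (Part (j * h) False) \<longleftrightarrow> j mod 4 \<noteq> 2 \<and> j mod m \<notin> {0, \<rho>, m - \<rho>}" for j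
  proof -
    have two: "(2::nat) < 4" by simp
    have c: "[int (h * j) = 0] (mod (int h * int m)) \<longleftrightarrow> j mod m = 0"
      "[int (h * j) = int h * int \<rho>] (mod (int h * int m)) \<longleftrightarrow> j mod m = \<rho>"
      "[int (h * j) = - (int h * int \<rho>)] (mod (int h * int m)) \<longleftrightarrow> j mod m = m - \<rho>"
      "[int (h * j) = int h * int 2] (mod (int h * int 4)) \<longleftrightarrow> j mod 4 = 2"
      using cong_scaled[OF h(2) \<rho>(6), of j] cong_scaled[OF h(2) \<rho>(2), of j] cong_scaled_neg[OF h(2) \<rho>(1,2), of j]
        cong_scaled[OF h(2) two, of j]
      by (simp_all only: of_nat_0 mult_zero_right)
    have "h * j mod \<eta> = h * (j mod 2)" unfolding h by (metis mult.commute mult_mod_right)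
    then have "h * j mod \<eta> = 0 \<or> h * j mod \<eta> = \<alpha> mid" by (cases "even j") (auto simp: h_def odd_iff_mod_2_eq_one)
    then have a: "allowed_size l \<eta> \<alpha> (h * j)" unfolding allowed_size_iff using mid(1) by blast
    have d: "int h dvd int (h * j)" by simp
    show ?thesis
      using l a d unfolding A0_part_def Let_def M_int e(1,3,4,5) part.sel mult.commute[of j h]
      unfolding e(2) c by simp
  qed
  let ?F = "\<lambda>j. if j mod 4 = 2 then 1 else 1 - g ^ j"
  have "(\<Prod>n<T * (M0 * \<eta>). if good (Part (Suc n) False) then 1 - Q ^ Suc n else 1) =
    (\<Prod>j<T * m. if Suc j mod m \<in> {0, \<rho>, m - \<rho>} then 1 else ?F (Suc j))" for T
  proof -
    have "(\<Prod>n<(T * m) * h. if good (Part (Suc n) False) then 1 - Q ^ Suc n else 1) =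
      (\<Prod>j<T * m. \<Prod>s\<in>{h}. if good (Part (j * h + s) False) then 1 - Q ^ (j * h + s) else 1)"
    proof (rule prod_blocks)
      show "{h} \<subseteq> {1..h}" using h by simp
      fix j s assume "s \<in> {1..h} - {h}"
      then have "\<not> h dvd j * h + s" by (auto dest: dvd_imp_le)
      then have "\<not> int h dvd int (j * h + s)" unfolding int_dvd_int_iff .
      then have "\<not> good (Part (j * h + s) False)" using l unfolding A0_part_def Let_def e(1) by simp
      then show "(if good (Part (j * h + s) False) then 1 - Q ^ (j * h + s) else 1) = 1" by (simp only: if_False)
    qed
    also have "\<dots> = (\<Prod>j<T * m. if Suc j mod m \<in> {0, \<rho>, m - \<rho>} then 1 else ?F (Suc j))"
    proof (rule prod.cong[OF refl])
      fix j
      have jh: "j * h + h = Suc j * h" "Q ^ (Suc j * h) = g ^ Suc j"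
        unfolding gQ by (simp_all only: power_mult[symmetric] mult.commute) simp
      have single: "(\<Prod>s\<in>{h}. f s) = f h" for f :: "nat \<Rightarrow> real" by simp
      show "(\<Prod>s\<in>{h}. if good (Part (j * h + s) False) then 1 - Q ^ (j * h + s) else 1) =
        (if Suc j mod m \<in> {0, \<rho>, m - \<rho>} then 1 else ?F (Suc j))"
        unfolding single jh good by presburger
    qed
    finally show ?thesis by (simp only: m_def h(1) mult_ac)
  qed
  moreover have "(\<lambda>T. \<Prod>j<T * m. if Suc j mod m \<in> {0, \<rho>, m - \<rho>} then 1 else ?F (Suc j)) \<longlonglongrightarrow> ?A / ?D"
  proof (rule prod_avoiding_residues[OF g(1) g_less_1 \<rho>(1-3), where F = ?F])
    have M: "T * m = 4 * (T * c)" for T unfolding c by simp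
    from c(2) show "(\<lambda>T. \<Prod>j<T * m. ?F (Suc j)) \<longlonglongrightarrow> ?A"
      unfolding M by (rule tendsto_multiples[OF prod_not_2_mod_4[OF g(1) g_less_1]])
    \<comment> \<open>Since \<rho> is odd and 4 divides \<open>m\<close>, the three forbidden
      classes contain no number congruent to 2 modulo 4, and no factor is excluded twice.\<close>
    show "?F j = 1 - g ^ j" if "j mod m \<in> {0, \<rho>, m - \<rho>}" for j
    proof -
      have "j mod m mod 4 = j mod 4" using \<rho>(5) by (rule mod_mod_cancel)
      moreover have "odd (m - \<rho>)" using \<rho>(2,4) unfolding c by presburger
      then have "j mod m = 0 \<or> odd (j mod m)" using that \<rho>(4) by (metis empty_iff insert_iff)
      moreover have "x mod 4 \<noteq> 2" if "x = 0 \<or> odd x" for x :: nat using that by presburger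
      ultimately have "j mod 4 \<noteq> 2" by metis
      then show ?thesis by simp
    qed
  qed
  ultimately show "(\<lambda>T. \<Prod>n<T * (M0 * \<eta>). if good (Part (Suc n) False) then 1 - Q ^ Suc n else 1) \<longlonglongrightarrow> ?A / ?D"
    by (simp only:)
  have B: "qp g (g\<^sup>2) \<noteq> 0" using qp_ge_1[OF g2, of g] g by simp
  have "qp (- (g\<^sup>2)) (g\<^sup>2) \<noteq> 0"
    using qp_minus_nonzero[OF g(1) g_less_1, of 2 2] by simp
  then have A: "?A \<noteq> 0" unfolding qp_odd_even[OF g(1) g_less_1, symmetric] by simp
  have D: "?D \<noteq> 0" using \<rho> qp_minus_nonzero[OF g(1) g_less_1] by simp
  show "?A / ?D \<noteq> 0" using A D by simp
  have "theta_quot g (2 * M0) (2 * r - l) = ?D / (?A * qp g (g\<^sup>2))"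
    unfolding theta_quot_def qp_odd_even[OF g(1) g_less_1] \<rho>_def[symmetric] m_def[symmetric] ..
  moreover have "(\<Prod>i\<in>{1..l}. qp (Q ^ \<alpha> i) (g\<^sup>2)) = qp g (g\<^sup>2) * (\<Prod>i\<in>S. qp (Q ^ \<alpha> i) (g\<^sup>2))"
    unfolding S_def using prod.remove[OF _ mid(1)] by (simp add: gQ h_def)
  ultimately show "qp (g\<^sup>2) (g\<^sup>2) * (\<Prod>i\<in>S. qp (Q ^ \<alpha> i) (g\<^sup>2)) / (?A / ?D) = Z"
    using A B D by (simp add: Z_def)
qed

lemma A0_sums_Z: "(\<lambda>n. real (A0 l \<alpha> \<eta> k r n) * Q ^ n) sums Z"
  using A0_sums_even A0_sums_odd by blast

end

text \<open>A first nonzero coefficient of the difference would be the limit of the difference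
  series divided by \<open>Q ^ n\<close> as \<open>Q\<close> tends to 0; the limit is taken from the
  right because only positive \<open>Q\<close> are available.\<close>

lemma sums_coeffs_unique:
  fixes c d :: "nat \<Rightarrow> real"
  assumes "\<And>Q. 0 < Q \<Longrightarrow> Q < 1 \<Longrightarrow> \<exists>Z. (\<lambda>n. c n * Q ^ n) sums Z \<and> (\<lambda>n. d n * Q ^ n) sums Z"
  shows "c n = d n"
proof -
  define e where "e n = c n - d n" for n
  have e0: "(\<lambda>n. e n * Q ^ n) sums 0" if "0 < Q" "Q < 1" for Q
    using assms[OF that] sums_diff by (fastforce simp: e_def algebra_simps)
  have "e n = 0"
  proof (induction n rule: less_induct)
    case (less n)
    have shifted: "(\<lambda>i. e (i + n) * Q ^ i) sums 0" if Q: "0 < Q" "Q < 1" for Q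
    proof -
      have "(\<Sum>i<n. e i * Q ^ i) = 0" using less by simp
      then have "(\<lambda>i. e (i + n) * Q ^ (i + n)) sums 0"
        using sums_split_initial_segment[OF e0[OF Q], of n] by simp
      then have "(\<lambda>i. e (i + n) * Q ^ (i + n) / Q ^ n) sums (0 / Q ^ n)" by (rule sums_divide)
      then show ?thesis using Q by (simp add: power_add)
    qed
    define f where "f Q = (\<Sum>i. e (i + n) * Q ^ i)" for Q
    have "summable (\<lambda>i. e (i + n) * (1 / 2) ^ i)" using shifted[of "1 / 2"] by (simp add: sums_iff)
    then have "isCont f 0" unfolding f_def by (intro isCont_powser) auto
    then have "f \<midarrow>0\<rightarrow> f 0" by (simp add: isCont_def)
    then have "(f \<longlongrightarrow> f 0) (at_right 0)" by (rule filterlim_at_split[THEN iffD1, THEN conjunct2])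
    moreover have "(f \<longlongrightarrow> 0) (at_right 0)"
    proof (rule tendsto_eventually)
      have "eventually (\<lambda>x. x \<in> {0<..<1}) (at_right (0::real))" by (rule eventually_at_right_real) simp
      then show "\<forall>\<^sub>F x in at_right 0. f x = 0"
        by eventually_elim (use shifted in \<open>auto simp: f_def sums_iff\<close>)
    qed
    ultimately have "f 0 = 0" using tendsto_unique trivial_limit_at_right_real by blast
    then show "e n = 0" by (simp add: f_def powser_zero)
  qed
  then show ?thesis by (simp add: e_def)
qed

text \<open>The condition \<open>r \<ge> 1\<close> excludes \<open>r = l = 0\<close>, where no list
  has at most -1 small parts, while the empty overpartition of 0 belongs to
  \<open>A0_set\<close>.\<close>

theorem theorem1p17:
  fixes l \<eta> k r n :: nat and \<alpha> :: "nat \<Rightarrow> nat"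
  assumes "0 < \<eta>"
    and "\<And>i. i \<in> {1..l} \<Longrightarrow> 0 < \<alpha> i \<and> \<alpha> i < \<eta>"
    and "strict_mono_on {1..l} \<alpha>"
    and "\<And>i. i \<in> {1..l} \<Longrightarrow> int (\<alpha> i) = int \<eta> - int (\<alpha> (l + 1 - i))"
    and "k \<ge> r" and "r \<ge> l" and "int k - 1 > int l"
    and "r \<ge> 1"
  shows "A0 l \<alpha> \<eta> k r n = B0 l \<alpha> \<eta> k r n"
proof -
  have "\<exists>Z. (\<lambda>n. real (A0 l \<alpha> \<eta> k r n) * Q ^ n) sums Z \<and> (\<lambda>n. real (B0 l \<alpha> \<eta> k r n) * Q ^ n) sums Z"
    if Q: "0 < Q" "Q < 1" for Q :: real
  proof -
    have "residues l \<eta> \<alpha>" by unfold_locales (use assms in auto)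
    moreover have "B0_model_axioms l k r Q" by unfold_locales (use assms Q in auto)
    moreover have "AB_model_axioms l \<eta> \<alpha> Q (sqrt (Q ^ \<eta>))"
    proof
      show "\<alpha> i + \<alpha> (l + 1 - i) = \<eta>" if "i \<in> {1..l}" for i using assms(4)[OF that] by linarith
    qed (use Q in auto)
    ultimately interpret AB_model l \<eta> \<alpha> k r Q "sqrt (Q ^ \<eta>)"
      by (simp add: AB_model_def B0_model_def)
    show ?thesis using A0_sums_Z B0_sums_Z by blast
  qed
  then have "real (A0 l \<alpha> \<eta> k r n) = real (B0 l \<alpha> \<eta> k r n)" by (rule sums_coeffs_unique)
  then show ?thesis by simp
qed

end
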